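(* The group $\mathbb{G}$ is a real Banach-Lie group endowed with the norm topology of $\mathcal{B}(H^1_0)$.
   Context: Let $\Omega\subset\mathbb{R}^n$ be open, $L^2=L^2(\Omega,dx)$ the complex Lebesgue space with its usual inner product $\langle\cdot,\cdot\rangle$, and $H^1_0=H^1_0(\Omega)$ the closure in the Sobolev norm of the complex-valued $C^\infty$ functions with compact support in $\Omega$. $H^1_0$ is a Hilbert space with inner product $[f,g]=\int_\Omega f\bar g\,dx+\int_\Omega\nabla f\cdot\nabla\bar g\,dx$. $\mathcal{B}(H^1_0)$ is the algebra of bounded linear operators on $H^1_0$ with the operator norm, and $Gl(H^1_0)$ is its group of invertible elements. $\mathbb{G}=\{G\in Gl(H^1_0):\langle Gf,Gg\rangle=\langle f,g\rangle\ \text{for all } f,g\in H^1_0\}$. *)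

theory Defs
  imports "HOL-Analysis.Analysis" "HOL-Algebra.Group"
begin

section \<open>Normed spaces on an explicit carrier\<close>

text \<open>
  The space \<open>H\<^sup>1\<^sub>0(\<Omega>)\<close> depends on the term \<open>\<Omega>\<close>, hence so do the operators on it and the model
  space of the Lie group; none of them can be a type. Normed spaces are therefore records.
\<close>

record ('k, 'a) nvs = "'a partial_object" +
  vadd :: "'a \<Rightarrow> 'a \<Rightarrow> 'a"
  vzero :: 'a
  vscale :: "'k \<Rightarrow> 'a \<Rightarrow> 'a"
  vnorm :: "'a \<Rightarrow> real"

definition normed_space :: "('k::real_normed_field, 'a) nvs \<Rightarrow> bool" where
  "normed_space V \<longleftrightarrow>
     comm_group \<lparr>carrier = carrier V, monoid.mult = vadd V, one = vzero V\<rparr> \<and>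
     (\<forall>a. \<forall>x\<in>carrier V. vscale V a x \<in> carrier V) \<and>
     (\<forall>a. \<forall>x\<in>carrier V. \<forall>y\<in>carrier V.
        vscale V a (vadd V x y) = vadd V (vscale V a x) (vscale V a y)) \<and>
     (\<forall>a b. \<forall>x\<in>carrier V. vscale V (a + b) x = vadd V (vscale V a x) (vscale V b x)) \<and>
     (\<forall>a b. \<forall>x\<in>carrier V. vscale V (a * b) x = vscale V a (vscale V b x)) \<and>
     (\<forall>x\<in>carrier V. vscale V 1 x = x) \<and>
     (\<forall>x\<in>carrier V. 0 \<le> vnorm V x) \<and>
     (\<forall>x\<in>carrier V. vnorm V x = 0 \<longleftrightarrow> x = vzero V) \<and>
     (\<forall>a. \<forall>x\<in>carrier V. vnorm V (vscale V a x) = norm a * vnorm V x) \<and>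
     (\<forall>x\<in>carrier V. \<forall>y\<in>carrier V. vnorm V (vadd V x y) \<le> vnorm V x + vnorm V y)"

definition vdiff :: "('k::real_normed_field, 'a) nvs \<Rightarrow> 'a \<Rightarrow> 'a \<Rightarrow> 'a" where
  "vdiff V x y = vadd V x (vscale V (- 1) y)"

text \<open>The value 0 off the carrier is forced by the locale \<^locale>\<open>Metric_space\<close>, whose
  non-negativity and symmetry axioms range over the whole type.\<close>

definition vdist :: "('k::real_normed_field, 'a) nvs \<Rightarrow> 'a \<Rightarrow> 'a \<Rightarrow> real" where
  "vdist V x y = (if x \<in> carrier V \<and> y \<in> carrier V then vnorm V (vdiff V x y) else 0)"

definition norm_topology :: "('k::real_normed_field, 'a) nvs \<Rightarrow> 'a topology" where
  "norm_topology V = Metric_space.mtopology (carrier V) (vdist V)"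

definition banach_space :: "('k::real_normed_field, 'a) nvs \<Rightarrow> bool" where
  "banach_space V \<longleftrightarrow> normed_space V \<and> Metric_space.mcomplete (carrier V) (vdist V)"

definition prod_nvs :: "('k, 'a) nvs \<Rightarrow> ('k, 'b) nvs \<Rightarrow> ('k, 'a \<times> 'b) nvs" where
  "prod_nvs V W =
     \<lparr>carrier = carrier V \<times> carrier W,
      vadd = (\<lambda>p q. (vadd V (fst p) (fst q), vadd W (snd p) (snd q))),
      vzero = (vzero V, vzero W),
      vscale = (\<lambda>a p. (vscale V a (fst p), vscale W a (snd p))),
      vnorm = (\<lambda>p. max (vnorm V (fst p)) (vnorm W (snd p)))\<rparr>"


section \<open>Bounded linear operators\<close>

text \<open>An operator is a function that is \<^const>\<open>undefined\<close> off the carrier, so that equality of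
  operators is equality on the space.\<close>

definition bounded_ops :: "('k::real_normed_field, 'a) nvs \<Rightarrow> ('a \<Rightarrow> 'a) set" where
  "bounded_ops V =
     {T \<in> carrier V \<rightarrow>\<^sub>E carrier V.
        (\<forall>x\<in>carrier V. \<forall>y\<in>carrier V. T (vadd V x y) = vadd V (T x) (T y)) \<and>
        (\<forall>a. \<forall>x\<in>carrier V. T (vscale V a x) = vscale V a (T x)) \<and>
        (\<exists>C. \<forall>x\<in>carrier V. vnorm V (T x) \<le> C * vnorm V x)}"

definition op_norm :: "('k::real_normed_field, 'a) nvs \<Rightarrow> ('a \<Rightarrow> 'a) \<Rightarrow> real" where
  "op_norm V T = (SUP x\<in>{x \<in> carrier V. vnorm V x \<le> 1}. vnorm V (T x))"

definition op_space :: "('k::real_normed_field, 'a) nvs \<Rightarrow> ('k, 'a \<Rightarrow> 'a) nvs" where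
  "op_space V =
     \<lparr>carrier = bounded_ops V,
      vadd = (\<lambda>S T. \<lambda>x\<in>carrier V. vadd V (S x) (T x)),
      vzero = (\<lambda>x\<in>carrier V. vzero V),
      vscale = (\<lambda>a T. \<lambda>x\<in>carrier V. vscale V a (T x)),
      vnorm = op_norm V\<rparr>"

definition op_monoid :: "('k::real_normed_field, 'a) nvs \<Rightarrow> ('a \<Rightarrow> 'a) monoid" where
  "op_monoid V =
     \<lparr>carrier = bounded_ops V,
      monoid.mult = (\<lambda>S T. compose (carrier V) S T),
      one = (\<lambda>x\<in>carrier V. x)\<rparr>"

definition op_Gl :: "('k::real_normed_field, 'a) nvs \<Rightarrow> ('a \<Rightarrow> 'a) monoid" where
  "op_Gl V = units_of (op_monoid V)"


section \<open>Smooth maps between open subsets of real normed spaces\<close>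

definition bounded_multilinear ::
    "(real, 'a) nvs \<Rightarrow> (real, 'b) nvs \<Rightarrow> nat \<Rightarrow> ('a list \<Rightarrow> 'b) \<Rightarrow> bool" where
  "bounded_multilinear E F k L \<longleftrightarrow>
     (\<forall>vs\<in>lists (carrier E). length vs = k \<longrightarrow> L vs \<in> carrier F) \<and>
     (\<forall>us\<in>lists (carrier E). \<forall>ws\<in>lists (carrier E). \<forall>v\<in>carrier E. \<forall>w\<in>carrier E.
        Suc (length us + length ws) = k \<longrightarrow>
          L (us @ vadd E v w # ws) = vadd F (L (us @ v # ws)) (L (us @ w # ws))) \<and>
     (\<forall>us\<in>lists (carrier E). \<forall>ws\<in>lists (carrier E). \<forall>v\<in>carrier E. \<forall>a.
        Suc (length us + length ws) = k \<longrightarrow>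
          L (us @ vscale E a v # ws) = vscale F a (L (us @ v # ws))) \<and>
     (\<exists>C. \<forall>vs\<in>lists (carrier E). length vs = k \<longrightarrow>
          vnorm F (L vs) \<le> C * prod_list (map (vnorm E) vs))"

text \<open>
  \<open>C\<^sup>\<infinity>\<close> in the Frechet sense. On lists of length \<open>k\<close>, \<open>D x\<close> is the \<open>k\<close>-th derivative of \<open>f\<close> at
  \<open>x\<close>, a bounded \<open>k\<close>-linear map. The last clause says that \<open>D x\<close> on lists of length \<open>k + 1\<close> is the
  Frechet derivative at \<open>x\<close> of the map \<open>U \<rightarrow> L\<^sup>k(E;F)\<close> given by \<open>D\<close> on lists of length \<open>k\<close>, for the
  operator norm of \<open>L\<^sup>k(E;F)\<close> and under the identification of \<open>L(E;L\<^sup>k(E;F))\<close> with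
  \<open>L\<^bsup>k+1\<^esup>(E;F)\<close>.
\<close>

definition smooth_on ::
    "(real, 'a) nvs \<Rightarrow> (real, 'b) nvs \<Rightarrow> 'a set \<Rightarrow> ('a \<Rightarrow> 'b) \<Rightarrow> bool" where
  "smooth_on E F U f \<longleftrightarrow>
     openin (norm_topology E) U \<and>
     (\<exists>D :: 'a \<Rightarrow> 'a list \<Rightarrow> 'b.
        (\<forall>x\<in>U. D x [] = f x) \<and>
        (\<forall>k. \<forall>x\<in>U. bounded_multilinear E F k (D x)) \<and>
        (\<forall>k. \<forall>x\<in>U. \<forall>\<epsilon>>0. \<exists>\<delta>>0. \<forall>y\<in>U. vdist E y x < \<delta> \<longrightarrow>
           (\<forall>vs\<in>lists (carrier E). length vs = k \<longrightarrow>
              vnorm F (vdiff F (vdiff F (D y vs) (D x vs)) (D x (vdiff E y x # vs)))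
                \<le> \<epsilon> * vdist E y x * prod_list (map (vnorm E) vs))))"


section \<open>Banach manifolds and Banach-Lie groups\<close>

text \<open>A chart is a pair \<open>(U, \<phi>)\<close>; an atlas is a set of charts. Since \<^const>\<open>smooth_on\<close> demands an
  open domain, \<open>smooth_map\<close> includes continuity.\<close>

definition is_chart :: "'g topology \<Rightarrow> (real, 'e) nvs \<Rightarrow> 'g set \<times> ('g \<Rightarrow> 'e) \<Rightarrow> bool" where
  "is_chart T E c \<longleftrightarrow> (case c of (U, \<phi>) \<Rightarrow>
     openin T U \<and> openin (norm_topology E) (\<phi> ` U) \<and>
     homeomorphic_map (subtopology T U) (subtopology (norm_topology E) (\<phi> ` U)) \<phi>)"

definition smooth_atlas ::
    "'g topology \<Rightarrow> (real, 'e) nvs \<Rightarrow> ('g set \<times> ('g \<Rightarrow> 'e)) set \<Rightarrow> bool" where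
  "smooth_atlas T E A \<longleftrightarrow>
     (\<forall>c\<in>A. is_chart T E c) \<and>
     (\<Union>(U, \<phi>)\<in>A. U) = topspace T \<and>
     (\<forall>(U, \<phi>)\<in>A. \<forall>(V, \<psi>)\<in>A. smooth_on E E (\<phi> ` (U \<inter> V)) (\<psi> \<circ> inv_into U \<phi>))"

definition prod_atlas ::
    "('g set \<times> ('g \<Rightarrow> 'e)) set \<Rightarrow> ('h set \<times> ('h \<Rightarrow> 'f)) set
       \<Rightarrow> (('g \<times> 'h) set \<times> ('g \<times> 'h \<Rightarrow> 'e \<times> 'f)) set" where
  "prod_atlas A B = (\<lambda>((U, \<phi>), (V, \<psi>)). (U \<times> V, map_prod \<phi> \<psi>)) ` (A \<times> B)"

definition smooth_map ::
    "(real, 'e) nvs \<Rightarrow> ('g set \<times> ('g \<Rightarrow> 'e)) set \<Rightarrow>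
     (real, 'f) nvs \<Rightarrow> ('h set \<times> ('h \<Rightarrow> 'f)) set \<Rightarrow> ('g \<Rightarrow> 'h) \<Rightarrow> bool" where
  "smooth_map E A F B f \<longleftrightarrow>
     (\<forall>(U, \<phi>)\<in>A. \<forall>(V, \<psi>)\<in>B.
        smooth_on E F (\<phi> ` {x \<in> U. f x \<in> V}) (\<psi> \<circ> f \<circ> inv_into U \<phi>))"

text \<open>
  \<open>T\<close> is the underlying topology of the manifold. Letting the model space \<open>E\<close> live on the type of
  the group elements is no restriction: a chart embeds a ball of \<open>E\<close> into the group, and a ball of
  \<open>E\<close> has the cardinality of \<open>E\<close>.
\<close>

definition real_banach_lie_group :: "('g, 'm) monoid_scheme \<Rightarrow> 'g topology \<Rightarrow> bool" where
  "real_banach_lie_group G T \<longleftrightarrow>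
     group G \<and> topspace T = carrier G \<and> Hausdorff_space T \<and>
     (\<exists>(E :: (real, 'g) nvs) A.
        banach_space E \<and> smooth_atlas T E A \<and>
        smooth_map (prod_nvs E E) (prod_atlas A A) E A (\<lambda>(g, h). g \<otimes>\<^bsub>G\<^esub> h) \<and>
        smooth_map E A E A (\<lambda>g. inv\<^bsub>G\<^esub> g))"


section \<open>The space \<open>L\<^sup>2(\<Omega>)\<close>\<close>

text \<open>Elements are classes of functions modulo equality almost everywhere on \<open>\<Omega>\<close>; the values of a
  representative outside \<open>\<Omega>\<close> are irrelevant.\<close>

type_synonym 'n fclass = "(real ^ 'n \<Rightarrow> complex) set"

definition L2_fun :: "(real ^ 'n) set \<Rightarrow> (real ^ 'n \<Rightarrow> complex) set" where
  "L2_fun \<Omega> = {f \<in> borel_measurable (lebesgue_on \<Omega>).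
                 integrable (lebesgue_on \<Omega>) (\<lambda>x. (norm (f x))\<^sup>2)}"

definition ae_rel :: "(real ^ 'n) set \<Rightarrow> (real ^ 'n \<Rightarrow> complex) rel" where
  "ae_rel \<Omega> = {(f, g). f \<in> L2_fun \<Omega> \<and> g \<in> L2_fun \<Omega> \<and> (AE x in lebesgue_on \<Omega>. f x = g x)}"

definition L2 :: "(real ^ 'n) set \<Rightarrow> 'n fclass set" where
  "L2 \<Omega> = L2_fun \<Omega> // ae_rel \<Omega>"

definition cls :: "(real ^ 'n) set \<Rightarrow> (real ^ 'n \<Rightarrow> complex) \<Rightarrow> 'n fclass" where
  "cls \<Omega> f = ae_rel \<Omega> `` {f}"

definition rep :: "'n fclass \<Rightarrow> real ^ 'n \<Rightarrow> complex" where
  "rep F = (SOME f. f \<in> F)"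

definition L2_add :: "(real ^ 'n) set \<Rightarrow> 'n fclass \<Rightarrow> 'n fclass \<Rightarrow> 'n fclass" where
  "L2_add \<Omega> F G = cls \<Omega> (\<lambda>x. rep F x + rep G x)"

definition L2_scale :: "(real ^ 'n) set \<Rightarrow> complex \<Rightarrow> 'n fclass \<Rightarrow> 'n fclass" where
  "L2_scale \<Omega> a F = cls \<Omega> (\<lambda>x. a * rep F x)"

definition L2_inner :: "(real ^ 'n) set \<Rightarrow> 'n fclass \<Rightarrow> 'n fclass \<Rightarrow> complex" where
  "L2_inner \<Omega> F G = (LINT x|lebesgue_on \<Omega>. rep F x * cnj (rep G x))"


section \<open>The Sobolev space \<open>H\<^sup>1\<^sub>0(\<Omega>)\<close>\<close>

definition partial_deriv :: "'n \<Rightarrow> (real ^ 'n \<Rightarrow> complex) \<Rightarrow> real ^ 'n \<Rightarrow> complex" where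
  "partial_deriv i f x = frechet_derivative f (at x) (axis i 1)"

primrec C_k :: "nat \<Rightarrow> (real ^ 'n \<Rightarrow> complex) \<Rightarrow> bool" where
  "C_k 0 f \<longleftrightarrow> continuous_on UNIV f"
| "C_k (Suc k) f \<longleftrightarrow> (\<forall>x. f differentiable (at x)) \<and> (\<forall>i. C_k k (partial_deriv i f))"

text \<open>\<open>C\<^sub>c\<^sup>\<infinity>(\<Omega>)\<close>, as functions on the whole space vanishing outside a compact subset of \<open>\<Omega>\<close>\<close>

definition test_funs :: "(real ^ 'n) set \<Rightarrow> (real ^ 'n \<Rightarrow> complex) set" where
  "test_funs \<Omega> = {\<phi>. (\<forall>k. C_k k \<phi>) \<and> compact (closure {x. \<phi> x \<noteq> 0}) \<and> closure {x. \<phi> x \<noteq> 0} \<subseteq> \<Omega>}"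

definition is_weak_partial :: "(real ^ 'n) set \<Rightarrow> 'n \<Rightarrow> 'n fclass \<Rightarrow> 'n fclass \<Rightarrow> bool" where
  "is_weak_partial \<Omega> i F D \<longleftrightarrow> D \<in> L2 \<Omega> \<and>
     (\<forall>\<phi>\<in>test_funs \<Omega>.
        (LINT x|lebesgue_on \<Omega>. rep F x * partial_deriv i \<phi> x)
          = - (LINT x|lebesgue_on \<Omega>. rep D x * \<phi> x))"

definition weak_partial :: "(real ^ 'n) set \<Rightarrow> 'n \<Rightarrow> 'n fclass \<Rightarrow> 'n fclass" where
  "weak_partial \<Omega> i F = (THE D. is_weak_partial \<Omega> i F D)"

definition H1_inner :: "(real ^ 'n) set \<Rightarrow> 'n fclass \<Rightarrow> 'n fclass \<Rightarrow> complex" where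
  "H1_inner \<Omega> F G =
     L2_inner \<Omega> F G + (\<Sum>i\<in>UNIV. L2_inner \<Omega> (weak_partial \<Omega> i F) (weak_partial \<Omega> i G))"

definition H1 :: "(real ^ 'n) set \<Rightarrow> (complex, 'n fclass) nvs" where
  "H1 \<Omega> =
     \<lparr>carrier = {F \<in> L2 \<Omega>. \<forall>i. \<exists>D. is_weak_partial \<Omega> i F D},
      vadd = L2_add \<Omega>,
      vzero = cls \<Omega> (\<lambda>x. 0),
      vscale = L2_scale \<Omega>,
      vnorm = (\<lambda>F. sqrt (Re (H1_inner \<Omega> F F)))\<rparr>"

definition H10 :: "(real ^ 'n) set \<Rightarrow> (complex, 'n fclass) nvs" where
  "H10 \<Omega> = (H1 \<Omega>)\<lparr>carrier := norm_topology (H1 \<Omega>) closure_of (cls \<Omega> ` test_funs \<Omega>)\<rparr>"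


section \<open>The group of \<open>L\<^sup>2\<close>-isometries on \<open>H\<^sup>1\<^sub>0(\<Omega>)\<close>\<close>

definition L2_isometry_group :: "(real ^ 'n) set \<Rightarrow> ('n fclass \<Rightarrow> 'n fclass) monoid" where
  "L2_isometry_group \<Omega> = (op_Gl (H10 \<Omega>))
     \<lparr>carrier := {G \<in> carrier (op_Gl (H10 \<Omega>)).
        \<forall>f\<in>carrier (H10 \<Omega>). \<forall>g\<in>carrier (H10 \<Omega>).
          L2_inner \<Omega> (G f) (G g) = L2_inner \<Omega> f g}\<rparr>"

end

theory Submission
  imports Defs
begin

text \<open>
  Write \<open>H\<close> for \<open>H\<^sup>1\<^sub>0(\<Omega>)\<close> and \<open>\<langle>\<cdot>,\<cdot>\<rangle>\<close> for the inner product of \<open>L\<^sup>2\<close>. The charts of the group come from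
  the Cayley transform \<open>c(X) = (1 - X)(1 + X)\<^sup>-\<^sup>1\<close>, which is its own inverse. For \<open>G = c(X)\<close> the
  substitution \<open>f = (1 + X)u\<close>, \<open>g = (1 + X)v\<close> turns \<open>\<langle>Gf,Gg\<rangle> = \<langle>f,g\<rangle>\<close> into
  \<open>\<langle>(1 - X)u,(1 - X)v\<rangle> = \<langle>(1 + X)u,(1 + X)v\<rangle>\<close>, that is, into \<open>\<langle>Xu,v\<rangle> + \<langle>u,Xv\<rangle> = 0\<close>. So \<open>c\<close> exchanges
  isometries of the form with operators that are skew for it. Skewness is a real linear condition on
  \<open>X\<close>, and a closed one because the form is continuous on \<open>H\<close>: the skew operators are a closed real
  subspace \<open>E\<close> of \<open>\<B>(H)\<close>. The maps \<open>h \<mapsto> c(g\<^sup>-\<^sup>1h)\<close> are therefore charts with values in an open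
  subset of \<open>E\<close>. In these charts the transition maps, the multiplication and the inversion are built
  from constants, sums, products and reciprocals in the Banach algebra \<open>\<B>(H)\<close>, and it remains to
  know that products and reciprocals of smooth maps are smooth (\<open>jet_smooth_mult\<close>,
  \<open>jet_smooth_rinv\<close>). The argument up to this point is the locale \<open>cayley_group\<close>, which applies to
  any group of units of a Banach algebra that the Cayley transform exchanges with a closed subspace.

  To compute in types, \<open>H\<close> is embedded in the Hilbert space \<open>L\<^sup>2(\<real>\<^sup>n)\<^sup>1\<^sup>+\<^sup>n\<close> by sending \<open>F\<close> to \<open>F\<close>
  and its weak partial derivatives, extended by zero. The image \<open>S\<close> is closed; if \<open>P\<close> is the
  orthogonal projection onto it, then \<open>T \<mapsto> TP\<close> embeds \<open>\<B>(H)\<close> isometrically in the operators on the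
  large space, and \<open>T \<mapsto> TP + (1 - P)\<close> embeds the group in the units (\<open>isometries_lie_group\<close>).
  Smoothness passes back to \<open>H\<close> because the derivatives of a map with values in a closed subspace
  are limits of difference quotients and thus stay in that subspace (\<open>smooth_on_of_jet_smooth\<close>).

  Three analytic facts make the embedding possible: \<open>L\<^sup>2\<close> is complete (Riesz and Fischer), weak
  derivatives are unique (\<open>fundamental_lemma\<close>, with explicit bump functions), and the relation
  between a function and its weak derivatives is closed in \<open>L\<^sup>2\<close> (\<open>closed_H1_range\<close>).
\<close>

section \<open>Derivatives of all orders as functions on lists\<close>

definition multilin :: "('a::real_vector list \<Rightarrow> 'b::real_vector) \<Rightarrow> bool" where
  "multilin \<Phi> \<longleftrightarrow>
     (\<forall>us v w ws. \<Phi> (us @ (v + w) # ws) = \<Phi> (us @ v # ws) + \<Phi> (us @ w # ws)) \<and>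
     (\<forall>us a v ws. \<Phi> (us @ (a *\<^sub>R v) # ws) = a *\<^sub>R \<Phi> (us @ v # ws))"

text \<open>
  Bounding all lists shorter than \<open>n\<close> at once suits inductions on the length, in which multilinear maps
  of different degrees occur together.
\<close>

definition list_bd :: "nat \<Rightarrow> real \<Rightarrow> ('a::real_normed_vector list \<Rightarrow> 'b::real_normed_vector) \<Rightarrow> bool"
  where "list_bd n c \<Phi> \<longleftrightarrow> (\<forall>us. length us < n \<longrightarrow> norm (\<Phi> us) \<le> c * prod_list (map norm us))"

text \<open>
  A jet collects the derivatives of all orders of \<open>f\<close>: \<open>D x vs\<close> is the derivative of order
  \<open>length vs\<close> at \<open>x\<close> in the directions \<open>vs\<close>, and differentiating once more puts the new direction in
  front. The last condition is Frechet differentiability for the operator norm on multilinear maps.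
\<close>

definition jet :: "'a::real_normed_vector set \<Rightarrow> ('a \<Rightarrow> 'b::real_normed_vector)
    \<Rightarrow> ('a \<Rightarrow> 'a list \<Rightarrow> 'b) \<Rightarrow> bool" where
  "jet U f D \<longleftrightarrow>
     (\<forall>x\<in>U. D x [] = f x \<and> multilin (D x) \<and> (\<forall>n. \<exists>c. list_bd n c (D x)) \<and>
        (\<forall>n. \<forall>\<epsilon>>0. \<forall>\<^sub>F y in nhds x.
           list_bd n (\<epsilon> * norm (y - x)) (\<lambda>vs. D y vs - D x vs - D x ((y - x) # vs))))"

definition jet_smooth :: "'a::real_normed_vector set \<Rightarrow> ('a \<Rightarrow> 'b::real_normed_vector) \<Rightarrow> bool"
  where "jet_smooth U f \<longleftrightarrow> open U \<and> (\<exists>D. jet U f D)"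

lemma prod_list_norm_nonneg: "0 \<le> prod_list (map norm (us :: 'a::real_normed_vector list))"
  by (induction us) auto

lemma list_bdD: "list_bd n c \<Phi> \<Longrightarrow> length us < n \<Longrightarrow> norm (\<Phi> us) \<le> c * prod_list (map norm us)"
  unfolding list_bd_def by auto

lemma small_factor:
  fixes \<epsilon> K :: real assumes "\<epsilon> > 0" "K \<ge> 0" obtains e where "e > 0" "K * e \<le> \<epsilon>"
proof
  show "\<epsilon> / (K + 1) > 0" using assms by (simp add: add_nonneg_pos)
  show "K * (\<epsilon> / (K + 1)) \<le> \<epsilon>" using assms by (simp add: field_simps add_nonneg_pos)
qed

lemma list_bd_mono: "list_bd n c \<Phi> \<Longrightarrow> c \<le> d \<Longrightarrow> m \<le> n \<Longrightarrow> list_bd m d \<Phi>"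
  unfolding list_bd_def
  by (meson mult_right_mono order_trans prod_list_norm_nonneg order_less_le_trans)

lemma list_bd_nonneg:
  assumes "list_bd n c \<Phi>" obtains d where "d \<ge> 0" "list_bd n d \<Phi>"
  using list_bd_mono[OF assms, of "max c 0" n] by (metis max.cobounded1 max.cobounded2 order_refl)

lemma list_bd_add: "list_bd n c \<Phi> \<Longrightarrow> list_bd n d \<Psi> \<Longrightarrow> list_bd n (c + d) (\<lambda>us. \<Phi> us + \<Psi> us)"
  unfolding list_bd_def by (auto simp: distrib_right intro!: order_trans[OF norm_triangle_ineq] add_mono)

lemma list_bd_minus: "list_bd n c \<Phi> \<Longrightarrow> list_bd n c (\<lambda>us. - \<Phi> us)"
  unfolding list_bd_def by auto

lemma list_bd_shift:
  assumes "list_bd (Suc n) c \<Phi>" shows "list_bd n (c * norm v) (\<lambda>us. \<Phi> (v # us))"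
  unfolding list_bd_def
proof (intro allI impI)
  fix us :: "'a list" assume "length us < n"
  then show "norm (\<Phi> (v # us)) \<le> c * norm v * prod_list (map norm us)"
    using list_bdD[OF assms, of "v # us"] by (simp add: mult_ac)
qed

lemma multilin_shift: "multilin \<Phi> \<Longrightarrow> multilin (\<lambda>us. \<Phi> (v # us))"
  unfolding multilin_def by (metis append_Cons)

lemma multilin_add: "multilin \<Phi> \<Longrightarrow> multilin \<Psi> \<Longrightarrow> multilin (\<lambda>us. \<Phi> us + \<Psi> us)"
  unfolding multilin_def by (auto simp: scaleR_add_right)

lemma multilin_linear: "multilin \<Phi> \<Longrightarrow> linear L \<Longrightarrow> multilin (\<lambda>us. L (\<Phi> us))"
  unfolding multilin_def by (auto simp: linear_add linear_scale)

section \<open>The Leibniz rule\<close>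

text \<open>
  All pairs of complementary subsequences of a list.
\<close>

primrec splits :: "'a list \<Rightarrow> ('a list \<times> 'a list) list" where
  "splits [] = [([], [])]"
| "splits (v # vs) = map (\<lambda>(us, ws). (v # us, ws)) (splits vs)
                   @ map (\<lambda>(us, ws). (us, v # ws)) (splits vs)"

text \<open>
  The shuffle product of two functions on lists: if \<open>\<Phi>\<close> and \<open>\<Psi>\<close> are the jets of two maps at a
  point, this is the jet of their product, by the general Leibniz rule.
\<close>

definition leibniz :: "('a list \<Rightarrow> 'r::real_normed_algebra) \<Rightarrow> ('a list \<Rightarrow> 'r) \<Rightarrow> 'a list \<Rightarrow> 'r" where
  "leibniz \<Phi> \<Psi> vs = (\<Sum>(us, ws)\<leftarrow>splits vs. \<Phi> us * \<Psi> ws)"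

lemma leibniz_Nil [simp]: "leibniz \<Phi> \<Psi> [] = \<Phi> [] * \<Psi> []"
  by (simp add: leibniz_def)

text \<open>
  Prepending a direction is differentiation, and it acts on the shuffle product as a derivation.
\<close>

lemma leibniz_Cons:
  "leibniz \<Phi> \<Psi> (v # vs) = leibniz (\<lambda>us. \<Phi> (v # us)) \<Psi> vs + leibniz \<Phi> (\<lambda>us. \<Psi> (v # us)) vs"
  by (simp add: leibniz_def comp_def case_prod_unfold)

lemma leibniz_add_left: "leibniz (\<lambda>us. \<Phi> us + \<Phi>' us) \<Psi> vs = leibniz \<Phi> \<Psi> vs + leibniz \<Phi>' \<Psi> vs"
  by (simp add: leibniz_def distrib_right sum_list_addf case_prod_unfold)

lemma leibniz_add_right: "leibniz \<Phi> (\<lambda>us. \<Psi> us + \<Psi>' us) vs = leibniz \<Phi> \<Psi> vs + leibniz \<Phi> \<Psi>' vs"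
  by (simp add: leibniz_def distrib_left sum_list_addf case_prod_unfold)

lemma leibniz_diff_left: "leibniz (\<lambda>us. \<Phi> us - \<Phi>' us) \<Psi> vs = leibniz \<Phi> \<Psi> vs - leibniz \<Phi>' \<Psi> vs"
  by (simp add: leibniz_def left_diff_distrib sum_list_subtractf case_prod_unfold)

lemma leibniz_diff_right: "leibniz \<Phi> (\<lambda>us. \<Psi> us - \<Psi>' us) vs = leibniz \<Phi> \<Psi> vs - leibniz \<Phi> \<Psi>' vs"
  by (simp add: leibniz_def right_diff_distrib sum_list_subtractf case_prod_unfold)

lemma leibniz_scale_left: "leibniz (\<lambda>us. a *\<^sub>R \<Phi> us) \<Psi> vs = a *\<^sub>R leibniz \<Phi> \<Psi> vs"
  by (induction vs arbitrary: \<Phi> \<Psi>) (simp_all add: leibniz_Cons scaleR_add_right)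

lemma leibniz_scale_right: "leibniz \<Phi> (\<lambda>us. a *\<^sub>R \<Psi> us) vs = a *\<^sub>R leibniz \<Phi> \<Psi> vs"
  by (induction vs arbitrary: \<Phi> \<Psi>) (simp_all add: leibniz_Cons scaleR_add_right)

lemma splits_length: "(us, ws) \<in> set (splits vs) \<Longrightarrow> length us + length ws = length vs"
  by (induction vs arbitrary: us ws) auto

text \<open>
  Apart from its leading term, a shuffle product uses the second factor on strictly shorter lists
  only. Reciprocals are therefore determined recursively, and statements about them can be proved by
  induction on the length.
\<close>

lemma leibniz_split_off_Nil:
  "leibniz \<Phi> \<Psi> vs = \<Phi> [] * \<Psi> vs + leibniz (\<Phi>([] := 0)) \<Psi> vs"
proof (induction vs arbitrary: \<Psi>)
  case (Cons v vs)
  have "(\<lambda>us. (\<Phi>([] := 0)) (v # us)) = (\<lambda>us. \<Phi> (v # us))" by auto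
  then show ?case using Cons[of "\<lambda>us. \<Psi> (v # us)"] by (simp add: leibniz_Cons add_ac)
qed simp

lemma leibniz_strict_cong:
  assumes "\<Phi> [] = 0" "\<And>us. length us < length vs \<Longrightarrow> \<Psi> us = \<Psi>' us"
  shows "leibniz \<Phi> \<Psi> vs = leibniz \<Phi> \<Psi>' vs"
  unfolding leibniz_def
proof (intro arg_cong[where f=sum_list] map_cong refl, clarify)
  fix us ws assume "(us, ws) \<in> set (splits vs)"
  then show "\<Phi> us * \<Psi> ws = \<Phi> us * \<Psi>' ws"
    using splits_length[of us ws vs] assms by (cases us) auto
qed

text \<open>
  The induction moves the modified entry to the front of the list; it needs arbitrary \<open>\<Phi>\<close> and \<open>\<Psi>\<close>
  because each step shifts one of them.
\<close>

lemma multilin_leibniz: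
  assumes "multilin \<Phi>" "multilin \<Psi>" shows "multilin (leibniz \<Phi> \<Psi>)"
proof -
  have "leibniz \<Phi> \<Psi> (us @ (v + w) # ws) = leibniz \<Phi> \<Psi> (us @ v # ws) + leibniz \<Phi> \<Psi> (us @ w # ws)
      \<and> leibniz \<Phi> \<Psi> (us @ (a *\<^sub>R v) # ws) = a *\<^sub>R leibniz \<Phi> \<Psi> (us @ v # ws)" for us v w ws a
    using assms
  proof (induction us arbitrary: \<Phi> \<Psi>)
    case Nil
    have eqs: "\<Phi> ((v + w) # us) = \<Phi> (v # us) + \<Phi> (w # us)" "\<Phi> ((a *\<^sub>R v) # us) = a *\<^sub>R \<Phi> (v # us)"
      "\<Psi> ((v + w) # us) = \<Psi> (v # us) + \<Psi> (w # us)" "\<Psi> ((a *\<^sub>R v) # us) = a *\<^sub>R \<Psi> (v # us)" for us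
      using Nil unfolding multilin_def by (metis append_Nil)+
    show ?case
      by (simp add: leibniz_Cons eqs leibniz_add_left leibniz_add_right leibniz_scale_left
          leibniz_scale_right scaleR_add_right)
  next
    case (Cons u us)
    from Cons.IH[OF multilin_shift[OF Cons.prems(1)] Cons.prems(2), of u]
      Cons.IH[OF Cons.prems(1) multilin_shift[OF Cons.prems(2)], of u]
    show ?case by (simp add: leibniz_Cons scaleR_add_right)
  qed
  then show ?thesis unfolding multilin_def by blast
qed

text \<open>
  A list of length \<open>k\<close> has \<open>2\<^sup>k\<close> splits.
\<close>

lemma list_bd_leibniz:
  assumes "list_bd n a \<Phi>" "list_bd n b \<Psi>" "a \<ge> 0" "b \<ge> 0"
  shows "list_bd n (2 ^ n * a * b) (leibniz \<Phi> \<Psi>)"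
  unfolding list_bd_def
proof (intro allI impI)
  fix vs :: "'a list" assume "length vs < n"
  then show "norm (leibniz \<Phi> \<Psi> vs) \<le> 2 ^ n * a * b * prod_list (map norm vs)"
    using assms
  proof (induction vs arbitrary: n a b \<Phi> \<Psi>)
    case Nil
    have "norm (\<Phi> [] * \<Psi> []) \<le> norm (\<Phi> []) * norm (\<Psi> [])" by (rule norm_mult_ineq)
    also have "\<dots> \<le> a * b"
      using list_bdD[OF Nil(2), of "[]"] list_bdD[OF Nil(3), of "[]"] Nil by (intro mult_mono) auto
    also have "\<dots> \<le> 2 ^ n * (a * b)"
      using Nil mult_right_mono[of 1 "2 ^ n" "a * b"] by simp
    finally show ?case by (simp add: mult_ac)
  next
    case (Cons v vs)
    obtain m where n: "n = Suc m" using Cons.prems(1) by (cases n) auto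
    have len: "length vs < m" using Cons.prems n by simp
    have "norm (leibniz (\<lambda>us. \<Phi> (v # us)) \<Psi> vs) \<le> 2 ^ m * (a * norm v) * b * prod_list (map norm vs)"
      using Cons.prems n by (intro Cons.IH len list_bd_shift) (auto intro: list_bd_mono)
    moreover have "norm (leibniz \<Phi> (\<lambda>us. \<Psi> (v # us)) vs) \<le> 2 ^ m * a * (b * norm v) * prod_list (map norm vs)"
      using Cons.prems n by (intro Cons.IH len list_bd_shift) (auto intro: list_bd_mono)
    ultimately have "norm (leibniz \<Phi> \<Psi> (v # vs)) \<le> 2 ^ m * (a * norm v) * b * prod_list (map norm vs)
        + 2 ^ m * a * (b * norm v) * prod_list (map norm vs)"
      unfolding leibniz_Cons by (rule norm_triangle_mono)
    then show ?case by (simp add: n mult_ac)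
  qed
qed

section \<open>Smooth maps between normed spaces\<close>

text \<open>
  Landau symbols for families of functions on lists, relative to the distance from \<open>x\<close> and for the
  operator norm in each degree less than \<open>n\<close>.
\<close>

definition bigo_at :: "'a::real_normed_vector \<Rightarrow> nat \<Rightarrow> ('a \<Rightarrow> 'a list \<Rightarrow> 'b::real_normed_vector) \<Rightarrow> bool" where
  "bigo_at x n R \<longleftrightarrow> (\<exists>c\<ge>0. \<forall>\<^sub>F y in nhds x. list_bd n (c * norm (y - x)) (R y))"

definition smallo_at :: "'a::real_normed_vector \<Rightarrow> nat \<Rightarrow> ('a \<Rightarrow> 'a list \<Rightarrow> 'b::real_normed_vector) \<Rightarrow> bool" where
  "smallo_at x n R \<longleftrightarrow> (\<forall>\<epsilon>>0. \<forall>\<^sub>F y in nhds x. list_bd n (\<epsilon> * norm (y - x)) (R y))"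

definition bounded_near :: "'a::real_normed_vector \<Rightarrow> nat \<Rightarrow> ('a \<Rightarrow> 'a list \<Rightarrow> 'b::real_normed_vector) \<Rightarrow> bool" where
  "bounded_near x n R \<longleftrightarrow> (\<exists>c\<ge>0. \<forall>\<^sub>F y in nhds x. list_bd n c (R y))"

lemma bounded_near_const: 
  assumes "list_bd n c \<Phi>" shows "bounded_near x n (\<lambda>y. \<Phi>)"
proof -
  obtain d where "d \<ge> 0" "list_bd n d \<Phi>" using list_bd_nonneg[OF assms] .
  then show ?thesis unfolding bounded_near_def by auto
qed

lemma smallo_add:
  assumes "smallo_at x n R" "smallo_at x n S" shows "smallo_at x n (\<lambda>y us. R y us + S y us)"
  unfolding smallo_at_def
proof (intro allI impI)
  fix \<epsilon> :: real assume "\<epsilon> > 0"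
  then have "\<forall>\<^sub>F y in nhds x. list_bd n (\<epsilon>/2 * norm (y - x)) (R y)"
    "\<forall>\<^sub>F y in nhds x. list_bd n (\<epsilon>/2 * norm (y - x)) (S y)"
    using assms unfolding smallo_at_def by (metis half_gt_zero)+
  then show "\<forall>\<^sub>F y in nhds x. list_bd n (\<epsilon> * norm (y - x)) (\<lambda>us. R y us + S y us)"
  proof eventually_elim
    case (elim y)
    from list_bd_add[OF elim] show ?case by (simp flip: distrib_right)
  qed
qed

lemma smallo_minus: "smallo_at x n R \<Longrightarrow> smallo_at x n (\<lambda>y us. - R y us)"
  unfolding smallo_at_def by (auto intro: list_bd_minus elim!: eventually_mono)

lemma bounded_near_add:
  assumes "bounded_near x n R" "bounded_near x n S" shows "bounded_near x n (\<lambda>y us. R y us + S y us)"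
proof -
  obtain c d where cd: "c \<ge> 0" "d \<ge> 0" and ev: "\<forall>\<^sub>F y in nhds x. list_bd n c (R y)" "\<forall>\<^sub>F y in nhds x. list_bd n d (S y)"
    using assms unfolding bounded_near_def by blast
  from ev have "\<forall>\<^sub>F y in nhds x. list_bd n (c + d) (\<lambda>us. R y us + S y us)"
    by eventually_elim (rule list_bd_add)
  then show ?thesis unfolding bounded_near_def using cd by (intro exI[of _ "c + d"]) auto
qed

lemma bigo_bounded_near:
  assumes "bigo_at x n R" shows "bounded_near x n R"
proof -
  obtain c where c: "c \<ge> 0" "\<forall>\<^sub>F y in nhds x. list_bd n (c * norm (y - x)) (R y)"
    using assms unfolding bigo_at_def by auto
  have "\<forall>\<^sub>F y in nhds x. dist y x < 1" unfolding eventually_nhds_metric by (intro exI[of _ 1]) auto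
  with c(2) have "\<forall>\<^sub>F y in nhds x. list_bd n c (R y)"
  proof eventually_elim
    case (elim y)
    then have "c * norm (y - x) \<le> c" using c(1) by (simp add: dist_norm mult_left_le)
    then show ?case using elim by (auto intro: list_bd_mono)
  qed
  then show ?thesis using c unfolding bounded_near_def by auto
qed

lemma bigo_leibniz:
  assumes "bigo_at x n R" "bounded_near x n S"
  shows "bigo_at x n (\<lambda>y. leibniz (R y) (S y))"
proof -
  obtain c b where c: "c \<ge> 0" "\<forall>\<^sub>F y in nhds x. list_bd n (c * norm (y - x)) (R y)"
    and b: "b \<ge> 0" "\<forall>\<^sub>F y in nhds x. list_bd n b (S y)"
    using assms unfolding bigo_at_def bounded_near_def by auto
  have "\<forall>\<^sub>F y in nhds x. list_bd n ((2 ^ n * c * b) * norm (y - x)) (leibniz (R y) (S y))"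
    using c(2) b(2)
  proof eventually_elim
    case (elim y)
    from list_bd_leibniz[OF elim] c b show ?case by (simp add: mult_ac)
  qed
  then show ?thesis unfolding bigo_at_def using c b by (intro exI[of _ "2 ^ n * c * b"]) auto
qed

lemma smallo_leibniz_left:
  assumes "smallo_at x n R" "bounded_near x n S"
  shows "smallo_at x n (\<lambda>y. leibniz (R y) (S y))"
  unfolding smallo_at_def
proof (intro allI impI)
  fix \<epsilon> :: real assume \<epsilon>: "\<epsilon> > 0"
  obtain b where b: "b \<ge> 0" "\<forall>\<^sub>F y in nhds x. list_bd n b (S y)"
    using assms unfolding bounded_near_def by auto
  obtain e where e: "e > 0" "2 ^ n * e * b \<le> \<epsilon>"
    using small_factor[of \<epsilon> "2 ^ n * b"] \<epsilon> b by (auto simp: mult_ac)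
  have "\<forall>\<^sub>F y in nhds x. list_bd n (e * norm (y - x)) (R y)"
    using assms e unfolding smallo_at_def by auto
  with b(2) show "\<forall>\<^sub>F y in nhds x. list_bd n (\<epsilon> * norm (y - x)) (leibniz (R y) (S y))"
  proof eventually_elim
    case (elim y)
    have "list_bd n (2 ^ n * (e * norm (y - x)) * b) (leibniz (R y) (S y))"
      using elim e b by (intro list_bd_leibniz) auto
    moreover have "2 ^ n * (e * norm (y - x)) * b \<le> \<epsilon> * norm (y - x)"
      using mult_right_mono[OF e(2), of "norm (y - x)"] by (simp add: mult_ac)
    ultimately show ?case by (rule list_bd_mono) simp
  qed
qed

lemma smallo_leibniz_right:
  assumes "bounded_near x n R" "smallo_at x n S"
  shows "smallo_at x n (\<lambda>y. leibniz (R y) (S y))"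
  unfolding smallo_at_def
proof (intro allI impI)
  fix \<epsilon> :: real assume \<epsilon>: "\<epsilon> > 0"
  obtain b where b: "b \<ge> 0" "\<forall>\<^sub>F y in nhds x. list_bd n b (R y)"
    using assms unfolding bounded_near_def by auto
  obtain e where e: "e > 0" "2 ^ n * b * e \<le> \<epsilon>"
    using small_factor[of \<epsilon> "2 ^ n * b"] \<epsilon> b by (auto simp: mult_ac)
  have "\<forall>\<^sub>F y in nhds x. list_bd n (e * norm (y - x)) (S y)"
    using assms e unfolding smallo_at_def by auto
  with b(2) show "\<forall>\<^sub>F y in nhds x. list_bd n (\<epsilon> * norm (y - x)) (leibniz (R y) (S y))"
  proof eventually_elim
    case (elim y)
    have "list_bd n (2 ^ n * b * (e * norm (y - x))) (leibniz (R y) (S y))"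
      using elim e b by (intro list_bd_leibniz) auto
    moreover have "2 ^ n * b * (e * norm (y - x)) \<le> \<epsilon> * norm (y - x)"
      using mult_right_mono[OF e(2), of "norm (y - x)"] by (simp add: mult_ac)
    ultimately show ?case by (rule list_bd_mono) simp
  qed
qed

lemma smallo_leibniz_bigo:
  assumes "bigo_at x n R" "bigo_at x n S"
  shows "smallo_at x n (\<lambda>y. leibniz (R y) (S y))"
  unfolding smallo_at_def
proof (intro allI impI)
  fix \<epsilon> :: real assume \<epsilon>: "\<epsilon> > 0"
  obtain c b where c: "c \<ge> 0" "\<forall>\<^sub>F y in nhds x. list_bd n (c * norm (y - x)) (R y)"
    and b: "b \<ge> 0" "\<forall>\<^sub>F y in nhds x. list_bd n (b * norm (y - x)) (S y)"
    using assms unfolding bigo_at_def by auto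
  have cb: "c * b \<ge> 0" using c b by auto
  obtain d where d: "d > 0" "2 ^ n * c * b * d \<le> \<epsilon>"
    using small_factor[of \<epsilon> "2 ^ n * c * b"] \<epsilon> c b by (auto simp: mult_ac)
  have "\<forall>\<^sub>F y in nhds x. dist y x < d"
    unfolding eventually_nhds_metric using d by blast
  with c(2) b(2) show "\<forall>\<^sub>F y in nhds x. list_bd n (\<epsilon> * norm (y - x)) (leibniz (R y) (S y))"
  proof eventually_elim
    case (elim y)
    have "list_bd n (2 ^ n * (c * norm (y - x)) * (b * norm (y - x))) (leibniz (R y) (S y))"
      using elim c b by (intro list_bd_leibniz) auto
    moreover have "2 ^ n * c * b * norm (y - x) \<le> 2 ^ n * c * b * d"
      using elim c b by (intro mult_left_mono) (auto simp: dist_norm)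
    then have "2 ^ n * c * b * norm (y - x) \<le> \<epsilon>" using d(2) by linarith
    then have "2 ^ n * c * b * norm (y - x) * norm (y - x) \<le> \<epsilon> * norm (y - x)"
      by (rule mult_right_mono) simp
    then have "2 ^ n * (c * norm (y - x)) * (b * norm (y - x)) \<le> \<epsilon> * norm (y - x)"
      by (simp add: mult_ac)
    ultimately show ?case by (rule list_bd_mono) simp
  qed
qed

lemma jet_smallo: "jet U f D \<Longrightarrow> x \<in> U \<Longrightarrow>
   smallo_at x n (\<lambda>y vs. D y vs - D x vs - D x ((y - x) # vs))"
  unfolding jet_def smallo_at_def by auto

lemma bigo_shift:
  assumes "list_bd (Suc n) c \<Phi>" shows "bigo_at x n (\<lambda>y vs. \<Phi> ((y - x) # vs))"
proof -
  obtain d where "d \<ge> 0" "list_bd (Suc n) d \<Phi>" using list_bd_nonneg[OF assms] .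
  then show ?thesis unfolding bigo_at_def by (intro exI[of _ d] conjI always_eventually allI list_bd_shift)
qed

lemma smallo_imp_bigo: "smallo_at x n R \<Longrightarrow> bigo_at x n R"
  unfolding smallo_at_def bigo_at_def by (metis zero_le_one zero_less_one)

lemma bigo_add:
  assumes "bigo_at x n R" "bigo_at x n S" shows "bigo_at x n (\<lambda>y us. R y us + S y us)"
proof -
  obtain c b where c: "c \<ge> 0" "\<forall>\<^sub>F y in nhds x. list_bd n (c * norm (y - x)) (R y)"
    and b: "b \<ge> 0" "\<forall>\<^sub>F y in nhds x. list_bd n (b * norm (y - x)) (S y)"
    using assms unfolding bigo_at_def by auto
  from c(2) b(2) have "\<forall>\<^sub>F y in nhds x. list_bd n ((c + b) * norm (y - x)) (\<lambda>us. R y us + S y us)"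
    by eventually_elim (auto simp: distrib_right intro: list_bd_add)
  then show ?thesis unfolding bigo_at_def using c b by (intro exI[of _ "c + b"]) auto
qed

lemma jet_bigo:
  assumes "jet U f D" "x \<in> U" shows "bigo_at x n (\<lambda>y vs. D y vs - D x vs)"
proof -
  obtain c where "list_bd (Suc n) c (D x)" using assms unfolding jet_def by blast
  from bigo_add[OF smallo_imp_bigo[OF jet_smallo[OF assms, of n]] bigo_shift[OF this, of x]]
  show ?thesis by simp
qed

lemma jet_bounded_near:
  assumes "jet U f D" "x \<in> U" shows "bounded_near x n D"
proof -
  obtain c where "list_bd n c (D x)" using assms unfolding jet_def by blast
  from bounded_near_add[OF bigo_bounded_near[OF jet_bigo[OF assms]] bounded_near_const[OF this]]
  show ?thesis by simp
qed

lemma jet_smooth_continuous: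
  assumes "jet_smooth U f" shows "continuous_on U f"
proof -
  obtain D where U: "open U" and D: "jet U f D" using assms unfolding jet_smooth_def by blast
  have "isCont f x" if x: "x \<in> U" for x
  proof -
    obtain c where c: "\<forall>\<^sub>F y in nhds x. list_bd 1 (c * norm (y - x)) (\<lambda>vs. D y vs - D x vs)"
      using jet_bigo[OF D x, of 1] unfolding bigo_at_def by auto
    have "\<forall>\<^sub>F y in nhds x. y \<in> U" using U x by (simp add: eventually_nhds_in_open)
    with c have "\<forall>\<^sub>F y in nhds x. norm (f y - f x) \<le> c * norm (y - x)"
    proof eventually_elim
      case (elim y)
      from list_bdD[OF elim(1), of "[]"] show ?case using D x elim by (simp add: jet_def)
    qed
    then have "\<forall>\<^sub>F y in at x. norm (f y - f x) \<le> c * norm (y - x)"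
      by (simp add: eventually_nhds_conv_at)
    moreover have "((\<lambda>y. c * norm (y - x)) \<longlongrightarrow> c * norm (x - x)) (at x)"
      by (intro tendsto_intros)
    ultimately have "((\<lambda>y. f y - f x) \<longlongrightarrow> 0) (at x)" by (auto intro: Lim_null_comparison)
    then show ?thesis unfolding isCont_def by (simp add: LIM_zero_cancel)
  qed
  then show ?thesis by (simp add: continuous_at_imp_continuous_on)
qed

lemma jet_smooth_subset: "jet_smooth U f \<Longrightarrow> open V \<Longrightarrow> V \<subseteq> U \<Longrightarrow> jet_smooth V f"
  unfolding jet_smooth_def jet_def by blast

lemma jet_smooth_const: "open U \<Longrightarrow> jet_smooth U (\<lambda>x. c)"
proof -
  assume U: "open U"
  define D :: "'a \<Rightarrow> 'a list \<Rightarrow> 'b" where "D = (\<lambda>x vs. if vs = [] then c else 0)"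
  have "jet U (\<lambda>x. c) D"
    unfolding jet_def
    by (auto simp: D_def multilin_def list_bd_def prod_list_norm_nonneg intro!: exI[of _ "norm c"])
  then show ?thesis using U unfolding jet_smooth_def by blast
qed

lemma jet_smooth_bounded_linear:
  assumes U: "open U" and L: "bounded_linear L" shows "jet_smooth U L"
proof -
  interpret bounded_linear L by fact
  define D where "D = (\<lambda>x vs. case vs of [] \<Rightarrow> L x | [v] \<Rightarrow> L v | _ \<Rightarrow> 0)"
  have D_eq: "D x (us @ v # ws) = (if us = [] \<and> ws = [] then L v else 0)" for x us v ws
    by (cases us; cases ws) (auto simp: D_def split: list.splits)
  have bd: "\<exists>c. list_bd n c (D x)" for n x
  proof -
    obtain K where K: "\<And>v. norm (L v) \<le> norm v * K" using bounded by blast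
    have "norm (D x us) \<le> max (norm (L x)) K * prod_list (map norm us)" for us
    proof (cases us)
      case (Cons v ws)
      then show ?thesis
      proof (cases ws)
        case Nil
        have "norm (L v) \<le> max (norm (L x)) K * norm v"
          using K[of v] mult_left_mono[of K "max (norm (L x)) K" "norm v"] by (simp add: mult_ac)
        then show ?thesis using Cons Nil by (simp add: D_def)
      next
        case (Cons w ws')
        have "0 \<le> max (norm (L x)) K" by (simp add: max.coboundedI1)
        with Cons \<open>us = v # ws\<close> show ?thesis
          by (simp add: D_def prod_list_norm_nonneg)
      qed
    qed (simp add: D_def)
    then show ?thesis unfolding list_bd_def by blast
  qed
  have rem: "D y vs - D x vs - D x ((y - x) # vs) = 0" for x y vs
    by (auto simp: D_def diff split: list.splits)
  have "jet U L D"
    unfolding jet_def rem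
    using bd by (auto simp: D_eq multilin_def add scaleR) (auto simp: D_def list_bd_def prod_list_norm_nonneg)
  then show ?thesis using U unfolding jet_smooth_def by blast
qed

lemma jet_smooth_add:
  assumes "jet_smooth U f" "jet_smooth U g" shows "jet_smooth U (\<lambda>x. f x + g x)"
proof -
  obtain D E where D: "jet U f D" and E: "jet U g E" and U: "open U"
    using assms unfolding jet_smooth_def by blast
  have "jet U (\<lambda>x. f x + g x) (\<lambda>x vs. D x vs + E x vs)"
    unfolding jet_def
  proof (intro ballI conjI)
    fix x assume x: "x \<in> U"
    show "D x [] + E x [] = f x + g x" using D E x unfolding jet_def by simp
    show "multilin (\<lambda>vs. D x vs + E x vs)" using D E x unfolding jet_def by (simp add: multilin_add)
    show "\<forall>n. \<exists>c. list_bd n c (\<lambda>vs. D x vs + E x vs)"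
      using D E x unfolding jet_def by (blast intro: list_bd_add)
    show "\<forall>n. \<forall>\<epsilon>>0. \<forall>\<^sub>F y in nhds x. list_bd n (\<epsilon> * norm (y - x))
        (\<lambda>vs. D y vs + E y vs - (D x vs + E x vs) - (D x ((y - x) # vs) + E x ((y - x) # vs)))"
      using smallo_add[OF jet_smallo[OF D x] jet_smallo[OF E x]]
      unfolding smallo_at_def by (simp add: algebra_simps)
  qed
  then show ?thesis using U unfolding jet_smooth_def by blast
qed

text \<open>
  The remainder of the product is written as three shuffle products: in two of them a factor is a
  remainder of \<open>f\<close> or \<open>g\<close>, and in the third both factors are increments, so that it is quadratic.
\<close>

lemma jet_smooth_mult:
  fixes f g :: "'a::real_normed_vector \<Rightarrow> 'r::real_normed_algebra"
  assumes "jet_smooth U f" "jet_smooth U g" shows "jet_smooth U (\<lambda>x. f x * g x)"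
proof -
  obtain D E where D: "jet U f D" and E: "jet U g E" and U: "open U"
    using assms unfolding jet_smooth_def by blast
  have "jet U (\<lambda>x. f x * g x) (\<lambda>x. leibniz (D x) (E x))"
    unfolding jet_def
  proof (intro ballI conjI)
    fix x assume x: "x \<in> U"
    show "leibniz (D x) (E x) [] = f x * g x" using D E x unfolding jet_def by simp
    show "multilin (leibniz (D x) (E x))" using D E x unfolding jet_def by (simp add: multilin_leibniz)
    show "\<forall>n. \<exists>c. list_bd n c (leibniz (D x) (E x))"
      using D E x unfolding jet_def by (meson list_bd_leibniz list_bd_nonneg)
    have "smallo_at x n (\<lambda>y vs. leibniz (D y) (E y) vs - leibniz (D x) (E x) vs
        - leibniz (D x) (E x) ((y - x) # vs))" for n
    proof -
      obtain a where a: "list_bd (Suc n) a (D x)" using D x unfolding jet_def by blast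
      have a': "list_bd n a (D x)" using a by (auto intro: list_bd_mono)
      have "smallo_at x n (\<lambda>y vs.
          leibniz (\<lambda>us. D y us - D x us - D x ((y - x) # us)) (E y) vs
          + leibniz (D x) (\<lambda>us. E y us - E x us - E x ((y - x) # us)) vs
          + leibniz (\<lambda>us. D x ((y - x) # us)) (\<lambda>us. E y us - E x us) vs)"
        by (intro smallo_add smallo_leibniz_left smallo_leibniz_right smallo_leibniz_bigo
            jet_smallo[OF D x] jet_smallo[OF E x] jet_bounded_near[OF E x] bounded_near_const[OF a']
            bigo_shift[OF a] jet_bigo[OF E x])
      then show ?thesis
        by (simp add: leibniz_Cons leibniz_diff_left leibniz_diff_right leibniz_add_left
            leibniz_add_right algebra_simps)
    qed
    then show "\<forall>n. \<forall>\<epsilon>>0. \<forall>\<^sub>F y in nhds x. list_bd n (\<epsilon> * norm (y - x))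
        (\<lambda>vs. leibniz (D y) (E y) vs - leibniz (D x) (E x) vs - leibniz (D x) (E x) ((y - x) # vs))"
      unfolding smallo_at_def by blast
  qed
  then show ?thesis using U unfolding jet_smooth_def by blast
qed

lemma jet_smooth_diff:
  assumes "jet_smooth U f" "jet_smooth U g" shows "jet_smooth U (\<lambda>x. f x - g x)"
proof -
  obtain E where E: "jet U g E" and U: "open U"
    using assms unfolding jet_smooth_def by blast
  have "jet U (\<lambda>x. - g x) (\<lambda>x vs. - E x vs)"
    unfolding jet_def
  proof (intro ballI conjI)
    fix x assume x: "x \<in> U"
    show "- E x [] = - g x" using E x unfolding jet_def by simp
    show "multilin (\<lambda>vs. - E x vs)" using E x unfolding jet_def multilin_def by auto
    show "\<forall>n. \<exists>c. list_bd n c (\<lambda>vs. - E x vs)"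
      using E x unfolding jet_def by (blast intro: list_bd_minus)
    show "\<forall>n. \<forall>\<epsilon>>0. \<forall>\<^sub>F y in nhds x. list_bd n (\<epsilon> * norm (y - x))
        (\<lambda>vs. - E y vs - - E x vs - - E x ((y - x) # vs))"
      using smallo_minus[OF jet_smallo[OF E x]]
      unfolding smallo_at_def by (simp add: algebra_simps)
  qed
  then have "jet_smooth U (\<lambda>x. - g x)" using U unfolding jet_smooth_def by blast
  from jet_smooth_add[OF assms(1) this] show ?thesis by simp
qed

section \<open>Units of a Banach algebra\<close>

definition runit :: "'r::monoid_mult \<Rightarrow> bool" where
  "runit x \<longleftrightarrow> (\<exists>y. x * y = 1 \<and> y * x = 1)"

definition rinv :: "'r::monoid_mult \<Rightarrow> 'r" where
  "rinv x = (THE y. x * y = 1 \<and> y * x = 1)"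

lemma left_right_inverse_eq: "x * y = 1 \<Longrightarrow> z * x = 1 \<Longrightarrow> z = (y :: 'r::monoid_mult)"
  by (metis mult.assoc mult_1_left mult_1_right)

lemma rinv_unique: "x * y = 1 \<Longrightarrow> y * x = 1 \<Longrightarrow> rinv x = (y :: 'r::monoid_mult)"
  unfolding rinv_def by (rule the_equality) (auto intro: left_right_inverse_eq)

lemma runitI: "x * y = 1 \<Longrightarrow> y * x = 1 \<Longrightarrow> runit (x :: 'r::monoid_mult)"
  unfolding runit_def by blast

lemma rinv_right [simp]: "runit x \<Longrightarrow> x * rinv x = (1 :: 'r::monoid_mult)"
  and rinv_left [simp]: "runit x \<Longrightarrow> rinv x * x = (1 :: 'r::monoid_mult)"
  unfolding runit_def using rinv_unique by metis+

lemma rinv_right_assoc [simp]: "runit x \<Longrightarrow> x * (rinv x * z) = (z :: 'r::monoid_mult)"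
  and rinv_left_assoc [simp]: "runit x \<Longrightarrow> rinv x * (x * z) = (z :: 'r::monoid_mult)"
  by (simp_all flip: mult.assoc)

lemma runit_one [simp]: "runit (1 :: 'r::monoid_mult)" by (rule runitI[of _ 1]) auto

lemma runit_rinv [simp]: "runit x \<Longrightarrow> runit (rinv x :: 'r::monoid_mult)"
  by (rule runitI[of _ x]) auto

lemma rinv_rinv [simp]: "runit x \<Longrightarrow> rinv (rinv x) = (x :: 'r::monoid_mult)"
  by (rule rinv_unique) auto

lemma runit_mult [simp]: "runit x \<Longrightarrow> runit y \<Longrightarrow> runit (x * y :: 'r::monoid_mult)"
  by (rule runitI[of _ "rinv y * rinv x"]) (simp_all add: mult.assoc)

lemma rinv_mult: "runit x \<Longrightarrow> runit y \<Longrightarrow> rinv (x * y) = rinv y * rinv (x :: 'r::monoid_mult)"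
  by (rule rinv_unique) (simp_all add: mult.assoc)

text \<open>
  A right inverse is a fixed point of the contraction \<open>y \<mapsto> 1 - a y\<close>, and a left inverse one of
  \<open>z \<mapsto> 1 - z a\<close>.
\<close>

lemma runit_one_plus:
  fixes a :: "'r::{real_normed_algebra, monoid_mult, banach}"
  assumes "norm a < 1" shows "runit (1 + a)"
proof -
  have lip: "dist (1 - a * x) (1 - a * y) \<le> norm a * dist x y"
    "dist (1 - x * a) (1 - y * a) \<le> norm a * dist x y" for x y
    using norm_mult_ineq[of a "y - x"] norm_mult_ineq[of "y - x" a]
    by (simp_all add: dist_norm norm_minus_commute algebra_simps)
  obtain y where y: "1 - a * y = y"
    using banach_fix_type[of "norm a" "\<lambda>y. 1 - a * y"] assms lip by auto
  obtain z where z: "1 - z * a = z"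
    using banach_fix_type[of "norm a" "\<lambda>z. 1 - z * a"] assms lip by auto
  have "(1 + a) * y = 1" "z * (1 + a) = 1" using y z by (simp_all add: algebra_simps)
  moreover from this have "z = y" by (rule left_right_inverse_eq)
  ultimately show ?thesis by (auto intro: runitI)
qed

lemma runit_near:
  fixes x y :: "'r::{real_normed_algebra, monoid_mult, banach}"
  assumes "runit x" "norm (rinv x) * norm (y - x) < 1" shows "runit y"
proof -
  have "norm (rinv x * (y - x)) < 1" using norm_mult_ineq assms(2) by (rule le_less_trans)
  then have "runit (x * (1 + rinv x * (y - x)))" using assms(1) by (intro runit_mult runit_one_plus)
  then show ?thesis using assms(1) by (simp add: algebra_simps)
qed

lemma open_runit: "open {x :: 'r::{real_normed_algebra, monoid_mult, banach}. runit x}"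
  unfolding open_dist
proof clarify
  fix x :: 'r assume x: "runit x"
  (* The summand 1 keeps the radius finite in the zero algebra, where the inverse has norm 0. *)
  define e where "e = 1 / (norm (rinv x) + 1)"
  have e: "e > 0" by (simp add: e_def add_nonneg_pos)
  have "runit y" if "dist y x < e" for y
  proof (rule runit_near[OF x])
    have "norm (rinv x) * norm (y - x) \<le> norm (rinv x) * e"
      using that by (intro mult_left_mono) (auto simp: dist_norm)
    also have "\<dots> < 1" by (simp add: e_def divide_less_eq add_nonneg_pos)
    finally show "norm (rinv x) * norm (y - x) < 1" .
  qed
  then show "\<exists>e>0. \<forall>y. dist y x < e \<longrightarrow> y \<in> {x. runit x}" using e by blast
qed

text \<open>
  By the identity \<open>y\<^sup>-\<^sup>1 = x\<^sup>-\<^sup>1 - y\<^sup>-\<^sup>1 (y - x) x\<^sup>-\<^sup>1\<close> the norm of \<open>y\<^sup>-\<^sup>1\<close> is at most that of \<open>x\<^sup>-\<^sup>1\<close> plus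
  half of itself.
\<close>

lemma norm_rinv_near:
  fixes x y :: "'r::{real_normed_algebra, monoid_mult}"
  assumes x: "runit x" and y: "runit y" and near: "norm (y - x) * norm (rinv x) \<le> 1/2"
  shows "norm (rinv y) \<le> 2 * norm (rinv x)"
proof -
  have "rinv y * (y - x) * rinv x = rinv x - rinv y"
    using x y by (simp add: right_diff_distrib left_diff_distrib mult.assoc)
  then have "rinv y = rinv x - rinv y * (y - x) * rinv x" by simp
  then have "norm (rinv y) \<le> norm (rinv x) + norm (rinv y * ((y - x) * rinv x))"
    by (metis mult.assoc norm_triangle_ineq4)
  also have "norm (rinv y * ((y - x) * rinv x)) \<le> norm (rinv y) * (norm (y - x) * norm (rinv x))"
    by (intro order_trans[OF norm_mult_ineq] mult_left_mono norm_mult_ineq) auto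
  also have "\<dots> \<le> norm (rinv y) * (1/2)" using near by (intro mult_left_mono) auto
  finally show ?thesis by simp
qed

section \<open>Reciprocals of smooth maps\<close>

text \<open>
  The inverse of \<open>\<Phi>\<close> for the shuffle product, where \<open>h\<close> is the inverse of \<open>\<Phi> []\<close>: the recursion
  solves the equation that the product vanishes on nonempty lists for its term with empty left list.
\<close>

function (sequential) jet_inv :: "'r \<Rightarrow> ('a list \<Rightarrow> 'r::real_normed_algebra) \<Rightarrow> 'a list \<Rightarrow> 'r" where
  "jet_inv h \<Phi> [] = h"
| "jet_inv h \<Phi> vs =
     - h * (\<Sum>(us, ws)\<leftarrow>filter (\<lambda>(us, ws). us \<noteq> []) (splits vs). \<Phi> us * jet_inv h \<Phi> ws)"
  by pat_completeness auto
termination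
  by (relation "Wellfounded.measure (\<lambda>(h, \<Phi>, vs). length vs)") (auto dest!: splits_length simp flip: length_greater_0_conv)

declare jet_inv.simps(2) [simp del]

lemma leibniz_jet_inv:
  fixes \<Phi> :: "'a list \<Rightarrow> 'r::{real_normed_algebra, monoid_mult}"
  assumes "\<Phi> [] * h = 1"
  shows "leibniz \<Phi> (jet_inv h \<Phi>) vs = (if vs = [] then 1 else 0)"
proof (cases vs)
  case (Cons v vs')
  have "leibniz (\<Phi>([] := 0)) (jet_inv h \<Phi>) vs
      = (\<Sum>(us, ws)\<leftarrow>filter (\<lambda>(us, ws). us \<noteq> []) (splits vs). \<Phi> us * jet_inv h \<Phi> ws)"
    unfolding leibniz_def sum_list_map_filter'
    by (intro arg_cong[where f = sum_list] map_cong) auto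
  then have "jet_inv h \<Phi> vs = - h * leibniz (\<Phi>([] := 0)) (jet_inv h \<Phi>) vs"
    using Cons by (simp add: jet_inv.simps(2))
  then have "\<Phi> [] * jet_inv h \<Phi> vs = - leibniz (\<Phi>([] := 0)) (jet_inv h \<Phi>) vs"
    using assms by (simp flip: mult.assoc)
  then show ?thesis using Cons leibniz_split_off_Nil[of \<Phi> "jet_inv h \<Phi>" vs] by simp
qed (use assms in auto)

text \<open>
  Truncation turns statements about all lists shorter than \<open>n\<close> into statements about all lists, so
  that the closure properties of the shuffle product apply inside an induction on the length.
\<close>

definition trunc :: "nat \<Rightarrow> ('a list \<Rightarrow> 'b::zero) \<Rightarrow> 'a list \<Rightarrow> 'b" where
  "trunc n E us = (if length us < n then E us else 0)"

lemma leibniz_solve: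
  fixes \<Phi> :: "'a list \<Rightarrow> 'r::{real_normed_algebra, monoid_mult}"
  assumes h: "h * \<Phi> [] = 1" and len: "length vs \<le> n"
  shows "E vs = h * (leibniz \<Phi> E vs - leibniz (\<Phi>([] := 0)) (trunc n E) vs)"
proof -
  have "leibniz (\<Phi>([] := 0)) (trunc n E) vs = leibniz (\<Phi>([] := 0)) E vs"
    using len by (intro leibniz_strict_cong) (auto simp: trunc_def)
  then show ?thesis
    using h by (subst leibniz_split_off_Nil) (simp flip: mult.assoc)
qed

text \<open>
  Multiplication by \<open>\<Phi>\<close> in the shuffle algebra has a bounded inverse as soon as \<open>\<Phi> []\<close> is
  invertible. The constant depends only on bounds for \<open>h\<close> and \<open>\<Phi>\<close>, so it serves all points near a
  given one.
\<close>

lemma leibniz_inverse_bound: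
  assumes "H \<ge> 0" "a \<ge> 0"
  shows "\<exists>C\<ge>0. \<forall>h \<Phi> E q. norm h \<le> H \<longrightarrow> h * \<Phi> [] = (1 :: 'r::{real_normed_algebra, monoid_mult})
     \<longrightarrow> list_bd n a \<Phi> \<longrightarrow> q \<ge> 0 \<longrightarrow> list_bd n q (leibniz \<Phi> E)
     \<longrightarrow> list_bd n (C * q) (E :: 'a::real_normed_vector list \<Rightarrow> 'r)"
proof (induction n)
  case 0
  show ?case by (auto simp: list_bd_def)
next
  case (Suc n)
  then obtain C where "C \<ge> 0" and
    C: "\<And>h \<Phi> E q. norm h \<le> H \<Longrightarrow> h * \<Phi> [] = 1 \<Longrightarrow> list_bd n a \<Phi> \<Longrightarrow> q \<ge> 0 \<Longrightarrow>
        list_bd n q (leibniz \<Phi> E) \<Longrightarrow> list_bd n (C * q) (E :: 'a list \<Rightarrow> 'r)" by blast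
  let ?C = "H * (1 + 2 ^ Suc n * a * C)"
  have "list_bd (Suc n) (?C * q) E"
    if hyp: "norm h \<le> H" "h * \<Phi> [] = 1" "list_bd (Suc n) a \<Phi>" "q \<ge> 0"
       "list_bd (Suc n) q (leibniz \<Phi> E)" for h \<Phi> q and E :: "'a list \<Rightarrow> 'r"
  proof -
    let ?N = "\<Phi>([] := 0)"
    have "list_bd n (C * q) E"
      using hyp by (intro C[of h \<Phi>]) (auto intro: list_bd_mono)
    then have T: "list_bd (Suc n) (C * q) (trunc n E)"
      using \<open>C \<ge> 0\<close> hyp by (auto simp: list_bd_def trunc_def prod_list_norm_nonneg)
    have N: "list_bd (Suc n) a ?N" using hyp(3) assms by (auto simp: list_bd_def)
    have Q: "list_bd (Suc n) (q + 2 ^ Suc n * a * (C * q)) (\<lambda>vs. leibniz \<Phi> E vs + - leibniz ?N (trunc n E) vs)"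
      using assms \<open>C \<ge> 0\<close> hyp by (intro list_bd_add list_bd_minus list_bd_leibniz T N) auto
    show ?thesis unfolding list_bd_def
    proof (intro allI impI)
      fix vs :: "'a list" assume len: "length vs < Suc n"
      have "E vs = h * (leibniz \<Phi> E vs + - leibniz ?N (trunc n E) vs)"
        using leibniz_solve[of h \<Phi> vs n E] hyp(2) len by simp
      then have "norm (E vs) \<le> norm h * norm (leibniz \<Phi> E vs + - leibniz ?N (trunc n E) vs)"
        by (metis norm_mult_ineq)
      also have "\<dots> \<le> H * ((q + 2 ^ Suc n * a * (C * q)) * prod_list (map norm vs))"
        using list_bdD[OF Q len] hyp(1) assms by (intro mult_mono) auto
      finally show "norm (E vs) \<le> ?C * q * prod_list (map norm vs)" by (simp add: algebra_simps)
    qed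
  qed
  then show ?case using assms \<open>C \<ge> 0\<close> by (intro exI[of _ ?C]) auto
qed

lemma multilin_leibniz_inverse:
  fixes \<Theta> :: "'a::real_vector list \<Rightarrow> 'r::{real_normed_algebra, monoid_mult}"
  assumes h: "h * \<Phi> [] = 1" and \<Phi>: "multilin \<Phi>"
    and \<Theta>: "\<And>vs. leibniz \<Phi> \<Theta> vs = (if vs = [] then 1 else 0)"
  shows "multilin \<Theta>"
proof -
  have "multilin (trunc n \<Theta>)" for n
  proof (induction n)
    case 0
    show ?case by (simp add: multilin_def trunc_def)
  next
    case (Suc n)
    have "multilin (\<Phi>([] := 0))" using \<Phi> by (simp add: multilin_def)
    from multilin_leibniz[OF this Suc]
    have M: "multilin (leibniz (\<Phi>([] := 0)) (trunc n \<Theta>))" .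
    have "multilin (\<lambda>vs. - h * leibniz (\<Phi>([] := 0)) (trunc n \<Theta>) vs)"
      by (rule multilin_linear[OF M]) (simp add: linear_iff algebra_simps)
    moreover have "trunc (Suc n) \<Theta> (us @ v # ws) = (if length (us @ v # ws) < Suc n then
        - h * leibniz (\<Phi>([] := 0)) (trunc n \<Theta>) (us @ v # ws) else 0)" for us v ws
      using leibniz_solve[of h \<Phi> "us @ v # ws" n \<Theta>] h \<Theta> by (simp add: trunc_def)
    ultimately show ?case by (simp add: multilin_def)
  qed
  then have T: "multilin (trunc n \<Theta>)" for n .
  have E: "\<Theta> vs = trunc (Suc (length vs)) \<Theta> vs" for vs by (simp add: trunc_def)
  show ?thesis
    unfolding multilin_def
  proof (intro conjI allI)
    fix us ws :: "'a list" and v w :: 'a and a :: real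
    have T': "multilin (trunc (Suc (Suc (length us + length ws))) \<Theta>)" by (rule T)
    show "\<Theta> (us @ (v + w) # ws) = \<Theta> (us @ v # ws) + \<Theta> (us @ w # ws)"
      using T'[unfolded multilin_def, THEN conjunct1, rule_format, of us v w ws] by (simp add: trunc_def)
    show "\<Theta> (us @ (a *\<^sub>R v) # ws) = a *\<^sub>R \<Theta> (us @ v # ws)"
      using T'[unfolded multilin_def, THEN conjunct2, rule_format, of us a v ws] by (simp add: trunc_def)
  qed
qed

text \<open>
  Estimates may be divided by a jet with invertible leading term.
\<close>

lemma bigo_leibniz_inverse:
  fixes \<Phi> :: "'a::real_normed_vector list \<Rightarrow> 'r::{real_normed_algebra, monoid_mult}"
  assumes "h * \<Phi> [] = 1" "list_bd n a \<Phi>" "bigo_at x n (\<lambda>y. leibniz \<Phi> (E y))"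
  shows "bigo_at x n E"
proof -
  obtain b where b: "b \<ge> 0" "list_bd n b \<Phi>" using list_bd_nonneg[OF assms(2)] .
  obtain C where C0: "C \<ge> 0" and bd: "(\<forall>h' \<Phi> E q. norm h' \<le> norm h \<longrightarrow> h' * \<Phi> [] = (1 :: 'r)
     \<longrightarrow> list_bd n b \<Phi> \<longrightarrow> q \<ge> 0 \<longrightarrow> list_bd n q (leibniz \<Phi> E)
     \<longrightarrow> list_bd n (C * q) (E :: 'a list \<Rightarrow> 'r))"
    using leibniz_inverse_bound[OF norm_ge_zero[of h] b(1), where n = n] by (elim exE conjE)
  have C: "C \<ge> 0" "\<And>E q. q \<ge> 0 \<Longrightarrow> list_bd n q (leibniz \<Phi> E) \<Longrightarrow> list_bd n (C * q) E"
    by (rule C0) (use bd[rule_format, of h \<Phi>] assms(1) b(2) in auto)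
  obtain c where c: "c \<ge> 0" "\<forall>\<^sub>F y in nhds x. list_bd n (c * norm (y - x)) (leibniz \<Phi> (E y))"
    using assms(3) unfolding bigo_at_def by blast
  from c(2) have "\<forall>\<^sub>F y in nhds x. list_bd n (C * c * norm (y - x)) (E y)"
  proof eventually_elim
    case (elim y)
    from C(2)[OF _ elim] c show ?case by (simp add: mult_ac)
  qed
  then show ?thesis using C c unfolding bigo_at_def by (intro exI[of _ "C * c"]) auto
qed

lemma smallo_leibniz_inverse:
  fixes \<Phi> :: "'a::real_normed_vector list \<Rightarrow> 'r::{real_normed_algebra, monoid_mult}"
  assumes "h * \<Phi> [] = 1" "list_bd n a \<Phi>" "smallo_at x n (\<lambda>y. leibniz \<Phi> (E y))"
  shows "smallo_at x n E"
  unfolding smallo_at_def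
proof (intro allI impI)
  fix \<epsilon> :: real assume "\<epsilon> > 0"
  obtain b where b: "b \<ge> 0" "list_bd n b \<Phi>" using list_bd_nonneg[OF assms(2)] .
  obtain C where C0: "C \<ge> 0" and bd: "(\<forall>h' \<Phi> E q. norm h' \<le> norm h \<longrightarrow> h' * \<Phi> [] = (1 :: 'r)
     \<longrightarrow> list_bd n b \<Phi> \<longrightarrow> q \<ge> 0 \<longrightarrow> list_bd n q (leibniz \<Phi> E)
     \<longrightarrow> list_bd n (C * q) (E :: 'a list \<Rightarrow> 'r))"
    using leibniz_inverse_bound[OF norm_ge_zero[of h] b(1), where n = n] by (elim exE conjE)
  have C: "C \<ge> 0" "\<And>E q. q \<ge> 0 \<Longrightarrow> list_bd n q (leibniz \<Phi> E) \<Longrightarrow> list_bd n (C * q) E"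
    by (rule C0) (use bd[rule_format, of h \<Phi>] assms(1) b(2) in auto)
  obtain e where e: "e > 0" "C * e \<le> \<epsilon>" using small_factor[OF \<open>\<epsilon> > 0\<close> C(1)] .
  have "\<forall>\<^sub>F y in nhds x. list_bd n (e * norm (y - x)) (leibniz \<Phi> (E y))"
    using assms(3) e unfolding smallo_at_def by blast
  then show "\<forall>\<^sub>F y in nhds x. list_bd n (\<epsilon> * norm (y - x)) (E y)"
  proof eventually_elim
    case (elim y)
    have "list_bd n (C * (e * norm (y - x))) (E y)" using elim e by (intro C) auto
    moreover have "C * (e * norm (y - x)) \<le> \<epsilon> * norm (y - x)"
      using mult_right_mono[OF e(2), of "norm (y - x)"] by (simp add: mult.assoc)
    ultimately show ?case by (rule list_bd_mono) simp
  qed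
qed

lemma bigo_cong: 
  assumes "\<forall>\<^sub>F y in nhds x. R y = S y" "bigo_at x n R" shows "bigo_at x n S"
proof -
  obtain c where c: "c \<ge> 0" "\<forall>\<^sub>F y in nhds x. list_bd n (c * norm (y - x)) (R y)"
    using assms(2) unfolding bigo_at_def by blast
  from assms(1) c(2) have "\<forall>\<^sub>F y in nhds x. list_bd n (c * norm (y - x)) (S y)"
    by eventually_elim simp
  then show ?thesis using c unfolding bigo_at_def by blast
qed

lemma smallo_cong: 
  assumes "\<forall>\<^sub>F y in nhds x. R y = S y" "smallo_at x n R" shows "smallo_at x n S"
  unfolding smallo_at_def
proof (intro allI impI)
  fix \<epsilon> :: real assume "\<epsilon> > 0"
  then have "\<forall>\<^sub>F y in nhds x. list_bd n (\<epsilon> * norm (y - x)) (R y)"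
    using assms(2) unfolding smallo_at_def by blast
  with assms(1) show "\<forall>\<^sub>F y in nhds x. list_bd n (\<epsilon> * norm (y - x)) (S y)"
    by eventually_elim simp
qed

text \<open>
  With \<open>\<Theta>\<close> the shuffle inverse of the jet \<open>D\<close> of \<open>f\<close>, subtracting the equations \<open>D\<cdot>\<Theta> = 1\<close> at \<open>x\<close> and
  at \<open>y\<close> expresses \<open>D x\<close> times the increment of \<open>\<Theta>\<close>, and \<open>D x\<close> times its first-order remainder, by the
  corresponding quantities of \<open>D\<close>. Dividing by \<open>D x\<close> gives first the continuity and then the
  differentiability of \<open>\<Theta>\<close>, in all degrees at once.
\<close>

lemma jet_smooth_rinv:
  fixes f :: "'a::real_normed_vector \<Rightarrow> 'r::{real_normed_algebra, monoid_mult}"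
  assumes sm: "jet_smooth U f" and unit: "\<And>x. x \<in> U \<Longrightarrow> runit (f x)"
  shows "jet_smooth U (\<lambda>x. rinv (f x))"
proof -
  obtain D where D: "jet U f D" and U: "open U" using sm unfolding jet_smooth_def by blast
  define \<Theta> where "\<Theta> x = jet_inv (rinv (f x)) (D x)" for x
  have D0: "D x [] = f x" if "x \<in> U" for x using D that unfolding jet_def by blast
  have \<Theta>: "leibniz (D x) (\<Theta> x) vs = (if vs = [] then 1 else 0)" if "x \<in> U" for x vs
    unfolding \<Theta>_def by (rule leibniz_jet_inv) (use D0 unit that in auto)
  have h: "rinv (f x) * D x [] = 1" if "x \<in> U" for x using D0 unit that by auto
  have "jet U (\<lambda>x. rinv (f x)) \<Theta>"
    unfolding jet_def
  proof (intro ballI conjI)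
    fix x assume x: "x \<in> U"
    have evU: "\<forall>\<^sub>F y in nhds x. y \<in> U" using U x by (simp add: eventually_nhds_in_open)
    show "\<Theta> x [] = rinv (f x)" by (simp add: \<Theta>_def)
    show "multilin (\<Theta> x)"
      using multilin_leibniz_inverse[OF h[OF x] _ \<Theta>[OF x]] D x unfolding jet_def by blast
    have near: "\<forall>\<^sub>F y in nhds x. norm (rinv (f y)) \<le> 2 * norm (rinv (f x))"
    proof -
      have "isCont f x"
        using jet_smooth_continuous[OF sm] U x by (simp add: continuous_on_eq_continuous_at)
      then have "((\<lambda>y. norm (f y - f x) * norm (rinv (f x))) \<longlongrightarrow> norm (f x - f x) * norm (rinv (f x))) (nhds x)"
        by (intro tendsto_intros) (simp add: isCont_def tendsto_at_iff_tendsto_nhds)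
      then have "\<forall>\<^sub>F y in nhds x. norm (f y - f x) * norm (rinv (f x)) < 1/2"
        by (intro order_tendstoD(2)) auto
      with evU show ?thesis
        by eventually_elim (use unit x in \<open>auto intro!: norm_rinv_near\<close>)
    qed
    have bn: "bounded_near x n \<Theta>" for n
    proof -
      obtain a where a: "a \<ge> 0" "\<forall>\<^sub>F y in nhds x. list_bd n a (D y)"
        using jet_bounded_near[OF D x] unfolding bounded_near_def by blast
      have H: "0 \<le> 2 * norm (rinv (f x))" by simp
      obtain C where C: "C \<ge> 0" "(\<forall>h \<Phi> E q. norm h \<le> 2 * norm (rinv (f x)) \<longrightarrow> h * \<Phi> [] = (1 :: 'r)
     \<longrightarrow> list_bd n a \<Phi> \<longrightarrow> q \<ge> 0 \<longrightarrow> list_bd n q (leibniz \<Phi> E)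
     \<longrightarrow> list_bd n (C * q) (E :: 'a list \<Rightarrow> 'r))"
        using leibniz_inverse_bound[OF H a(1), where n = n] by (elim exE conjE)
      from near a(2) evU have "\<forall>\<^sub>F y in nhds x. list_bd n (C * norm (1::'r)) (\<Theta> y)"
      proof eventually_elim
        case (elim y)
        show ?case
          by (rule C(2)[rule_format, of "rinv (f y)" "D y", OF elim(1) h[OF elim(3)] elim(2)])
            (auto simp: list_bd_def \<Theta>[OF elim(3)] prod_list_norm_nonneg)
      qed
      then show ?thesis using C(1) unfolding bounded_near_def by (intro exI[of _ "C * norm (1::'r)"]) auto
    qed
    then show "\<forall>n. \<exists>c. list_bd n c (\<Theta> x)"
      unfolding bounded_near_def by (meson eventually_nhds_x_imp_x)
    have diff: "bigo_at x n (\<lambda>y vs. \<Theta> y vs - \<Theta> x vs)" for n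
    proof -
      obtain a where a: "list_bd n a (D x)" using D x unfolding jet_def by blast
      have "bigo_at x n (\<lambda>y. leibniz (\<lambda>vs. D y vs - D x vs) (\<lambda>vs. \<Theta> y vs))"
        by (intro bigo_leibniz jet_bigo[OF D x] bn)
      moreover have "bigo_at x n (\<lambda>y vs. - R y vs)" if "bigo_at x n R" for R :: "'a \<Rightarrow> 'a list \<Rightarrow> 'r"
        using that unfolding bigo_at_def by (auto simp: list_bd_def)
      ultimately have "bigo_at x n (\<lambda>y vs. - leibniz (\<lambda>vs. D y vs - D x vs) (\<lambda>vs. \<Theta> y vs) vs)"
        by blast
      moreover have "\<forall>\<^sub>F y in nhds x. (\<lambda>vs. - leibniz (\<lambda>vs. D y vs - D x vs) (\<lambda>vs. \<Theta> y vs) vs)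
          = leibniz (D x) (\<lambda>vs. \<Theta> y vs - \<Theta> x vs)"
        using evU
        by eventually_elim (auto simp: leibniz_diff_left leibniz_diff_right \<Theta> x)
      ultimately have "bigo_at x n (\<lambda>y. leibniz (D x) (\<lambda>vs. \<Theta> y vs - \<Theta> x vs))"
        by (rule bigo_cong[rotated])
      then show ?thesis by (rule bigo_leibniz_inverse[OF h[OF x] a])
    qed
    have "smallo_at x n (\<lambda>y vs. \<Theta> y vs - \<Theta> x vs - \<Theta> x ((y - x) # vs))" for n
    proof -
      obtain a where a: "list_bd (Suc n) a (D x)" using D x unfolding jet_def by blast
      have a': "list_bd n a (D x)" using a by (auto intro: list_bd_mono)
      let ?Q = "\<lambda>y vs. - (leibniz (\<lambda>us. D y us - D x us - D x ((y - x) # us)) (\<Theta> y) vs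
          + leibniz (\<lambda>us. D x ((y - x) # us)) (\<lambda>us. \<Theta> y us - \<Theta> x us) vs)"
      have "smallo_at x n ?Q"
        by (intro smallo_minus smallo_add smallo_leibniz_left smallo_leibniz_bigo jet_smallo[OF D x]
            bn bigo_shift[OF a] diff)
      moreover have "\<forall>\<^sub>F y in nhds x. ?Q y
          = leibniz (D x) (\<lambda>vs. \<Theta> y vs - \<Theta> x vs - \<Theta> x ((y - x) # vs))"
        using evU
      proof eventually_elim
        case (elim y)
        have "leibniz (D x) (\<lambda>vs. \<Theta> x ((y - x) # vs)) vs = - leibniz (\<lambda>us. D x ((y - x) # us)) (\<Theta> x) vs" for vs
          using \<Theta>[OF x, of "(y - x) # vs"] by (simp add: leibniz_Cons eq_neg_iff_add_eq_0 add.commute)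
        then show ?case
          by (simp add: fun_eq_iff leibniz_diff_left leibniz_diff_right \<Theta> x elim)
      qed
      ultimately have "smallo_at x n (\<lambda>y. leibniz (D x) (\<lambda>vs. \<Theta> y vs - \<Theta> x vs - \<Theta> x ((y - x) # vs)))"
        by (rule smallo_cong[rotated])
      then show ?thesis by (rule smallo_leibniz_inverse[OF h[OF x] a'])
    qed
    then show "\<forall>n. \<forall>\<epsilon>>0. \<forall>\<^sub>F y in nhds x. list_bd n (\<epsilon> * norm (y - x))
        (\<lambda>vs. \<Theta> y vs - \<Theta> x vs - \<Theta> x ((y - x) # vs))"
      unfolding smallo_at_def by blast
  qed
  then show ?thesis using U unfolding jet_smooth_def by blast
qed

section \<open>The Cayley transform\<close>

definition cayley :: "'r::{ring, monoid_mult} \<Rightarrow> 'r" where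
  "cayley x = (1 - x) * rinv (1 + x)"

text \<open>
  Replace \<open>1\<close> by \<open>(1 + x)(1 + x)\<^sup>-\<^sup>1\<close>.
\<close>

lemma one_plus_cayley:
  fixes x :: "'r::{real_normed_algebra, monoid_mult}"
  assumes "runit (1 + x)"
  shows "1 + cayley x = (2::real) *\<^sub>R rinv (1 + x)" "1 - cayley x = (2::real) *\<^sub>R (x * rinv (1 + x))"
proof -
  have one: "1 = (1 + x) * rinv (1 + x)" using assms by simp
  show "1 + cayley x = (2::real) *\<^sub>R rinv (1 + x)" "1 - cayley x = (2::real) *\<^sub>R (x * rinv (1 + x))"
    unfolding cayley_def by (subst (1) one; simp add: algebra_simps scaleR_2)+
qed

lemma runit_scaleR:
  fixes x :: "'r::{real_normed_algebra, monoid_mult}"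
  assumes "runit x" "c \<noteq> 0" shows "runit (c *\<^sub>R x)" "rinv (c *\<^sub>R x) = inverse c *\<^sub>R rinv x"
  using assms by (auto intro!: runitI[of _ "inverse c *\<^sub>R rinv x"] rinv_unique)

lemma runit_one_plus_cayley:
  fixes x :: "'r::{real_normed_algebra, monoid_mult}"
  shows "runit (1 + x) \<Longrightarrow> runit (1 + cayley x)"
  by (simp add: one_plus_cayley runit_scaleR)

lemma cayley_cayley:
  fixes x :: "'r::{real_normed_algebra, monoid_mult}"
  assumes "runit (1 + x)" shows "cayley (cayley x) = x"
  using assms unfolding cayley_def[of "cayley x"]
  by (simp add: one_plus_cayley runit_scaleR mult.assoc)

lemma runit_one_minus_cayley:
  fixes x :: "'r::{real_normed_algebra, monoid_mult}"
  assumes "runit (1 + x)" "runit x" shows "runit (1 - cayley x)"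
  using assms by (simp add: one_plus_cayley runit_scaleR)

lemma runit_cayley:
  fixes x :: "'r::{real_normed_algebra, monoid_mult}"
  assumes "runit (1 + x)" "runit (1 - x)" shows "runit (cayley x)"
  using assms by (simp add: cayley_def)

lemma jet_smooth_cayley:
  fixes f :: "'a::real_normed_vector \<Rightarrow> 'r::{real_normed_algebra, monoid_mult}"
  assumes "jet_smooth U f" "\<And>x. x \<in> U \<Longrightarrow> runit (1 + f x)"
  shows "jet_smooth U (\<lambda>x. cayley (f x))"
proof -
  have "open U" using assms(1) by (simp add: jet_smooth_def)
  then show ?thesis unfolding cayley_def
    by (intro jet_smooth_mult jet_smooth_rinv jet_smooth_diff jet_smooth_add jet_smooth_const assms)
qed

section \<open>Normed spaces embedded in a type\<close>

text \<open>
  A normed space on a carrier, modelled by an isometric linear map \<open>J\<close> into a type; \<open>sc\<close> is the scalar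
  multiplication on the side of the type. All axioms of a normed space are inherited along \<open>J\<close>.
\<close>

locale nvs_embedding =
  fixes V :: "('k::real_normed_field, 'a) nvs"
    and sc :: "'k \<Rightarrow> 'v \<Rightarrow> 'v::real_normed_vector"
    and J :: "'a \<Rightarrow> 'v"
  assumes inj: "inj_on J (carrier V)"
    and add_closed: "\<And>x y. x \<in> carrier V \<Longrightarrow> y \<in> carrier V \<Longrightarrow> vadd V x y \<in> carrier V"
    and zero_closed: "vzero V \<in> carrier V"
    and scale_closed: "\<And>a x. x \<in> carrier V \<Longrightarrow> vscale V a x \<in> carrier V"
    and J_add: "\<And>x y. x \<in> carrier V \<Longrightarrow> y \<in> carrier V \<Longrightarrow> J (vadd V x y) = J x + J y"
    and J_zero: "J (vzero V) = 0"
    and J_scale: "\<And>a x. x \<in> carrier V \<Longrightarrow> J (vscale V a x) = sc a (J x)"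
    and J_norm: "\<And>x. x \<in> carrier V \<Longrightarrow> vnorm V x = norm (J x)"
    and sc_add_right: "\<And>a u v. sc a (u + v) = sc a u + sc a v"
    and sc_add_left: "\<And>a b u. sc (a + b) u = sc a u + sc b u"
    and sc_mult: "\<And>a b u. sc (a * b) u = sc a (sc b u)"
    and sc_one: "\<And>u. sc 1 u = u"
    and norm_sc: "\<And>a u. norm (sc a u) = norm a * norm u"
begin

lemma J_eq_iff: "x \<in> carrier V \<Longrightarrow> y \<in> carrier V \<Longrightarrow> J x = J y \<longleftrightarrow> x = y"
  using inj by (auto dest: inj_onD)

lemma sc_minus_one: "sc (- 1) u = - u"
proof -
  have "sc 0 u = 0" using sc_add_left[of 0 0 u] by simp
  then have "sc (- 1) u + u = 0" using sc_add_left[of "- 1" 1 u] by (simp add: sc_one)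
  then show ?thesis by (simp add: eq_neg_iff_add_eq_0)
qed

lemma diff_closed: "x \<in> carrier V \<Longrightarrow> y \<in> carrier V \<Longrightarrow> vdiff V x y \<in> carrier V"
  by (simp add: vdiff_def add_closed scale_closed)

lemma J_diff: "x \<in> carrier V \<Longrightarrow> y \<in> carrier V \<Longrightarrow> J (vdiff V x y) = J x - J y"
  by (simp add: vdiff_def J_add J_scale scale_closed sc_minus_one)

lemma normed_space: "normed_space V"
proof -
  let ?G = "\<lparr>carrier = carrier V, monoid.mult = vadd V, one = vzero V\<rparr>"
  have neg: "vadd V (vscale V (- 1) x) x = vzero V" if "x \<in> carrier V" for x
    using that by (intro inj_onD[OF inj])
      (auto simp: J_add J_scale J_zero sc_minus_one add_closed scale_closed zero_closed)
  have "comm_group ?G"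
  proof (rule comm_groupI)
    fix x assume x: "x \<in> carrier ?G"
    show "\<exists>y\<in>carrier ?G. y \<otimes>\<^bsub>?G\<^esub> x = \<one>\<^bsub>?G\<^esub>"
      using neg x by (auto intro!: bexI[of _ "vscale V (- 1) x"] scale_closed)
  qed (auto intro!: inj_onD[OF inj] add_closed zero_closed simp: J_add J_zero add_closed zero_closed add_ac)
  then show ?thesis
    unfolding normed_space_def
    by (auto simp: J_norm J_add J_scale add_closed scale_closed zero_closed norm_sc norm_triangle_ineq
        J_zero simp flip: J_eq_iff intro!: inj_onD[OF inj] simp: sc_add_left sc_add_right sc_mult sc_one)
qed

lemma vdist_eq: "x \<in> carrier V \<Longrightarrow> y \<in> carrier V \<Longrightarrow> vdist V x y = dist (J x) (J y)"
  by (simp add: vdist_def J_norm diff_closed J_diff dist_norm)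

sublocale M: Metric_space "carrier V" "vdist V"
proof
  show "0 \<le> vdist V x y" for x y
    by (cases "x \<in> carrier V \<and> y \<in> carrier V") (auto simp: vdist_eq, auto simp: vdist_def)
  show "vdist V x y = vdist V y x" for x y
    by (cases "x \<in> carrier V \<and> y \<in> carrier V") (auto simp: vdist_eq dist_commute, auto simp: vdist_def)
  show "(vdist V x y = 0) = (x = y)" if "x \<in> carrier V" "y \<in> carrier V" for x y
    using that by (simp add: vdist_eq J_eq_iff)
  show "vdist V x z \<le> vdist V x y + vdist V y z"
    if "x \<in> carrier V" "y \<in> carrier V" "z \<in> carrier V" for x y z
    using that by (simp add: vdist_eq dist_triangle)
qed

lemma norm_topology_pullback: "norm_topology V = pullback_topology (carrier V) J euclidean"
  unfolding topology_eq norm_topology_def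
proof (intro allI)
  fix S
  show "openin M.mtopology S \<longleftrightarrow> openin (pullback_topology (carrier V) J euclidean) S"
  proof
    assume S: "openin M.mtopology S"
    then have sub: "S \<subseteq> carrier V" by (simp add: M.openin_mtopology)
    obtain r where r: "\<And>x. x \<in> S \<Longrightarrow> r x > 0 \<and> M.mball x (r x) \<subseteq> S"
      using S unfolding M.openin_mtopology by metis
    define O' where "O' = (\<Union>x\<in>S. ball (J x) (r x))"
    have "S = J -` O' \<inter> carrier V"
    proof (rule equalityI; rule subsetI)
      fix y assume "y \<in> S"
      then show "y \<in> J -` O' \<inter> carrier V" using r sub by (force simp: O'_def)
    next
      fix y assume "y \<in> J -` O' \<inter> carrier V"
      then obtain x where "x \<in> S" "dist (J x) (J y) < r x" "y \<in> carrier V" by (auto simp: O'_def)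
      then have "y \<in> M.mball x (r x)" using sub by (auto simp: vdist_eq)
      then show "y \<in> S" using r[OF \<open>x \<in> S\<close>] by blast
    qed
    moreover have "open O'" by (auto simp: O'_def)
    ultimately show "openin (pullback_topology (carrier V) J euclidean) S"
      by (auto simp: openin_pullback_topology)
  next
    assume "openin (pullback_topology (carrier V) J euclidean) S"
    then obtain O' where O': "open O'" "S = J -` O' \<inter> carrier V" by (auto simp: openin_pullback_topology)
    show "openin M.mtopology S"
      unfolding M.openin_mtopology
    proof (intro conjI allI impI)
      fix x assume x: "x \<in> S"
      then obtain e where e: "e > 0" "ball (J x) e \<subseteq> O'" using O' by (auto simp: open_contains_ball)
      have "M.mball x e \<subseteq> S" using e O' by (auto simp: vdist_eq subset_iff)
      then show "\<exists>r>0. M.mball x r \<subseteq> S" using e by blast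
    qed (use O' in auto)
  qed
qed

lemma closure_of_norm_topology:
  "x \<in> norm_topology V closure_of C \<longleftrightarrow> x \<in> carrier V \<and> J x \<in> closure (J ` (C \<inter> carrier V))"
proof
  assume x: "x \<in> norm_topology V closure_of C"
  have "J ` (C \<inter> carrier V) \<inter> A \<noteq> {}" if "U \<subseteq> A" "open U" "J x \<in> U" for A U
  proof -
    have "openin (norm_topology V) (J -` U \<inter> carrier V)"
      using that by (auto simp: norm_topology_pullback openin_pullback_topology)
    moreover have "x \<in> carrier V"
      using x by (simp add: in_closure_of norm_topology_pullback topspace_pullback_topology)
    ultimately have "\<exists>y. y \<in> C \<and> y \<in> J -` U \<inter> carrier V"
      using x[unfolded in_closure_of, THEN conjunct2, rule_format, of "J -` U \<inter> carrier V"] that by simp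
    then show ?thesis using that by blast
  qed
  then show "x \<in> carrier V \<and> J x \<in> closure (J ` (C \<inter> carrier V))"
    using x unfolding closure_iff_nhds_not_empty
    by (auto simp: in_closure_of norm_topology_pullback topspace_pullback_topology)
next
  assume x: "x \<in> carrier V \<and> J x \<in> closure (J ` (C \<inter> carrier V))"
  show "x \<in> norm_topology V closure_of C"
    unfolding in_closure_of
  proof (intro conjI allI impI)
    fix T assume "x \<in> T \<and> openin (norm_topology V) T"
    then obtain U where U: "open U" "T = J -` U \<inter> carrier V" "x \<in> T"
      by (auto simp: norm_topology_pullback openin_pullback_topology)
    then have "J ` (C \<inter> carrier V) \<inter> U \<noteq> {}"
      using x unfolding closure_iff_nhds_not_empty by blast
    then show "\<exists>y. y \<in> C \<and> y \<in> T" using U by blast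
  qed (use x in \<open>simp add: norm_topology_pullback topspace_pullback_topology\<close>)
qed

lemma banach_space:
  assumes "closed (J ` carrier V)" "complete (UNIV :: 'v set)"
  shows "banach_space V"
proof -
  have C: "complete (J ` carrier V)"
    using complete_closed_subset[OF assms(1) subset_UNIV assms(2)] .
  have "M.mcomplete"
    unfolding M.mcomplete_def
  proof (intro allI impI)
    fix \<sigma> assume \<sigma>: "M.MCauchy \<sigma>"
    then have in_V: "\<sigma> n \<in> carrier V" for n by (auto simp: M.MCauchy_def)
    have "Cauchy (\<lambda>n. J (\<sigma> n))"
      unfolding Cauchy_def using \<sigma> in_V by (simp add: M.MCauchy_def vdist_eq)
    moreover have "\<forall>n. J (\<sigma> n) \<in> J ` carrier V" using in_V by blast
    ultimately obtain l where l: "l \<in> J ` carrier V" "(\<lambda>n. J (\<sigma> n)) \<longlonglongrightarrow> l"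
      using C[unfolded complete_def, rule_format, of "\<lambda>n. J (\<sigma> n)"] by auto
    then obtain x where x: "x \<in> carrier V" "l = J x" by blast
    have "limitin M.mtopology \<sigma> x sequentially"
      unfolding M.limit_metric_sequentially using l x in_V by (simp add: vdist_eq lim_sequentially)
    then show "\<exists>x. limitin M.mtopology \<sigma> x sequentially" by blast
  qed
  then show ?thesis by (simp add: banach_space_def normed_space)
qed

end

section \<open>Smoothness in coordinates\<close>

text \<open>
  On the domain of a smooth map, the coordinate \<open>J\<close> only has to be linear and continuous. This admits
  the product of two spaces, whose maximum norm differs from the norm of the product type.
\<close>

locale linear_coordinate =
  fixes V :: "(real, 'a) nvs" and J :: "'a \<Rightarrow> 'v::real_normed_vector" and K :: real
  assumes metric: "Metric_space (carrier V) (vdist V)"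
    and K_pos: "K > 0"
    and add_closed: "\<And>x y. x \<in> carrier V \<Longrightarrow> y \<in> carrier V \<Longrightarrow> vadd V x y \<in> carrier V"
    and scale_closed: "\<And>a x. x \<in> carrier V \<Longrightarrow> vscale V a x \<in> carrier V"
    and J_add: "\<And>x y. x \<in> carrier V \<Longrightarrow> y \<in> carrier V \<Longrightarrow> J (vadd V x y) = J x + J y"
    and J_scale: "\<And>a x. x \<in> carrier V \<Longrightarrow> J (vscale V a x) = a *\<^sub>R J x"
    and J_bound: "\<And>x. x \<in> carrier V \<Longrightarrow> norm (J x) \<le> K * vnorm V x"
begin

lemma diff_closed: "x \<in> carrier V \<Longrightarrow> y \<in> carrier V \<Longrightarrow> vdiff V x y \<in> carrier V"
  by (simp add: vdiff_def add_closed scale_closed)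

lemma J_diff: "x \<in> carrier V \<Longrightarrow> y \<in> carrier V \<Longrightarrow> J (vdiff V x y) = J x - J y"
  by (simp add: vdiff_def J_add J_scale scale_closed)

lemma dist_J_le: "x \<in> carrier V \<Longrightarrow> y \<in> carrier V \<Longrightarrow> norm (J x - J y) \<le> K * vdist V x y"
  using J_bound[of "vdiff V x y"] by (simp add: vdist_def diff_closed J_diff)

lemma openin_preimage:
  assumes "open O'" shows "openin (norm_topology V) {x \<in> carrier V. J x \<in> O'}"
proof -
  interpret M: Metric_space "carrier V" "vdist V" by (rule metric)
  show ?thesis
    unfolding norm_topology_def M.openin_mtopology
  proof (intro conjI allI impI)
    fix x assume x: "x \<in> {x \<in> carrier V. J x \<in> O'}"
    then obtain e where e: "e > 0" "ball (J x) e \<subseteq> O'" using assms by (auto simp: open_contains_ball)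
    have "J y \<in> ball (J x) e" if "y \<in> carrier V" "vdist V x y < e / K" for y
    proof -
      have "norm (J x - J y) \<le> K * vdist V x y" using x that by (intro dist_J_le) auto
      also have "\<dots> < e" using that K_pos by (simp add: field_simps)
      finally show ?thesis by (simp add: dist_norm)
    qed
    then have "M.mball x (e / K) \<subseteq> {x \<in> carrier V. J x \<in> O'}" using e by auto
    then show "\<exists>r>0. M.mball x r \<subseteq> {x \<in> carrier V. J x \<in> O'}"
      using e K_pos by (intro exI[of _ "e / K"]) auto
  qed auto
qed

lemma prod_list_J_le:
  "vs \<in> lists (carrier V) \<Longrightarrow>
     prod_list (map norm (map J vs)) \<le> K ^ length vs * prod_list (map (vnorm V) vs)"
proof (induction vs rule: lists.induct)
  case (Cons v vs)
  have "0 \<le> K * vnorm V v" using Cons.hyps J_bound[of v] norm_ge_zero[of "J v"] by linarith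
  then have "norm (J v) * prod_list (map norm (map J vs))
      \<le> (K * vnorm V v) * (K ^ length vs * prod_list (map (vnorm V) vs))"
    using Cons J_bound[of v] by (intro mult_mono) (use prod_list_norm_nonneg[of "map J vs"] in auto)
  then show ?case by (simp add: mult_ac)
qed simp

end

text \<open>
  A derivative in a new direction \<open>v\<close> is a limit of difference quotients along the line through \<open>x\<close>
  in direction \<open>v\<close>.
\<close>

lemma jet_directional_limit:
  assumes D: "jet Q F D" and x: "x \<in> Q"
  shows "((\<lambda>t. (1 / t) *\<^sub>R (D (x + t *\<^sub>R v) ws - D x ws)) \<longlongrightarrow> D x (v # ws)) (at 0)"
proof (rule tendstoI)
  fix e :: real assume "e > 0"
  let ?P = "prod_list (map norm ws)"
  obtain \<epsilon> where \<epsilon>: "\<epsilon> > 0" "(norm v * ?P + 1) * \<epsilon> \<le> e / 2"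
    using small_factor[of "e / 2" "norm v * ?P + 1"] \<open>e > 0\<close> prod_list_norm_nonneg[of ws]
    by (auto simp: add_nonneg_nonneg)
  have lim: "filterlim (\<lambda>t. x + t *\<^sub>R v) (nhds x) (at 0)"
  proof -
    have "((\<lambda>t. x + t *\<^sub>R v) \<longlongrightarrow> x + 0 *\<^sub>R v) (at 0)" by (intro tendsto_intros)
    then show ?thesis by simp
  qed
  have "\<forall>\<^sub>F y in nhds x. list_bd (Suc (length ws)) (\<epsilon> * norm (y - x))
      (\<lambda>vs. D y vs - D x vs - D x ((y - x) # vs))"
    using D x \<epsilon>(1) unfolding jet_def by blast
  from eventually_compose_filterlim[OF this lim] eventually_at_filter[of "\<lambda>t. t \<noteq> 0" 0 UNIV]
  have "\<forall>\<^sub>F t in at 0. list_bd (Suc (length ws)) (\<epsilon> * norm (t *\<^sub>R v))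
      (\<lambda>vs. D (x + t *\<^sub>R v) vs - D x vs - D x ((t *\<^sub>R v) # vs)) \<and> t \<noteq> 0"
    by (auto intro: eventually_conj eventually_neq_at_within)
  then show "\<forall>\<^sub>F t in at 0. dist ((1 / t) *\<^sub>R (D (x + t *\<^sub>R v) ws - D x ws)) (D x (v # ws)) < e"
  proof eventually_elim
    case (elim t)
    have "D x ((t *\<^sub>R v) # ws) = t *\<^sub>R D x (v # ws)"
      using D x unfolding jet_def multilin_def by (metis append_Nil)
    then have "norm (D (x + t *\<^sub>R v) ws - D x ws - t *\<^sub>R D x (v # ws)) \<le> \<epsilon> * norm (t *\<^sub>R v) * ?P"
      using list_bdD[OF conjunct1[OF elim], of ws] by simp
    moreover have "(1 / t) *\<^sub>R (D (x + t *\<^sub>R v) ws - D x ws) - D x (v # ws)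
        = (1 / t) *\<^sub>R (D (x + t *\<^sub>R v) ws - D x ws - t *\<^sub>R D x (v # ws))"
      using elim by (simp add: scaleR_diff_right)
    ultimately have "dist ((1 / t) *\<^sub>R (D (x + t *\<^sub>R v) ws - D x ws)) (D x (v # ws))
        \<le> \<bar>1 / t\<bar> * (\<epsilon> * norm (t *\<^sub>R v) * ?P)"
      unfolding dist_norm by (metis abs_ge_zero mult_left_mono norm_scaleR)
    also have "\<dots> = (norm v * ?P) * \<epsilon>" using elim by (simp add: field_simps)
    also have "\<dots> \<le> e / 2" using \<epsilon> by (simp add: distrib_right)
    finally show ?case using \<open>e > 0\<close> by simp
  qed
qed

text \<open>
  A map between carriers is smooth if it is given in coordinates by a map with a jet. The values of the
  jet on the range of \<open>J\<close> lie in the closed subspace \<open>L ` carrier W\<close> by induction on the length of the list: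
  each new derivative is a limit of difference quotients along a segment that stays in \<open>U\<close>.
\<close>

theorem smooth_on_of_jet_smooth:
  fixes W :: "(real, 'b) nvs" and L :: "'b \<Rightarrow> 'w::real_normed_vector"
  assumes "linear_coordinate V J K" and "nvs_embedding W scaleR L"
    and closed: "closed (L ` carrier W)"
    and sm: "jet_smooth Q F"
    and U: "U = {x \<in> carrier V. J x \<in> Q}"
    and f: "\<And>x. x \<in> U \<Longrightarrow> f x \<in> carrier W \<and> L (f x) = F (J x)"
  shows "smooth_on V W U f"
proof -
  interpret V: linear_coordinate V J K by fact
  interpret W: nvs_embedding W scaleR L by fact
  obtain D where Q: "open Q" and D: "jet Q F D" using sm unfolding jet_smooth_def by blast
  let ?S = "L ` carrier W"
  have D0: "D x [] = F x" if "x \<in> Q" for x using D that unfolding jet_def by blast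
  have J_line: "x + t *\<^sub>R J v \<in> J ` carrier V" if x: "x \<in> J ` carrier V" and "v \<in> carrier V" for x t v
  proof -
    obtain y where "y \<in> carrier V" "x = J y" using x by blast
    then have "x + t *\<^sub>R J v = J (vadd V y (vscale V t v))"
      using that by (simp add: V.J_add V.J_scale V.scale_closed)
    then show ?thesis using \<open>y \<in> carrier V\<close> that by (simp add: V.add_closed V.scale_closed)
  qed
  have S_diff: "a - b \<in> ?S" if ab: "a \<in> ?S" "b \<in> ?S" for a b
  proof -
    obtain p q where "p \<in> carrier W" "q \<in> carrier W" "a = L p" "b = L q" using ab by auto
    then show ?thesis using imageI[OF W.diff_closed, of p q L] by (simp add: W.J_diff)
  qed
  have S_scale: "t *\<^sub>R a \<in> ?S" if a: "a \<in> ?S" for a t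
  proof -
    obtain p where "p \<in> carrier W" "a = L p" using a by auto
    then show ?thesis using imageI[OF W.scale_closed, of p L t] by (simp add: W.J_scale)
  qed
  have in_S: "D x (map J vs) \<in> ?S" if "x \<in> Q" "x \<in> J ` carrier V" "vs \<in> lists (carrier V)" for x vs
    using that(3,1,2)
  proof (induction vs arbitrary: x rule: lists.induct)
    case Nil
    obtain y where "y \<in> carrier V" "x = J y" using Nil.prems by blast
    then have "y \<in> U" using Nil.prems U by simp
    then show ?case using D0[OF Nil.prems(1)] f[of y] \<open>x = J y\<close> imageI[of "f y" "carrier W" L] by simp
  next
    case (Cons v vs)
    let ?q = "\<lambda>t. (1 / t) *\<^sub>R (D (x + t *\<^sub>R J v) (map J vs) - D x (map J vs))"
    have "((\<lambda>t. x + t *\<^sub>R J v) \<longlongrightarrow> x + 0 *\<^sub>R J v) (at 0)" by (intro tendsto_intros)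
    then have "\<forall>\<^sub>F t in at 0. x + t *\<^sub>R J v \<in> Q" using Q Cons.prems by (intro topological_tendstoD) auto
    then have "\<forall>\<^sub>F t in at 0. ?q t \<in> ?S"
    proof eventually_elim
      case (elim t)
      then show ?case using Cons J_line by (intro S_scale S_diff) auto
    qed
    then show ?case
      using Lim_in_closed_set[OF closed _ _ jet_directional_limit[OF D Cons.prems(1)]] by simp
  qed
  define E where "E x vs = inv_into (carrier W) L (D (J x) (map J vs))" for x vs
  have E: "E x vs \<in> carrier W" "L (E x vs) = D (J x) (map J vs)"
    if "x \<in> U" "vs \<in> lists (carrier V)" for x vs
    using in_S[of "J x" vs] that U unfolding E_def by (auto simp: inv_into_into f_inv_into_f)
  have E_bd: "vnorm W (E x vs) \<le> c * K ^ k * prod_list (map (vnorm V) vs)"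
    if "x \<in> U" "vs \<in> lists (carrier V)" "length vs = k" "list_bd (Suc k) c (D (J x))" "c \<ge> 0" for x vs k c
  proof -
    have "vnorm W (E x vs) \<le> c * prod_list (map norm (map J vs))"
      using that list_bdD[OF that(4), of "map J vs"] by (simp add: W.J_norm E)
    also have "\<dots> \<le> c * (K ^ k * prod_list (map (vnorm V) vs))"
      using V.prod_list_J_le[OF that(2)] that by (intro mult_left_mono) auto
    finally show ?thesis by (simp add: mult.assoc)
  qed
  have "\<forall>x\<in>U. E x [] = f x"
  proof
    fix x assume x: "x \<in> U"
    have "L (E x []) = L (f x)" using D0[of "J x"] f[OF x] x U E[OF x, of "[]"] by simp
    then show "E x [] = f x" using E[OF x, of "[]"] f[OF x] W.J_eq_iff[of "E x []" "f x"] by simp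
  qed
  moreover have "bounded_multilinear V W k (E x)" if x: "x \<in> U" for k x
    unfolding bounded_multilinear_def
  proof (intro conjI ballI allI impI)
    have m: "multilin (D (J x))" using D x U unfolding jet_def by blast
    fix us ws v w and a :: real
    assume l: "us \<in> lists (carrier V)" "ws \<in> lists (carrier V)" "v \<in> carrier V"
    show "E x (us @ vscale V a v # ws) = vscale W a (E x (us @ v # ws))"
      using l m x by (intro inj_onD[OF W.inj])
        (auto simp: E W.scale_closed V.scale_closed V.J_scale W.J_scale multilin_def)
    assume w: "w \<in> carrier V"
    show "E x (us @ vadd V v w # ws) = vadd W (E x (us @ v # ws)) (E x (us @ w # ws))"
      using l w m x by (intro inj_onD[OF W.inj])
        (auto simp: E W.add_closed V.add_closed V.J_add W.J_add multilin_def)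
  next
    obtain c where "list_bd (Suc k) c (D (J x))" using D x U unfolding jet_def by blast
    then obtain c where c: "list_bd (Suc k) c (D (J x))" "c \<ge> 0" by (metis list_bd_nonneg)
    show "\<exists>C. \<forall>vs\<in>lists (carrier V). length vs = k \<longrightarrow> vnorm W (E x vs) \<le> C * prod_list (map (vnorm V) vs)"
      using E_bd[OF x _ _ c] by (intro exI[of _ "c * K ^ k"]) auto
  qed (use E x in auto)
  moreover have "\<exists>\<delta>>0. \<forall>y\<in>U. vdist V y x < \<delta> \<longrightarrow> (\<forall>vs\<in>lists (carrier V). length vs = k \<longrightarrow>
      vnorm W (vdiff W (vdiff W (E y vs) (E x vs)) (E x (vdiff V y x # vs)))
        \<le> \<epsilon> * vdist V y x * prod_list (map (vnorm V) vs))"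
    if x: "x \<in> U" and \<epsilon>: "\<epsilon> > 0" for k x \<epsilon>
  proof -
    obtain e where e: "e > 0" "K ^ Suc k * e \<le> \<epsilon>"
      using small_factor[OF \<epsilon>, of "K ^ Suc k"] V.K_pos by auto
    have "\<forall>\<^sub>F y in nhds (J x). list_bd (Suc k) (e * norm (y - J x))
        (\<lambda>vs. D y vs - D (J x) vs - D (J x) ((y - J x) # vs))"
      using D x U e unfolding jet_def by blast
    then obtain d where d: "d > 0" "\<And>y. dist y (J x) < d \<Longrightarrow> list_bd (Suc k) (e * norm (y - J x))
        (\<lambda>vs. D y vs - D (J x) vs - D (J x) ((y - J x) # vs))"
      unfolding eventually_nhds_metric by blast
    have "vnorm W (vdiff W (vdiff W (E y vs) (E x vs)) (E x (vdiff V y x # vs)))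
        \<le> \<epsilon> * vdist V y x * prod_list (map (vnorm V) vs)"
      if y: "y \<in> U" "vdist V y x < d / K" and vs: "vs \<in> lists (carrier V)" "length vs = k" for y vs
    proof -
      have xy: "x \<in> carrier V" "y \<in> carrier V" using x y U by auto
      note le = V.dist_J_le[OF xy(2,1)]
      have "K * vdist V y x < d" using y V.K_pos by (simp add: field_simps)
      then have bd: "list_bd (Suc k) (e * norm (J y - J x))
          (\<lambda>vs. D (J y) vs - D (J x) vs - D (J x) ((J y - J x) # vs))"
        using le by (intro d) (auto simp: dist_norm)
      have cl: "vdiff V y x # vs \<in> lists (carrier V)" using vs xy by (auto intro: V.diff_closed)
      have "vnorm W (vdiff W (vdiff W (E y vs) (E x vs)) (E x (vdiff V y x # vs)))
          = norm (D (J y) (map J vs) - D (J x) (map J vs) - D (J x) ((J y - J x) # map J vs))"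
        using E[OF x vs(1)] E[OF y(1) vs(1)] E[OF x cl] xy
        by (simp add: W.J_norm W.diff_closed W.J_diff V.J_diff)
      also have "\<dots> \<le> e * norm (J y - J x) * prod_list (map norm (map J vs))"
        using list_bdD[OF bd, of "map J vs"] vs by simp
      also have "\<dots> \<le> e * (K * vdist V y x) * (K ^ k * prod_list (map (vnorm V) vs))"
        using e le V.prod_list_J_le[OF vs(1)] vs(2) V.K_pos Metric_space.nonneg[OF V.metric, of y x]
        by (intro mult_mono prod_list_norm_nonneg mult_nonneg_nonneg) auto
      also have "\<dots> = (K ^ Suc k * e) * (vdist V y x * prod_list (map (vnorm V) vs))" by (simp add: mult_ac)
      also have "\<dots> \<le> \<epsilon> * (vdist V y x * prod_list (map (vnorm V) vs))"
      proof (rule mult_right_mono[OF e(2)])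
        have "0 \<le> vdist V y x" using Metric_space.nonneg[OF V.metric] .
        moreover have "0 \<le> K ^ length vs * prod_list (map (vnorm V) vs)"
          using order_trans[OF prod_list_norm_nonneg V.prod_list_J_le[OF vs(1)]] .
        then have "0 \<le> prod_list (map (vnorm V) vs)" using zero_less_power[OF V.K_pos, of "length vs"] by (auto simp: zero_le_mult_iff)
        ultimately show "0 \<le> vdist V y x * prod_list (map (vnorm V) vs)" by simp
      qed
      finally show ?thesis by (simp add: mult.assoc)
    qed
    then show ?thesis using d V.K_pos by (intro exI[of _ "d / K"]) auto
  qed
  ultimately show ?thesis
    unfolding smooth_on_def using V.openin_preimage[OF Q] U by blast
qed

lemma linear_coordinate_embedding:
  assumes "nvs_embedding V scaleR J" shows "linear_coordinate V J 1"
proof -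
  interpret nvs_embedding V scaleR J by fact
  show ?thesis
    by unfold_locales
      (auto simp: add_closed scale_closed J_add J_scale J_norm M.commute M.triangle)
qed

lemma linear_coordinate_prod:
  assumes "nvs_embedding V scaleR J"
  shows "linear_coordinate (prod_nvs V V) (map_prod J J) 2"
proof -
  interpret nvs_embedding V scaleR J by fact
  have dist: "vdist (prod_nvs V V) p q = max (vdist V (fst p) (fst q)) (vdist V (snd p) (snd q))"
    if "p \<in> carrier V \<times> carrier V" "q \<in> carrier V \<times> carrier V" for p q
    using that by (auto simp: vdist_def prod_nvs_def vdiff_def)
  have off: "vdist (prod_nvs V V) p q = 0"
    if "\<not> (p \<in> carrier V \<times> carrier V \<and> q \<in> carrier V \<times> carrier V)" for p q
    unfolding vdist_def by (rule if_not_P) (use that in \<open>simp add: prod_nvs_def\<close>)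
  show ?thesis
  proof
    fix p q r :: "'a \<times> 'a"
    show "0 \<le> vdist (prod_nvs V V) p q"
      by (cases "p \<in> carrier V \<times> carrier V \<and> q \<in> carrier V \<times> carrier V")
        (simp add: dist max.coboundedI1, simp add: off)
    show "vdist (prod_nvs V V) p q = vdist (prod_nvs V V) q p"
      by (cases "p \<in> carrier V \<times> carrier V \<and> q \<in> carrier V \<times> carrier V")
        (simp add: dist M.commute, simp add: off conj_commute)
    assume p: "p \<in> carrier (prod_nvs V V)"
    then have p': "p \<in> carrier V \<times> carrier V" by (simp add: prod_nvs_def)
    show "vscale (prod_nvs V V) a p \<in> carrier (prod_nvs V V)" for a
      using p by (auto simp: prod_nvs_def scale_closed)
    show "map_prod J J (vscale (prod_nvs V V) a p) = a *\<^sub>R map_prod J J p" for a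
      using p by (auto simp: prod_nvs_def J_scale)
    show "norm (map_prod J J p) \<le> 2 * vnorm (prod_nvs V V) p"
      using p norm_Pair_le[of "J (fst p)" "J (snd p)"] by (auto simp: prod_nvs_def J_norm)
    assume q: "q \<in> carrier (prod_nvs V V)"
    then have q': "q \<in> carrier V \<times> carrier V" by (simp add: prod_nvs_def)
    show "(vdist (prod_nvs V V) p q = 0) = (p = q)"
    proof -
      have "max a b = 0 \<longleftrightarrow> a = 0 \<and> b = 0" if "a \<ge> 0" "b \<ge> 0" for a b :: real using that by auto
      then show ?thesis using p' q' by (auto simp: dist[OF p' q'])
    qed
    show "vadd (prod_nvs V V) p q \<in> carrier (prod_nvs V V)"
      using p q by (auto simp: prod_nvs_def add_closed)
    show "map_prod J J (vadd (prod_nvs V V) p q) = map_prod J J p + map_prod J J q"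
      using p q by (auto simp: prod_nvs_def J_add)
    assume "r \<in> carrier (prod_nvs V V)"
    then have r': "r \<in> carrier V \<times> carrier V" by (simp add: prod_nvs_def)
    show "vdist (prod_nvs V V) p r \<le> vdist (prod_nvs V V) p q + vdist (prod_nvs V V) q r"
      using p' q' r' M.triangle[of "fst p" "fst q" "fst r"] M.triangle[of "snd p" "snd q" "snd r"]
      by (auto simp: dist intro: order_trans add_mono)
  qed simp
qed

section \<open>The Cayley atlas\<close>

text \<open>
  The open set on which the Cayley transform is defined and has invertible values; intersected with the
  model space it is the common image of all charts.
\<close>

definition cayley_dom :: "'r::{real_normed_algebra, monoid_mult} set" where
  "cayley_dom = {x. runit (1 + x) \<and> runit (1 - x)}"

lemma open_cayley_dom: "open (cayley_dom :: 'r::{real_normed_algebra, monoid_mult, banach} set)"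
proof -
  have "cayley_dom = (\<lambda>x::'r. 1 + x) -` {x. runit x} \<inter> (\<lambda>x. 1 - x) -` {x. runit x}"
    by (auto simp: cayley_dom_def)
  moreover have "open ((\<lambda>x::'r. 1 + x) -` {x. runit x} \<inter> (\<lambda>x. 1 - x) -` {x. runit x})"
    by (intro open_Int open_vimage open_runit continuous_intros)
  ultimately show ?thesis by simp
qed

lemma open_runit_preimage:
  fixes f :: "'a::real_normed_vector \<Rightarrow> 'r::{real_normed_algebra, monoid_mult, banach}"
  assumes "jet_smooth U f" shows "open {x \<in> U. runit (1 + f x)}"
proof -
  have "open U" using assms by (simp add: jet_smooth_def)
  then have "continuous_on U (\<lambda>x. 1 + f x)"
    using jet_smooth_continuous[OF assms] by (intro continuous_intros)
  then have "open (U \<inter> (\<lambda>x. 1 + f x) -` {y. runit y})"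
    using \<open>open U\<close> open_runit by (rule continuous_open_preimage)
  then show ?thesis by (simp add: Int_def vimage_def)
qed

text \<open>
  A group that \<open>K\<close> identifies with a group of units of a Banach algebra, and a space \<open>E\<close> that \<open>L\<close> identifies
  with a closed subspace, such that the Cayley transform carries each into the other wherever it is defined and, in the direction of
  the group, has invertible values. In the application the two ranges are isometries and skew operators.
\<close>

locale cayley_group = group G + E: nvs_embedding E "scaleR" L
  for G :: "('g, 'm) monoid_scheme" (structure)
    and E :: "(real, 'g) nvs"
    and L :: "'g \<Rightarrow> 'r::{real_normed_algebra, monoid_mult, banach}" +
  fixes K :: "'g \<Rightarrow> 'r"
  assumes K_inj: "inj_on K (carrier G)"
    and K_one: "K \<one> = 1"
    and K_mult: "\<And>g h. g \<in> carrier G \<Longrightarrow> h \<in> carrier G \<Longrightarrow> K (g \<otimes> h) = K g * K h"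
    and closed_E: "closed (L ` carrier E)"
    and cayley_in_G: "\<And>X. X \<in> L ` carrier E \<Longrightarrow> runit (1 + X) \<Longrightarrow> runit (1 - X) \<Longrightarrow> cayley X \<in> K ` carrier G"
    and cayley_in_E: "\<And>g. g \<in> K ` carrier G \<Longrightarrow> runit (1 + g) \<Longrightarrow> cayley g \<in> L ` carrier E"
begin

abbreviation T :: "'g topology" where "T \<equiv> pullback_topology (carrier G) K euclidean"

lemma K_inverse: "g \<in> carrier G \<Longrightarrow> K g * K (inv g) = 1 \<and> K (inv g) * K g = 1"
  using K_mult[of g "inv g"] K_mult[of "inv g" g] by (simp add: K_one)

lemma runit_K [simp]: "g \<in> carrier G \<Longrightarrow> runit (K g)"
  using K_inverse by (blast intro: runitI)

lemma K_inv: "g \<in> carrier G \<Longrightarrow> K (inv g) = rinv (K g)"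
  using K_inverse by (metis rinv_unique)

definition chart_dom :: "'g \<Rightarrow> 'g set" where
  "chart_dom g = {h \<in> carrier G. runit (1 + rinv (K g) * K h)}"

text \<open>
  The chart at \<open>g\<close> is \<open>h \<mapsto> c(g\<^sup>-\<^sup>1h)\<close>, and \<open>point g\<close> is its inverse \<open>X \<mapsto> g c(X)\<close>; both are pulled back to
  the carriers.
\<close>

definition chart :: "'g \<Rightarrow> 'g \<Rightarrow> 'g" where
  "chart g h = inv_into (carrier E) L (cayley (rinv (K g) * K h))"

definition point :: "'g \<Rightarrow> 'g \<Rightarrow> 'g" where
  "point g X = inv_into (carrier G) K (K g * cayley (L X))"

definition chart_image :: "'g set" where
  "chart_image = {X \<in> carrier E. L X \<in> cayley_dom}"

text \<open>
  The image condition uses \<open>1 - c(x) = 2x(1 + x)\<^sup>-\<^sup>1\<close>, a product of units if \<open>x\<close> is one.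
\<close>

lemma chart:
  assumes "g \<in> carrier G" "h \<in> chart_dom g"
  shows "chart g h \<in> chart_image" "L (chart g h) = cayley (rinv (K g) * K h)"
proof -
  have h: "h \<in> carrier G" "runit (1 + rinv (K g) * K h)" using assms by (auto simp: chart_dom_def)
  have "rinv (K g) * K h = K (inv g \<otimes> h)" using assms h by (simp add: K_mult K_inv)
  then have "rinv (K g) * K h \<in> K ` carrier G" using assms h by auto
  then have S: "cayley (rinv (K g) * K h) \<in> L ` carrier E" using h by (intro cayley_in_E)
  then show L: "L (chart g h) = cayley (rinv (K g) * K h)" by (simp add: chart_def f_inv_into_f)
  have "chart g h \<in> carrier E" using S by (simp add: chart_def inv_into_into)
  then show "chart g h \<in> chart_image"
    using assms h unfolding chart_image_def cayley_dom_def
    by (simp add: L runit_one_plus_cayley runit_one_minus_cayley)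
qed

lemma point:
  assumes "g \<in> carrier G" "X \<in> chart_image"
  shows "point g X \<in> chart_dom g" "K (point g X) = K g * cayley (L X)"
proof -
  have X: "X \<in> carrier E" "runit (1 + L X)" "runit (1 - L X)"
    using assms by (auto simp: chart_image_def cayley_dom_def)
  obtain h where h: "h \<in> carrier G" "cayley (L X) = K h" using cayley_in_G[of "L X"] X by blast
  then have "K g * cayley (L X) = K (g \<otimes> h)" using assms by (simp add: K_mult)
  then have S: "K g * cayley (L X) \<in> K ` carrier G" using assms h by auto
  then show L: "K (point g X) = K g * cayley (L X)" by (simp add: point_def f_inv_into_f)
  have "point g X \<in> carrier G" using S by (simp add: point_def inv_into_into)
  then show "point g X \<in> chart_dom g"
    using assms X by (simp add: chart_dom_def L runit_one_plus_cayley)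
qed

lemma chart_point:
  assumes "g \<in> carrier G" "X \<in> chart_image" shows "chart g (point g X) = X"
proof -
  have "L (chart g (point g X)) = L X"
    using assms chart(2)[OF assms(1) point(1)[OF assms]] point(2)[OF assms]
    by (simp add: cayley_cayley chart_image_def cayley_dom_def)
  moreover have "chart g (point g X) \<in> carrier E" "X \<in> carrier E"
    using chart(1)[OF assms(1) point(1)[OF assms]] assms by (auto simp: chart_image_def)
  ultimately show ?thesis by (simp add: E.J_eq_iff)
qed

lemma point_chart:
  assumes "g \<in> carrier G" "h \<in> chart_dom g" shows "point g (chart g h) = h"
proof -
  have "K (point g (chart g h)) = K h"
    using assms point(2)[OF assms(1) chart(1)[OF assms]] chart(2)[OF assms]
    by (simp add: cayley_cayley chart_dom_def)
  moreover have "point g (chart g h) \<in> carrier G" "h \<in> carrier G"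
    using point(1)[OF assms(1) chart(1)[OF assms]] assms by (auto simp: chart_dom_def)
  ultimately show ?thesis using K_inj by (auto dest: inj_onD)
qed

lemma chart_inj: "g \<in> carrier G \<Longrightarrow> inj_on (chart g) (chart_dom g)"
  by (metis inj_onI point_chart)

lemma chart_image_eq: "g \<in> carrier G \<Longrightarrow> chart g ` chart_dom g = chart_image"
  using chart(1) chart_point point(1) by (force simp: image_iff)

lemma inv_into_chart:
  assumes "g \<in> carrier G" "X \<in> chart_image"
  shows "inv_into (chart_dom g) (chart g) X = point g X"
  using assms by (intro inv_into_f_eq chart_inj point chart_point)

lemma topspace_T: "topspace T = carrier G"
  by (simp add: topspace_pullback_topology)

lemma chart_dom_subset: "chart_dom g \<subseteq> carrier G"
  by (auto simp: chart_dom_def)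

lemma jet_smooth_translated_cayley:
  assumes "open U" "U \<subseteq> cayley_dom" shows "jet_smooth U (\<lambda>x. a * cayley (x :: 'r))"
  using assms
  by (intro jet_smooth_mult jet_smooth_cayley jet_smooth_bounded_linear[of _ "\<lambda>x. x"] jet_smooth_const)
    (auto simp: cayley_dom_def)

lemma is_chart:
  assumes g: "g \<in> carrier G" shows "is_chart T E (chart_dom g, chart g)"
proof -
  let ?Q = "{x. runit (1 + rinv (K g) * x)}"
  have lin: "jet_smooth UNIV (\<lambda>x. rinv (K g) * x)"
    by (intro jet_smooth_bounded_linear) (auto simp: bounded_linear_mult_right)
  have Q: "open ?Q" using open_runit_preimage[OF lin] by simp
  have dom: "chart_dom g = K -` ?Q \<inter> carrier G" by (auto simp: chart_dom_def)
  have o1: "openin T (chart_dom g)" using Q dom by (auto simp: openin_pullback_topology)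
  have o2: "openin (norm_topology E) chart_image"
    unfolding E.norm_topology_pullback openin_pullback_topology chart_image_def
    using open_cayley_dom by (auto intro!: exI[of _ cayley_dom])
  have "homeomorphic_maps (subtopology T (chart_dom g)) (subtopology (norm_topology E) chart_image)
      (chart g) (point g)"
    unfolding homeomorphic_maps_def
  proof (intro conjI ballI)
    have "jet_smooth ?Q (\<lambda>x. cayley (rinv (K g) * x))"
      by (rule jet_smooth_cayley[OF jet_smooth_subset[OF lin Q subset_UNIV]]) simp
    then have "continuous_on ?Q (\<lambda>x. cayley (rinv (K g) * x))" by (rule jet_smooth_continuous)
    then have c: "continuous_map (top_of_set ?Q) euclidean (\<lambda>x. cayley (rinv (K g) * x))" by simp
    have "continuous_map T euclidean (id \<circ> K)" by (intro continuous_map_pullback) simp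
    then have "continuous_map (subtopology T (chart_dom g)) (top_of_set ?Q) K"
      by (auto simp: continuous_map_in_subtopology dom intro: continuous_map_from_subtopology)
    from continuous_map_compose[OF this c]
    have "continuous_map (subtopology T (chart_dom g)) euclidean (L \<circ> chart g)"
      by (rule continuous_map_eq) (use chart(2)[OF g] in \<open>auto simp: topspace_T\<close>)
    then have "continuous_map (subtopology T (chart_dom g)) (norm_topology E) (chart g)"
      unfolding E.norm_topology_pullback
      by (rule continuous_map_pullback')
        (use chart(1)[OF g] in \<open>auto simp: topspace_T chart_image_def\<close>)
    then show "continuous_map (subtopology T (chart_dom g)) (subtopology (norm_topology E) chart_image) (chart g)"
      using chart(1)[OF g] by (auto simp: continuous_map_in_subtopology)
  next
    have "jet_smooth cayley_dom (\<lambda>x. K g * cayley x)"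
      by (intro jet_smooth_translated_cayley open_cayley_dom order_refl)
    then have "continuous_on cayley_dom (\<lambda>x. K g * cayley x)" by (rule jet_smooth_continuous)
    then have c: "continuous_map (top_of_set cayley_dom) euclidean (\<lambda>x. K g * cayley x)" by simp
    have "continuous_map (norm_topology E) euclidean (id \<circ> L)"
      unfolding E.norm_topology_pullback by (intro continuous_map_pullback) simp
    then have "continuous_map (subtopology (norm_topology E) chart_image) (top_of_set cayley_dom) L"
      by (auto simp: continuous_map_in_subtopology chart_image_def intro: continuous_map_from_subtopology)
    from continuous_map_compose[OF this c]
    have "continuous_map (subtopology (norm_topology E) chart_image) euclidean (K \<circ> point g)"
      by (rule continuous_map_eq) (use point(2)[OF g] in auto)
    then have "continuous_map (subtopology (norm_topology E) chart_image) T (point g)"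
      by (rule continuous_map_pullback')
        (use point(1)[OF g] chart_dom_subset in auto)
    then show "continuous_map (subtopology (norm_topology E) chart_image) (subtopology T (chart_dom g)) (point g)"
      using point(1)[OF g] by (auto simp: continuous_map_in_subtopology)
  qed (use point_chart[OF g] chart_point[OF g] in auto)
  then show ?thesis
    using o1 o2 homeomorphic_maps_imp_map by (auto simp: is_chart_def chart_image_eq[OF g])
qed

text \<open>
  Smoothness of a map into the group is checked on \<open>F\<close>, the map into the Banach algebra: composing with
  a chart only adds a translation and a Cayley transform.
\<close>

lemma smooth_on_to_chart:
  assumes V: "linear_coordinate V J c" and k: "k \<in> carrier G"
    and sm: "jet_smooth Q F" and U: "U = {x \<in> carrier V. J x \<in> Q \<and> runit (1 + rinv (K k) * F (J x))}"
    and f: "\<And>x. x \<in> U \<Longrightarrow> f x = chart k (p x) \<and> p x \<in> carrier G \<and> K (p x) = F (J x)"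
  shows "smooth_on V E U f"
proof -
  let ?F = "\<lambda>x. rinv (K k) * F x"
  have smF: "jet_smooth Q ?F" using sm by (intro jet_smooth_mult jet_smooth_const) (auto simp: jet_smooth_def)
  have O': "open {x \<in> Q. runit (1 + ?F x)}" by (rule open_runit_preimage[OF smF])
  have "jet_smooth {x \<in> Q. runit (1 + ?F x)} (\<lambda>x. cayley (?F x))"
    by (rule jet_smooth_cayley[OF jet_smooth_subset[OF smF O']]) auto
  then show ?thesis
  proof (rule smooth_on_of_jet_smooth[OF V E.nvs_embedding_axioms closed_E])
    show "U = {x \<in> carrier V. J x \<in> {x \<in> Q. runit (1 + ?F x)}}" using U by auto
    fix x assume x: "x \<in> U"
    have "p x \<in> chart_dom k" using f[OF x] x U by (auto simp: chart_dom_def)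
    from chart[OF k this] show "f x \<in> carrier E \<and> L (f x) = cayley (?F (J x))"
      using f[OF x] by (simp add: chart_image_def)
  qed
qed

definition atlas :: "('g set \<times> ('g \<Rightarrow> 'g)) set" where
  "atlas = (\<lambda>g. (chart_dom g, chart g)) ` carrier G"

lemma chart_image_subset:
  assumes "g \<in> carrier G"
  shows "chart g ` {x \<in> chart_dom g. P x} = {X \<in> chart_image. P (point g X)}"
proof (intro equalityI subsetI)
  fix X assume "X \<in> {X \<in> chart_image. P (point g X)}"
  then show "X \<in> chart g ` {x \<in> chart_dom g. P x}"
    using assms by (intro image_eqI[of _ _ "point g X"]) (auto simp: chart_point point)
qed (use assms in \<open>auto simp: chart point_chart\<close>)

text \<open>
  With \<open>f\<close> the identity this gives the transition maps, with \<open>f\<close> the inversion its smoothness.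
\<close>

lemma smooth_from_chart:
  assumes g: "g \<in> carrier G" and k: "k \<in> carrier G"
    and f: "\<And>x. x \<in> carrier G \<Longrightarrow> f x \<in> carrier G \<and> K (f x) = \<Phi> (K x)"
    and \<Phi>: "jet_smooth cayley_dom (\<lambda>x. \<Phi> (K g * cayley x))"
  shows "smooth_on E E (chart g ` {x \<in> chart_dom g. f x \<in> chart_dom k})
           (chart k \<circ> f \<circ> inv_into (chart_dom g) (chart g))"
proof (rule smooth_on_to_chart[OF linear_coordinate_embedding[OF E.nvs_embedding_axioms] k \<Phi>])
  have pt: "point g x \<in> carrier G" "K (point g x) = K g * cayley (L x)" if "x \<in> chart_image" for x
    using point[OF g that] by (auto simp: chart_dom_def)
  show "chart g ` {x \<in> chart_dom g. f x \<in> chart_dom k}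
      = {x \<in> carrier E. L x \<in> cayley_dom \<and> runit (1 + rinv (K k) * \<Phi> (K g * cayley (L x)))}"
    unfolding chart_image_subset[OF g]
    using pt f by (auto simp: chart_image_def chart_dom_def)
  fix x assume "x \<in> chart g ` {x \<in> chart_dom g. f x \<in> chart_dom k}"
  then have x: "x \<in> chart_image" unfolding chart_image_subset[OF g] by simp
  show "(chart k \<circ> f \<circ> inv_into (chart_dom g) (chart g)) x = chart k (f (point g x))
      \<and> f (point g x) \<in> carrier G \<and> K (f (point g x)) = \<Phi> (K g * cayley (L x))"
    using f[OF pt(1)[OF x]] pt(2)[OF x] inv_into_chart[OF g x] by simp
qed

lemma smooth_atlas: "smooth_atlas T E atlas"
  unfolding smooth_atlas_def
proof (intro conjI)
  show "\<forall>c\<in>atlas. is_chart T E c" using is_chart by (auto simp: atlas_def)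
  have "g \<in> chart_dom g" if "g \<in> carrier G" for g
  proof -
    have "runit ((2::real) *\<^sub>R (1::'r))" by (rule runit_scaleR) auto
    then show ?thesis using that by (simp add: chart_dom_def scaleR_2)
  qed
  then show "(\<Union>(U, \<phi>)\<in>atlas. U) = topspace T"
    using chart_dom_subset by (auto simp: atlas_def topspace_T)
  show "\<forall>(U, \<phi>)\<in>atlas. \<forall>(V, \<psi>)\<in>atlas. smooth_on E E (\<phi> ` (U \<inter> V)) (\<psi> \<circ> inv_into U \<phi>)"
  proof (clarsimp simp: atlas_def)
    fix g k assume g: "g \<in> carrier G" and k: "k \<in> carrier G"
    have "jet_smooth cayley_dom (\<lambda>x. K g * cayley x)"
      by (intro jet_smooth_translated_cayley open_cayley_dom order_refl)
    from smooth_from_chart[OF g k _ this, of "\<lambda>x. x"]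
    show "smooth_on E E (chart g ` (chart_dom g \<inter> chart_dom k)) (chart k \<circ> inv_into (chart_dom g) (chart g))"
      by (simp add: Int_def comp_def)
  qed
qed

lemma smooth_inverse: "smooth_map E atlas E atlas (\<lambda>g. inv g)"
  unfolding smooth_map_def
proof (clarsimp simp: atlas_def)
  fix g k assume g: "g \<in> carrier G" and k: "k \<in> carrier G"
  have "jet_smooth cayley_dom (\<lambda>x. rinv (K g * cayley x))"
    using g by (intro jet_smooth_rinv jet_smooth_translated_cayley open_cayley_dom order_refl runit_mult
        runit_K runit_cayley) (auto simp: cayley_dom_def)
  from smooth_from_chart[OF g k _ this, of "\<lambda>x. inv x"]
  show "smooth_on E E (chart g ` {x \<in> chart_dom g. inv x \<in> chart_dom k})
      (chart k \<circ> m_inv G \<circ> inv_into (chart_dom g) (chart g))"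
    by (simp add: K_inv)
qed

lemma smooth_multiplication:
  "smooth_map (prod_nvs E E) (prod_atlas atlas atlas) E atlas (\<lambda>(g, h). g \<otimes> h)"
  unfolding smooth_map_def
proof (clarsimp simp: atlas_def prod_atlas_def)
  fix g h k assume g: "g \<in> carrier G" and h: "h \<in> carrier G" and k: "k \<in> carrier G"
  let ?D = "chart_dom g \<times> chart_dom h" and ?\<phi> = "map_prod (chart g) (chart h)"
  show "smooth_on (prod_nvs E E) E
     (?\<phi> ` {x \<in> ?D. (case x of (g, h) \<Rightarrow> g \<otimes> h) \<in> chart_dom k})
     (chart k \<circ> (\<lambda>(g, h). g \<otimes> h) \<circ> inv_into ?D ?\<phi>)" (is "smooth_on _ _ ?U ?f")
  proof (rule smooth_on_to_chart[OF linear_coordinate_prod[OF E.nvs_embedding_axioms] k])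
    let ?F = "\<lambda>p. (K g * cayley (fst p)) * (K h * cayley (snd p))"
    have op: "open (cayley_dom \<times> cayley_dom :: ('r \<times> 'r) set)" by (intro open_Times open_cayley_dom)
    show "jet_smooth (cayley_dom \<times> cayley_dom) ?F"
      using op by (intro jet_smooth_mult jet_smooth_const jet_smooth_cayley
          jet_smooth_bounded_linear bounded_linear_fst bounded_linear_snd)
        (auto simp: cayley_dom_def)
    have pt: "point g X \<in> carrier G" "K (point g X) = K g * cayley (L X)"
      "point h X \<in> carrier G" "K (point h X) = K h * cayley (L X)"
      if "X \<in> chart_image" for X
      using point[OF g that] point[OF h that] by (auto simp: chart_dom_def)
    have U: "?U = {(X, Y). X \<in> chart_image \<and> Y \<in> chart_image \<and> point g X \<otimes> point h Y \<in> chart_dom k}"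
    proof (intro equalityI subsetI)
      fix p assume "p \<in> {(X, Y). X \<in> chart_image \<and> Y \<in> chart_image \<and> point g X \<otimes> point h Y \<in> chart_dom k}"
      then show "p \<in> ?U"
        using g h by (intro image_eqI[of _ _ "(point g (fst p), point h (snd p))"])
          (auto simp: chart_point point)
    qed (use g h in \<open>auto simp: chart point_chart\<close>)
    show "?U = {p \<in> carrier (prod_nvs E E). map_prod L L p \<in> cayley_dom \<times> cayley_dom
        \<and> runit (1 + rinv (K k) * ?F (map_prod L L p))}"
      unfolding U using pt by (auto simp: chart_image_def chart_dom_def prod_nvs_def K_mult)
    fix p assume "p \<in> ?U"
    then obtain X Y where p: "p = (X, Y)" "X \<in> chart_image" "Y \<in> chart_image" unfolding U by auto
    have inj: "inj_on ?\<phi> ?D" using chart_inj g h by (intro map_prod_inj_on)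
    have "inv_into ?D ?\<phi> p = (point g X, point h Y)"
      using p g h by (intro inv_into_f_eq inj) (auto simp: point chart_point)
    then show "?f p = chart k (point g (fst p) \<otimes> point h (snd p))
        \<and> point g (fst p) \<otimes> point h (snd p) \<in> carrier G
        \<and> K (point g (fst p) \<otimes> point h (snd p)) = ?F (map_prod L L p)"
      using p pt by (simp add: K_mult)
  qed
qed

theorem real_banach_lie_group: "real_banach_lie_group G T"
proof -
  have "continuous_map T euclidean (id \<circ> K)" by (intro continuous_map_pullback) simp
  then have "Hausdorff_space T"
    using K_inj by (intro Hausdorff_space_injective_preimage[of euclidean T K]) (auto simp: topspace_T)
  moreover have "banach_space E"
    by (intro E.banach_space closed_E) (rule complete_UNIV)
  ultimately show ?thesis
    unfolding real_banach_lie_group_def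
    using is_group topspace_T smooth_atlas smooth_multiplication smooth_inverse by blast
qed

end

section \<open>The Hilbert space of square integrable functions\<close>

definition square_integrable :: "('a::euclidean_space \<Rightarrow> 'b::euclidean_space) \<Rightarrow> bool" where
  "square_integrable f \<longleftrightarrow> f \<in> borel_measurable lebesgue \<and> integrable lebesgue (\<lambda>x. (norm (f x))\<^sup>2)"

definition l2_rel :: "('a::euclidean_space \<Rightarrow> 'b::euclidean_space) \<Rightarrow> ('a \<Rightarrow> 'b) \<Rightarrow> bool" where
  "l2_rel f g \<longleftrightarrow> square_integrable f \<and> square_integrable g \<and> (AE x in lebesgue. f x = g x)"

lemma square_integrable_measurable [measurable_dest]:
  "square_integrable f \<Longrightarrow> f \<in> borel_measurable lebesgue"
  by (simp add: square_integrable_def)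

lemma square_integrable_add:
  assumes "square_integrable f" "square_integrable g" shows "square_integrable (\<lambda>x. f x + g x)"
proof -
  note [measurable] = square_integrable_measurable[OF assms(1)] square_integrable_measurable[OF assms(2)]
  have "integrable lebesgue (\<lambda>x. 2 * (norm (f x))\<^sup>2 + 2 * (norm (g x))\<^sup>2)"
    using assms by (auto simp: square_integrable_def)
  then have "integrable lebesgue (\<lambda>x. (norm (f x + g x))\<^sup>2)"
  proof (rule Bochner_Integration.integrable_bound)
    have "(norm (f x + g x))\<^sup>2 \<le> 2 * (norm (f x))\<^sup>2 + 2 * (norm (g x))\<^sup>2" for x
    proof -
      have "(norm (f x + g x))\<^sup>2 \<le> (norm (f x) + norm (g x))\<^sup>2"
        by (intro power_mono norm_triangle_ineq) auto
      also have "\<dots> \<le> 2 * (norm (f x))\<^sup>2 + 2 * (norm (g x))\<^sup>2"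
        using sum_squares_bound[of "norm (f x)" "norm (g x)"] by (simp add: power2_sum)
      finally show ?thesis .
    qed
    then show "AE x in lebesgue. norm ((norm (f x + g x))\<^sup>2) \<le> norm (2 * (norm (f x))\<^sup>2 + 2 * (norm (g x))\<^sup>2)"
      by auto
  qed simp
  then show ?thesis by (simp add: square_integrable_def)
qed

lemma square_integrable_scaleR:
  "square_integrable f \<Longrightarrow> square_integrable (\<lambda>x. c *\<^sub>R f x)"
  unfolding square_integrable_def by (auto simp: power_mult_distrib)

lemma square_integrable_uminus:
  "square_integrable f \<Longrightarrow> square_integrable (\<lambda>x. - f x)"
  unfolding square_integrable_def by auto

lemma square_integrable_diff:
  assumes "square_integrable f" "square_integrable g" shows "square_integrable (\<lambda>x. f x - g x)"
  using square_integrable_add[OF assms(1) square_integrable_uminus[OF assms(2)]] by simp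

lemma square_integrable_zero: "square_integrable (\<lambda>x. 0)"
  by (simp add: square_integrable_def)

lemma integrable_inner:
  assumes "square_integrable f" "square_integrable g"
  shows "integrable lebesgue (\<lambda>x. f x \<bullet> g x)"
proof -
  note [measurable] = square_integrable_measurable[OF assms(1)] square_integrable_measurable[OF assms(2)]
  have "integrable lebesgue (\<lambda>x. (norm (f x))\<^sup>2 + (norm (g x))\<^sup>2)"
    using assms by (auto simp: square_integrable_def)
  then show ?thesis
  proof (rule Bochner_Integration.integrable_bound)
    have "\<bar>f x \<bullet> g x\<bar> \<le> (norm (f x))\<^sup>2 + (norm (g x))\<^sup>2" for x
    proof -
      have "\<bar>f x \<bullet> g x\<bar> \<le> norm (f x) * norm (g x)" by (rule Cauchy_Schwarz_ineq2)
      also have "\<dots> \<le> (norm (f x))\<^sup>2 + (norm (g x))\<^sup>2"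
        using sum_squares_bound[of "norm (f x)" "norm (g x)"]
          mult_nonneg_nonneg[OF norm_ge_zero norm_ge_zero, of "f x" "g x"]
        unfolding mult.assoc by linarith
      finally show ?thesis .
    qed
    then show "AE x in lebesgue. norm (f x \<bullet> g x) \<le> norm ((norm (f x))\<^sup>2 + (norm (g x))\<^sup>2)" by auto
  qed simp
qed

quotient_type (overloaded) ('a, 'b) l2 = "'a::euclidean_space \<Rightarrow> 'b::euclidean_space" / partial: l2_rel
proof (rule part_equivpI)
  show "\<exists>x::'a \<Rightarrow> 'b. l2_rel x x"
    by (rule exI[of _ "\<lambda>x. 0"]) (simp add: l2_rel_def square_integrable_zero)
  show "symp (l2_rel :: ('a \<Rightarrow> 'b) \<Rightarrow> _)" by (auto simp: symp_def l2_rel_def)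
  show "transp (l2_rel :: ('a \<Rightarrow> 'b) \<Rightarrow> _)" by (auto simp: transp_def l2_rel_def)
qed

lemma l2_rel_refl [simp]: "l2_rel f f \<longleftrightarrow> square_integrable f" by (simp add: l2_rel_def)

lemma rep_l2: "square_integrable (rep_l2 F)"
  using Quotient_l2 Quotient_rep_reflp by fastforce

lemma abs_rep_l2: "abs_l2 (rep_l2 F) = F"
  by (rule Quotient_abs_rep[OF Quotient_l2])

lemma abs_l2_eq_iff:
  "square_integrable f \<Longrightarrow> square_integrable g \<Longrightarrow> abs_l2 f = abs_l2 g \<longleftrightarrow> (AE x in lebesgue. f x = g x)"
  using Quotient_rel[OF Quotient_l2, of f g] by (auto simp: l2_rel_def)

instantiation l2 :: (euclidean_space, euclidean_space) real_vector
begin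

lift_definition zero_l2 :: "('a, 'b) l2" is "\<lambda>x. 0" by (simp add: square_integrable_zero)

lift_definition plus_l2 :: "('a, 'b) l2 \<Rightarrow> ('a, 'b) l2 \<Rightarrow> ('a, 'b) l2" is "\<lambda>f g x. f x + g x"
  by (auto simp: l2_rel_def square_integrable_add)

lift_definition minus_l2 :: "('a, 'b) l2 \<Rightarrow> ('a, 'b) l2 \<Rightarrow> ('a, 'b) l2" is "\<lambda>f g x. f x - g x"
  by (auto simp: l2_rel_def square_integrable_diff)

lift_definition uminus_l2 :: "('a, 'b) l2 \<Rightarrow> ('a, 'b) l2" is "\<lambda>f x. - f x"
  by (auto simp: l2_rel_def square_integrable_uminus)

lift_definition scaleR_l2 :: "real \<Rightarrow> ('a, 'b) l2 \<Rightarrow> ('a, 'b) l2" is "\<lambda>c f x. c *\<^sub>R f x"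
  by (auto simp: l2_rel_def square_integrable_scaleR)

instance
proof
  fix F G H :: "('a, 'b) l2" and a b :: real
  note sq = square_integrable_add square_integrable_diff square_integrable_uminus
    square_integrable_scaleR square_integrable_zero
  show "F + G + H = F + (G + H)" by transfer (auto simp: l2_rel_def sq add.assoc)
  show "F + G = G + F" by transfer (auto simp: l2_rel_def sq add.commute)
  show "0 + F = F" by transfer (auto simp: l2_rel_def)
  show "- F + F = 0" by transfer (auto simp: l2_rel_def sq)
  show "F - G = F + - G" by transfer (auto simp: l2_rel_def sq)
  show "a *\<^sub>R (F + G) = a *\<^sub>R F + a *\<^sub>R G" by transfer (auto simp: l2_rel_def sq scaleR_add_right)
  show "(a + b) *\<^sub>R F = a *\<^sub>R F + b *\<^sub>R F" by transfer (auto simp: l2_rel_def sq scaleR_add_left)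
  show "a *\<^sub>R b *\<^sub>R F = (a * b) *\<^sub>R F" by transfer (auto simp: l2_rel_def sq)
  show "1 *\<^sub>R F = F" by transfer (auto simp: l2_rel_def)
qed

end

instantiation l2 :: (euclidean_space, euclidean_space) real_inner
begin

lift_definition inner_l2 :: "('a, 'b) l2 \<Rightarrow> ('a, 'b) l2 \<Rightarrow> real" is "\<lambda>f g. LINT x|lebesgue. f x \<bullet> g x"
proof -
  fix f f' g g' :: "'a \<Rightarrow> 'b" assume a: "l2_rel f f'" "l2_rel g g'"
  then have [measurable]: "f \<in> borel_measurable lebesgue" "f' \<in> borel_measurable lebesgue"
    "g \<in> borel_measurable lebesgue" "g' \<in> borel_measurable lebesgue"
    by (auto simp: l2_rel_def square_integrable_def)
  show "(LINT x|lebesgue. f x \<bullet> g x) = (LINT x|lebesgue. f' x \<bullet> g' x)"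
    using a by (intro integral_cong_AE) (auto simp: l2_rel_def)
qed

definition norm_l2 :: "('a, 'b) l2 \<Rightarrow> real" where "norm_l2 F = sqrt (inner F F)"
definition sgn_l2 :: "('a, 'b) l2 \<Rightarrow> ('a, 'b) l2" where "sgn_l2 F = F /\<^sub>R norm F"
definition dist_l2 :: "('a, 'b) l2 \<Rightarrow> ('a, 'b) l2 \<Rightarrow> real" where "dist_l2 F G = norm (F - G)"
definition uniformity_l2 :: "(('a, 'b) l2 \<times> ('a, 'b) l2) filter" where
  "uniformity_l2 = (INF e\<in>{0<..}. principal {(x, y). dist x y < e})"
definition open_l2 :: "('a, 'b) l2 set \<Rightarrow> bool" where
  "open_l2 U \<longleftrightarrow> (\<forall>x\<in>U. \<forall>\<^sub>F (x', y) in uniformity. x' = x \<longrightarrow> y \<in> U)"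

instance
proof
  fix F G H :: "('a, 'b) l2" and a b :: real and U :: "('a, 'b) l2 set"
  show "dist F G = norm (F - G)" by (simp add: dist_l2_def)
  show "sgn F = F /\<^sub>R norm F" by (simp add: sgn_l2_def)
  show "uniformity = (INF e\<in>{0<..}. principal {(x :: ('a, 'b) l2, y). dist x y < e})"
    by (simp add: uniformity_l2_def)
  show "open U = (\<forall>x\<in>U. \<forall>\<^sub>F (x', y) in uniformity. x' = x \<longrightarrow> y \<in> U)"
    by (simp add: open_l2_def)
  show "F \<bullet> G = G \<bullet> F" by transfer (simp add: inner_commute)
  show "(F + G) \<bullet> H = F \<bullet> H + G \<bullet> H"
    by transfer (simp add: inner_add_left integrable_inner)
  show "(a *\<^sub>R F) \<bullet> G = a * (F \<bullet> G)" by transfer simp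
  show "0 \<le> F \<bullet> F" by transfer (auto intro: Bochner_Integration.integral_nonneg)
  show "(F \<bullet> F = 0) = (F = 0)"
  proof transfer
    fix f :: "'a \<Rightarrow> 'b" assume "l2_rel f f"
    then show "((LINT x|lebesgue. f x \<bullet> f x) = 0) = l2_rel f (\<lambda>x. 0)"
      by (subst integral_nonneg_eq_0_iff_AE) (auto simp: integrable_inner l2_rel_def square_integrable_zero)
  qed
  show "norm F = sqrt (F \<bullet> F)" by (simp add: norm_l2_def)
qed

end

lemma norm_abs_l2: "square_integrable f \<Longrightarrow> (norm (abs_l2 f))\<^sup>2 = (LINT x|lebesgue. (norm (f x))\<^sup>2)"
  by (simp add: power2_norm_eq_inner inner_l2.abs_eq)

lemma nn_integral_l2:
  assumes "square_integrable f"
  shows "(\<integral>\<^sup>+x. ennreal ((norm (f x))\<^sup>2) \<partial>lebesgue) = ennreal ((norm (abs_l2 f))\<^sup>2)"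
  using assms by (simp add: norm_abs_l2 nn_integral_eq_integral square_integrable_def)

lemma square_integrable_nn:
  assumes "f \<in> borel_measurable lebesgue" "(\<integral>\<^sup>+x. ennreal ((norm (f x))\<^sup>2) \<partial>lebesgue) < \<infinity>"
  shows "square_integrable f"
  using assms unfolding square_integrable_def by (auto intro!: integrableI_bounded)

text \<open>
  The theorem of Riesz and Fischer. Along a subsequence with \<open>\<parallel>u\<^sub>k\<^sub>+\<^sub>1 - u\<^sub>k\<parallel> \<le> 4\<^sup>-\<^sup>k\<close>, the sum of the
  \<open>4\<^sup>k |u\<^sub>k\<^sub>+\<^sub>1 - u\<^sub>k|\<^sup>2\<close> has a finite integral and hence is finite almost everywhere, so that the differences
  are dominated by a multiple of \<open>2\<^sup>-\<^sup>k\<close> and \<open>u\<^sub>k\<close> converges pointwise. Fatou's lemma shows that the pointwise limit is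
  the limit in norm.
\<close>

instance l2 :: (euclidean_space, euclidean_space) complete_space
proof
  fix X :: "nat \<Rightarrow> ('a, 'b) l2" assume X: "Cauchy X"
  have "\<forall>k. \<exists>N. \<forall>m\<ge>N. \<forall>n\<ge>N. dist (X m) (X n) < (1/4) ^ k"
    using X unfolding Cauchy_def by (simp)
  then obtain N where N: "\<And>k m n. m \<ge> N k \<Longrightarrow> n \<ge> N k \<Longrightarrow> dist (X m) (X n) < (1/4) ^ k" by metis
  (* Partial sums give indices that do not decrease with k and are at least N k. *)
  define r where "r k = (\<Sum>i\<le>k. N i)" for k
  have r_ge: "r m \<ge> N k" if "m \<ge> k" for m k
    unfolding r_def using member_le_sum[of k "{..m}" N] that by simp
  define u where "u k = rep_l2 (X (r k))" for k
  have u: "square_integrable (u k)" "abs_l2 (u k) = X (r k)" for k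
    by (simp_all add: u_def rep_l2 abs_rep_l2)
  note [measurable] = square_integrable_measurable[OF u(1)]
  have u_diff: "(\<integral>\<^sup>+x. ennreal ((norm (u m x - u k x))\<^sup>2) \<partial>lebesgue) \<le> ennreal ((1/16) ^ k)"
    if "m \<ge> k" for m k
  proof -
    have "abs_l2 (\<lambda>x. u m x - u k x) = X (r m) - X (r k)"
      using u by (metis l2_rel_refl minus_l2.abs_eq)
    then have "(\<integral>\<^sup>+x. ennreal ((norm (u m x - u k x))\<^sup>2) \<partial>lebesgue) = ennreal ((dist (X (r m)) (X (r k)))\<^sup>2)"
      by (simp add: nn_integral_l2 u square_integrable_diff dist_norm)
    also have "\<dots> \<le> ennreal (((1/4) ^ k)\<^sup>2)"
      using N[of k "r m" "r k"] r_ge that by (intro ennreal_leI power_mono) auto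
    also have "((1/4::real) ^ k)\<^sup>2 = (1/16) ^ k"
      by (simp add: power2_eq_square flip: power_mult_distrib)
    finally show ?thesis .
  qed
  define d where "d k x = (norm (u (Suc k) x - u k x))\<^sup>2" for k x
  have [measurable]: "d k \<in> borel_measurable lebesgue" for k unfolding d_def by measurable
  have "(\<integral>\<^sup>+x. (\<Sum>k. ennreal (4 ^ k * d k x)) \<partial>lebesgue) = (\<Sum>k. \<integral>\<^sup>+x. ennreal (4 ^ k * d k x) \<partial>lebesgue)"
    by (intro nn_integral_suminf) measurable
  also have "\<dots> \<le> (\<Sum>k. ennreal ((1/4) ^ k))"
  proof (intro suminf_le allI)
    fix k
    have "(\<integral>\<^sup>+x. ennreal (4 ^ k * d k x) \<partial>lebesgue) = ennreal (4 ^ k) * (\<integral>\<^sup>+x. ennreal (d k x) \<partial>lebesgue)"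
      by (subst nn_integral_cmult[symmetric]) (auto simp: ennreal_mult d_def)
    also have "\<dots> \<le> ennreal (4 ^ k) * ennreal ((1/16) ^ k)"
      unfolding d_def by (intro mult_left_mono u_diff) auto
    also have "\<dots> = ennreal ((1/4) ^ k)"
      by (simp flip: ennreal_mult power_mult_distrib)
    finally show "(\<integral>\<^sup>+x. ennreal (4 ^ k * d k x) \<partial>lebesgue) \<le> ennreal ((1/4) ^ k)" .
  qed auto
  also have "\<dots> = ennreal (\<Sum>k. (1/4) ^ k)"
    by (intro suminf_ennreal2) (auto intro: summable_geometric)
  finally have fin: "(\<integral>\<^sup>+x. (\<Sum>k. ennreal (4 ^ k * d k x)) \<partial>lebesgue) \<noteq> \<infinity>"
    by (auto simp: top_unique)
  have "AE x in lebesgue. (\<Sum>k. ennreal (4 ^ k * d k x)) \<noteq> \<infinity>"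
    by (rule nn_integral_noteq_infinite[OF _ fin]) measurable
  then have conv: "AE x in lebesgue. convergent (\<lambda>k. u k x)"
  proof (rule AE_mp, intro AE_I2 impI)
    fix x assume fx: "(\<Sum>k. ennreal (4 ^ k * d k x)) \<noteq> \<infinity>"
    have d0: "d k x \<ge> 0" for k by (simp add: d_def)
    have "summable (\<lambda>k. 4 ^ k * d k x)"
      using fx d0 by (intro summable_suminf_not_top) auto
    then have "Bseq (\<lambda>k. 4 ^ k * d k x)"
      by (intro convergent_imp_Bseq convergentI[OF summable_LIMSEQ_zero])
    then obtain C where C: "C > 0" "\<And>k. norm (4 ^ k * d k x) \<le> C" unfolding Bseq_def by blast
    have bound: "norm (u (Suc k) x - u k x) \<le> sqrt C * (1/2) ^ k" for k
    proof (rule power2_le_imp_le)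
      have "4 ^ k * (norm (u (Suc k) x - u k x))\<^sup>2 \<le> C" using C(2)[of k] d0[of k] by (simp add: d_def)
      then have "(norm (u (Suc k) x - u k x))\<^sup>2 \<le> C / 4 ^ k" by (simp add: field_simps)
      also have "C / 4 ^ k = (sqrt C * (1/2) ^ k)\<^sup>2"
        using C(1) by (simp add: power_mult_distrib power_divide power2_eq_square flip: power_mult_distrib)
      finally show "(norm (u (Suc k) x - u k x))\<^sup>2 \<le> (sqrt C * (1/2) ^ k)\<^sup>2" .
    qed (use C in auto)
    have "summable (\<lambda>k. sqrt C * (1/2) ^ k)" by (intro summable_mult summable_geometric) auto
    then have "summable (\<lambda>k. u (Suc k) x - u k x)"
      by (rule summable_comparison_test'[of _ 0]) (rule bound)
    then have "convergent (\<lambda>n. u 0 x + (\<Sum>k<n. u (Suc k) x - u k x))"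
      by (intro convergent_add convergent_const) (simp add: summable_iff_convergent)
    then show "convergent (\<lambda>k. u k x)" using sum_lessThan_telescope[of "\<lambda>k. u k x"] by simp
  qed
  define g where "g x = lim (\<lambda>k. u k x)" for x
  have g_meas [measurable]: "g \<in> borel_measurable lebesgue"
    unfolding g_def by (rule borel_measurable_lim_metric) measurable
  have g_diff: "(\<integral>\<^sup>+x. ennreal ((norm (g x - u k x))\<^sup>2) \<partial>lebesgue) \<le> ennreal ((1/16) ^ k)" for k
  proof -
    have "AE x in lebesgue. ennreal ((norm (g x - u k x))\<^sup>2) = liminf (\<lambda>m. ennreal ((norm (u m x - u k x))\<^sup>2))"
      using conv
    proof eventually_elim
      case (elim x)
      then have "(\<lambda>m. u m x) \<longlonglongrightarrow> g x" by (simp add: g_def convergent_LIMSEQ_iff)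
      then have "(\<lambda>m. ennreal ((norm (u m x - u k x))\<^sup>2)) \<longlonglongrightarrow> ennreal ((norm (g x - u k x))\<^sup>2)"
        by (intro tendsto_intros)
      then show ?case by (rule lim_imp_Liminf[OF sequentially_bot, symmetric])
    qed
    then have "(\<integral>\<^sup>+x. ennreal ((norm (g x - u k x))\<^sup>2) \<partial>lebesgue)
        = (\<integral>\<^sup>+x. liminf (\<lambda>m. ennreal ((norm (u m x - u k x))\<^sup>2)) \<partial>lebesgue)"
      by (rule nn_integral_cong_AE)
    also have "\<dots> \<le> liminf (\<lambda>m. \<integral>\<^sup>+x. ennreal ((norm (u m x - u k x))\<^sup>2) \<partial>lebesgue)"
      by (rule nn_integral_liminf) measurable
    also have "\<dots> \<le> ennreal ((1/16) ^ k)"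
      by (intro Liminf_le eventually_sequentiallyI[of k] u_diff) auto
    finally show ?thesis .
  qed
  have diff: "square_integrable (\<lambda>x. g x - u k x)" for k
    by (rule square_integrable_nn) (use g_diff[of k] in \<open>auto simp: order.strict_trans1\<close>)
  have g: "square_integrable g" using square_integrable_add[OF diff[of 0] u(1)[of 0]] by simp
  have close: "dist (abs_l2 g) (X (r k)) \<le> (1/4) ^ k" for k
  proof -
    have "abs_l2 (\<lambda>x. g x - u k x) = abs_l2 g - X (r k)"
      using u g by (metis l2_rel_refl minus_l2.abs_eq)
    then have "ennreal ((dist (abs_l2 g) (X (r k)))\<^sup>2) \<le> ennreal ((1/16) ^ k)"
      using g_diff[of k] nn_integral_l2[OF diff[of k]] by (simp add: dist_norm)
    then have "(dist (abs_l2 g) (X (r k)))\<^sup>2 \<le> (1/16) ^ k" by (simp add: ennreal_le_iff)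
    also have "(1/16::real) ^ k = ((1/4) ^ k)\<^sup>2"
      by (simp add: power2_eq_square flip: power_mult_distrib)
    finally show ?thesis by (rule power2_le_imp_le) simp
  qed
  have "X \<longlonglongrightarrow> abs_l2 g"
  proof (rule metric_LIMSEQ_I)
    fix e :: real assume "e > 0"
    obtain k where k: "(1/4::real) ^ k < e / 2"
      using real_arch_pow_inv[of "e / 2" "1/4"] \<open>e > 0\<close> by auto
    have "dist (X n) (abs_l2 g) < e" if "n \<ge> N k" for n
    proof -
      have "dist (X n) (abs_l2 g) \<le> dist (X n) (X (r k)) + dist (X (r k)) (abs_l2 g)" by (rule dist_triangle)
      also have "dist (X n) (X (r k)) < (1/4) ^ k" using that r_ge by (intro N) auto
      also have "dist (X (r k)) (abs_l2 g) \<le> (1/4) ^ k" using close by (simp add: dist_commute)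
      finally show ?thesis using k by simp
    qed
    then show "\<exists>no. \<forall>n\<ge>no. dist (X n) (abs_l2 g) < e" by blast
  qed
  then show "convergent X" by (rule convergentI)
qed

instance l2 :: (euclidean_space, euclidean_space) banach ..

section \<open>Orthogonal projection\<close>

text \<open>
  A sequence in \<open>S\<close> that minimises the distance to \<open>x\<close> is a Cauchy sequence by the parallelogram law;
  its limit minimises the distance, and minimality in the direction \<open>t\<close> gives orthogonality to \<open>t\<close>.
\<close>

lemma orthogonal_projection_exists:
  fixes S :: "'x::{real_inner, complete_space} set"
  assumes S: "subspace S" and cl: "closed S"
  shows "\<exists>p\<in>S. \<forall>s\<in>S. (x - p) \<bullet> s = 0"
proof -
  let ?f = "\<lambda>s. (norm (x - s))\<^sup>2"
  define d where "d = (INF s\<in>S. ?f s)"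
  have ne: "S \<noteq> {}" using S subspace_0 by blast
  have bdd: "bdd_below (?f ` S)" by (auto intro: bdd_belowI[of _ 0])
  have d_le: "d \<le> ?f s" if "s \<in> S" for s unfolding d_def by (rule cINF_lower[OF bdd that])
  have "\<exists>s\<in>S. ?f s < d + 1 / real (Suc n)" for n
    using cINF_less_iff[OF ne bdd, of "d + 1 / real (Suc n)"] by (simp add: d_def)
  then obtain s where s: "\<And>n. s n \<in> S" "\<And>n. ?f (s n) < d + 1 / real (Suc n)" by metis
  have par: "(norm (s m - s n))\<^sup>2 \<le> 2 * (1 / real (Suc m) + 1 / real (Suc n))" for m n
  proof -
    have "(1/2) *\<^sub>R (s m + s n) \<in> S" using S s by (intro subspace_scale subspace_add) auto
    from d_le[OF this] have "4 * d \<le> (norm (2 *\<^sub>R (x - (1/2) *\<^sub>R (s m + s n))))\<^sup>2"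
      by (simp add: power_mult_distrib)
    also have "2 *\<^sub>R (x - (1/2) *\<^sub>R (s m + s n)) = (x - s m) + (x - s n)"
      by (simp add: algebra_simps scaleR_2)
    finally have "4 * d \<le> (norm ((x - s m) + (x - s n)))\<^sup>2" .
    moreover have "(norm ((x - s m) + (x - s n)))\<^sup>2 + (norm ((x - s n) - (x - s m)))\<^sup>2
        = 2 * ?f (s m) + 2 * ?f (s n)"
      by (simp add: power2_norm_eq_inner algebra_simps inner_commute)
    moreover have "(x - s n) - (x - s m) = s m - s n" by simp
    ultimately show ?thesis using s(2)[of m] s(2)[of n] by (simp add: algebra_simps)
  qed
  have "Cauchy s"
  proof (rule CauchyI)
    fix e :: real assume e: "e > 0"
    obtain N where N: "1 / real (Suc N) < e\<^sup>2 / 4"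
      using nat_approx_posE[of "e\<^sup>2 / 4"] e by (metis divide_pos_pos zero_less_numeral zero_less_power)
    have "norm (s m - s n) < e" if "m \<ge> N" "n \<ge> N" for m n
    proof (rule power2_less_imp_less)
      have "1 / real (Suc m) \<le> 1 / real (Suc N)" "1 / real (Suc n) \<le> 1 / real (Suc N)"
        using that by (auto intro!: divide_left_mono)
      then show "(norm (s m - s n))\<^sup>2 < e\<^sup>2" using par[of m n] N by argo
    qed (use e in auto)
    then show "\<exists>M. \<forall>m\<ge>M. \<forall>n\<ge>M. norm (s m - s n) < e" by blast
  qed
  then obtain p where p: "s \<longlonglongrightarrow> p" using convergent_eq_Cauchy by blast
  have pS: "p \<in> S" using closed_sequentially[OF cl _ p] s by blast
  have fp: "?f p \<le> d"
  proof (rule LIMSEQ_le)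
    show "(\<lambda>n. ?f (s n)) \<longlonglongrightarrow> ?f p" by (intro tendsto_intros p)
    have "(\<lambda>n. d + 1 / real (Suc n)) \<longlonglongrightarrow> d + 0"
      by (intro tendsto_add tendsto_const LIMSEQ_Suc[OF lim_1_over_n])
    then show "(\<lambda>n. d + 1 / real (Suc n)) \<longlonglongrightarrow> d" by simp
    show "\<exists>N. \<forall>n\<ge>N. ?f (s n) \<le> d + 1 / real (Suc n)" using s(2) less_imp_le by blast
  qed
  have "(x - p) \<bullet> t = 0" if t: "t \<in> S" for t
  proof (cases "t = 0")
    case False
    (* The minimiser of the quadratic function a \<mapsto> (norm (x - p - a t))^2. *)
    define a where "a = ((x - p) \<bullet> t) / (t \<bullet> t)"
    have tt: "t \<bullet> t > 0" using False by simp
    have "p + a *\<^sub>R t \<in> S" using S pS t by (intro subspace_add subspace_scale)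
    then have "?f p \<le> ?f (p + a *\<^sub>R t)" by (rule order_trans[OF fp d_le])
    also have "?f (p + a *\<^sub>R t) = ?f p - 2 * a * ((x - p) \<bullet> t) + a\<^sup>2 * (t \<bullet> t)"
      by (simp add: power2_norm_eq_inner power2_eq_square[of a] algebra_simps inner_commute)
    finally have "2 * a * ((x - p) \<bullet> t) \<le> a\<^sup>2 * (t \<bullet> t)" by simp
    then have "((x - p) \<bullet> t)\<^sup>2 / (t \<bullet> t) \<le> 0"
      using tt by (simp add: a_def power2_eq_square field_simps)
    then have "((x - p) \<bullet> t)\<^sup>2 \<le> 0" using tt by (simp add: divide_le_0_iff)
    then show ?thesis by simp
  qed simp
  then show ?thesis using pS by blast
qed

definition proj :: "'x::real_inner set \<Rightarrow> 'x \<Rightarrow> 'x" where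
  "proj S x = (SOME p. p \<in> S \<and> (\<forall>s\<in>S. (x - p) \<bullet> s = 0))"

locale closed_subspace =
  fixes S :: "'x::{real_inner, complete_space} set"
  assumes subspace: "subspace S" and closed: "closed S"
begin

lemma proj: "proj S x \<in> S" "s \<in> S \<Longrightarrow> (x - proj S x) \<bullet> s = 0"
  using someI_ex[of "\<lambda>p. p \<in> S \<and> (\<forall>s\<in>S. (x - p) \<bullet> s = 0)"]
    orthogonal_projection_exists[OF subspace closed, of x]
  unfolding proj_def by blast+

lemma proj_unique:
  assumes "p \<in> S" "\<And>s. s \<in> S \<Longrightarrow> (x - p) \<bullet> s = 0" shows "proj S x = p"
proof -
  have d: "p - proj S x \<in> S" using assms proj subspace by (intro subspace_diff) auto
  have "(p - proj S x) \<bullet> (p - proj S x) = (x - proj S x) \<bullet> (p - proj S x) - (x - p) \<bullet> (p - proj S x)"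
    by (simp add: algebra_simps)
  also have "\<dots> = 0" using d assms(2) proj(2) by simp
  finally show ?thesis by simp
qed

lemma proj_id: "s \<in> S \<Longrightarrow> proj S s = s" by (rule proj_unique) auto

lemma proj_compl: "proj S (x - proj S x) = 0"
  using subspace_0[OF subspace] by (intro proj_unique) (auto simp: proj)

lemma norm_proj_le: "norm (proj S x) \<le> norm x"
proof (rule power2_le_imp_le)
  have "(x - proj S x) \<bullet> proj S x = 0" by (intro proj)
  then have "(norm x)\<^sup>2 = (norm (x - proj S x))\<^sup>2 + (norm (proj S x))\<^sup>2"
    by (simp add: power2_norm_eq_inner algebra_simps inner_commute)
  then show "(norm (proj S x))\<^sup>2 \<le> (norm x)\<^sup>2" by simp
qed simp

lemma bounded_linear_proj: "bounded_linear (proj S)"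
proof (rule bounded_linear_intro[of _ 1])
  show "proj S (x + y) = proj S x + proj S y" for x y
  proof (rule proj_unique)
    show "((x + y) - (proj S x + proj S y)) \<bullet> s = 0" if "s \<in> S" for s
      using proj(2)[OF that, of x] proj(2)[OF that, of y] by (simp add: algebra_simps)
  qed (use subspace proj in \<open>auto intro: subspace_add\<close>)
  show "proj S (r *\<^sub>R x) = r *\<^sub>R proj S x" for r x
  proof (rule proj_unique)
    show "(r *\<^sub>R x - r *\<^sub>R proj S x) \<bullet> s = 0" if "s \<in> S" for s
      using proj(2)[OF that, of x] by (simp flip: scaleR_diff_right)
  qed (use subspace proj in \<open>auto intro: subspace_scale\<close>)
  show "norm (proj S x) \<le> norm x * 1" for x using norm_proj_le by simp
qed

end

section \<open>The algebra of operators\<close>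

text \<open>
  A type constructor with one argument, so that composition can instantiate the classes of algebras.
\<close>

typedef (overloaded) 'x endo = "UNIV :: ('x::real_normed_vector \<Rightarrow>\<^sub>L 'x) set" by simp

setup_lifting type_definition_endo

instantiation endo :: (real_normed_vector) real_vector
begin
lift_definition zero_endo :: "'a endo" is 0 .
lift_definition plus_endo :: "'a endo \<Rightarrow> 'a endo \<Rightarrow> 'a endo" is "(+)" .
lift_definition minus_endo :: "'a endo \<Rightarrow> 'a endo \<Rightarrow> 'a endo" is "(-)" .
lift_definition uminus_endo :: "'a endo \<Rightarrow> 'a endo" is uminus .
lift_definition scaleR_endo :: "real \<Rightarrow> 'a endo \<Rightarrow> 'a endo" is scaleR .
instance by standard (transfer; simp add: algebra_simps)+
end

instantiation endo :: (real_normed_vector) real_normed_vector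
begin
lift_definition norm_endo :: "'a endo \<Rightarrow> real" is norm .
definition sgn_endo :: "'a endo \<Rightarrow> 'a endo" where "sgn_endo F = F /\<^sub>R norm F"
definition dist_endo :: "'a endo \<Rightarrow> 'a endo \<Rightarrow> real" where "dist_endo F G = norm (F - G)"
definition uniformity_endo :: "('a endo \<times> 'a endo) filter" where
  "uniformity_endo = (INF e\<in>{0<..}. principal {(x, y). dist x y < e})"
definition open_endo :: "'a endo set \<Rightarrow> bool" where
  "open_endo U \<longleftrightarrow> (\<forall>x\<in>U. \<forall>\<^sub>F (x', y) in uniformity. x' = x \<longrightarrow> y \<in> U)"
instance
proof
  fix F G :: "'a endo" and r :: real
  show "norm (F + G) \<le> norm F + norm G" by transfer (rule norm_triangle_ineq)
  show "norm (r *\<^sub>R F) = \<bar>r\<bar> * norm F" by transfer simp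
  show "(norm F = 0) = (F = 0)" by transfer simp
qed (auto simp: sgn_endo_def dist_endo_def uniformity_endo_def open_endo_def)
end

instantiation endo :: (real_normed_vector) "{real_normed_algebra, monoid_mult}"
begin
lift_definition times_endo :: "'a endo \<Rightarrow> 'a endo \<Rightarrow> 'a endo" is "(o\<^sub>L)" .
lift_definition one_endo :: "'a endo" is id_blinfun .
instance
  by standard (transfer; auto intro!: blinfun_eqI norm_blinfun_compose
      simp: blinfun.add_left blinfun.add_right blinfun.scaleR_left blinfun.scaleR_right)+
end

instance endo :: (banach) banach
proof
  fix X :: "nat \<Rightarrow> 'a endo" assume "Cauchy X"
  have d: "dist F G = dist (Rep_endo F) (Rep_endo G)" for F G :: "'a endo"
    unfolding dist_norm by transfer simp
  have "Cauchy (\<lambda>n. Rep_endo (X n))" using \<open>Cauchy X\<close> by (simp add: Cauchy_def d)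
  then obtain L where "(\<lambda>n. Rep_endo (X n)) \<longlonglongrightarrow> L" using convergent_eq_Cauchy by blast
  then have "X \<longlonglongrightarrow> Abs_endo L" by (simp add: lim_sequentially d Abs_endo_inverse)
  then show "convergent X" by (rule convergentI)
qed

lift_definition endo_apply :: "'a::real_normed_vector endo \<Rightarrow> 'a \<Rightarrow> 'a" is blinfun_apply .

definition endo_of :: "('a::real_normed_vector \<Rightarrow> 'a) \<Rightarrow> 'a endo" where
  "endo_of f = Abs_endo (Blinfun f)"

lemma endo_apply_endo_of: "bounded_linear f \<Longrightarrow> endo_apply (endo_of f) = f"
  by (simp add: endo_of_def endo_apply.abs_eq bounded_linear_Blinfun_apply)

lemma endo_eqI: "(\<And>x. endo_apply F x = endo_apply G x) \<Longrightarrow> F = G"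
  by transfer (rule blinfun_eqI)

lemma endo_apply_simps [simp]:
  "endo_apply (F + G) x = endo_apply F x + endo_apply G x"
  "endo_apply (F - G) x = endo_apply F x - endo_apply G x"
  "endo_apply (- F) x = - endo_apply F x"
  "endo_apply (r *\<^sub>R F) x = r *\<^sub>R endo_apply F x"
  "endo_apply (F * G) x = endo_apply F (endo_apply G x)"
  "endo_apply 1 x = x" "endo_apply 0 x = 0"
  by (transfer; simp add: blinfun.add_left blinfun.diff_left blinfun.minus_left blinfun.scaleR_left)+

lemma bounded_linear_endo_apply: "bounded_linear (endo_apply F)"
  by transfer (rule blinfun.bounded_linear_right)

lemma bounded_linear_endo_apply_left: "bounded_linear (\<lambda>F. endo_apply F x)"
proof (rule bounded_linear_intro[of _ "norm x"])
  show "norm (endo_apply F x) \<le> norm F * norm x" for F by transfer (rule norm_blinfun)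
qed auto

lemma norm_endo_apply_le: "norm (endo_apply F x) \<le> norm F * norm x"
  by transfer (rule norm_blinfun)

lemma norm_endo_bound: "0 \<le> b \<Longrightarrow> (\<And>x. norm (endo_apply F x) \<le> b * norm x) \<Longrightarrow> norm F \<le> b"
  by transfer (rule norm_blinfun_bound)

lemmas endo_apply_linear [simp] =
  bounded_linear.linear[OF bounded_linear_endo_apply, THEN linear_add]
  bounded_linear.linear[OF bounded_linear_endo_apply, THEN linear_diff]
  bounded_linear.linear[OF bounded_linear_endo_apply, THEN linear_scale]
  bounded_linear.linear[OF bounded_linear_endo_apply, THEN linear_0]

section \<open>Operators on a closed subspace of a Hilbert space\<close>

text \<open>
  A complex space \<open>V\<close> that \<open>J\<close> identifies with a closed subspace of a Hilbert space, and a continuous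
  form on it. Only the real part \<open>B\<close> of the form enters the model; the imaginary part is recovered by
  multiplying the first argument by \<open>-\<i>\<close>.
\<close>

locale hilbert_model = nvs_embedding V sc J
  for V :: "(complex, 'a) nvs"
    and sc :: "complex \<Rightarrow> 'x \<Rightarrow> 'x::{real_inner, banach}"
    and J :: "'a \<Rightarrow> 'x" +
  fixes B :: "'x \<Rightarrow> 'x \<Rightarrow> real" and form :: "'a \<Rightarrow> 'a \<Rightarrow> complex"
  assumes closed_range: "closed (J ` carrier V)"
    and sc_real: "\<And>r u. sc (of_real r) u = r *\<^sub>R u"
    and B: "bounded_bilinear B"
    and Re_form: "\<And>f g. f \<in> carrier V \<Longrightarrow> g \<in> carrier V \<Longrightarrow> Re (form f g) = B (J f) (J g)"
    and Im_form: "\<And>f g. f \<in> carrier V \<Longrightarrow> g \<in> carrier V \<Longrightarrow> Im (form f g) = B (sc (- \<i>) (J f)) (J g)"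
begin

interpretation B: bounded_bilinear B by (rule B)

definition S :: "'x set" where "S = J ` carrier V"
definition Jinv :: "'x \<Rightarrow> 'a" where "Jinv = inv_into (carrier V) J"

lemma J_in_S [simp]: "f \<in> carrier V \<Longrightarrow> J f \<in> S" by (simp add: S_def)

lemma Jinv [simp]: "s \<in> S \<Longrightarrow> Jinv s \<in> carrier V" "s \<in> S \<Longrightarrow> J (Jinv s) = s"
  by (auto simp: S_def Jinv_def inv_into_into f_inv_into_f)

lemma Jinv_J [simp]: "f \<in> carrier V \<Longrightarrow> Jinv (J f) = f"
  by (simp add: Jinv_def inj)

lemma S_sc: "s \<in> S \<Longrightarrow> sc a s \<in> S"
  unfolding S_def by (metis (no_types, lifting) J_scale scale_closed image_iff)

lemma S_add: "s \<in> S \<Longrightarrow> t \<in> S \<Longrightarrow> s + t \<in> S"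
  unfolding S_def by (metis (no_types, lifting) J_add add_closed image_iff)

lemma sc_scaleR: "sc a (r *\<^sub>R u) = r *\<^sub>R sc a u"
  by (simp add: mult.commute flip: sc_real sc_mult)

sublocale S: closed_subspace S
proof
  show "subspace S"
    unfolding subspace_def
  proof (intro conjI ballI allI)
    show "0 \<in> S" using zero_closed J_zero by (metis S_def imageI)
    show "r *\<^sub>R s \<in> S" if "s \<in> S" for r s using S_sc[OF that, of "of_real r"] by (simp add: sc_real)
  qed (rule S_add)
  show "closed S" using closed_range by (simp add: S_def)
qed

lemma S_zero [simp]: "0 \<in> S" using S.subspace subspace_0 by blast

lemma S_diff: "s \<in> S \<Longrightarrow> t \<in> S \<Longrightarrow> s - t \<in> S"
  using S.subspace subspace_diff by blast

abbreviation P :: "'x \<Rightarrow> 'x" where "P \<equiv> proj S"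

lemma P_in_S [simp]: "P x \<in> S" by (rule S.proj)
lemma P_id [simp]: "s \<in> S \<Longrightarrow> P s = s" by (rule S.proj_id)
lemma P_compl [simp]: "P (x - P x) = 0" by (rule S.proj_compl)

lemmas P_linear = bounded_linear.linear[OF S.bounded_linear_proj]

lemma P_simps [simp]: "P (x + y) = P x + P y" "P (x - y) = P x - P y" "P (r *\<^sub>R x) = r *\<^sub>R P x" "P 0 = 0"
  using P_linear by (auto simp: linear_add linear_diff linear_scale linear_0)

text \<open>
  Operators on \<open>V\<close> become operators on the whole Hilbert space by composition with the projection
  \<open>P\<close>; \<open>restr\<close> is the way back, for operators that are \<open>invariant\<close>.
\<close>

definition ext :: "('a \<Rightarrow> 'a) \<Rightarrow> 'x endo" where
  "ext T = endo_of (\<lambda>x. J (T (Jinv (P x))))"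

definition restr :: "'x endo \<Rightarrow> 'a \<Rightarrow> 'a" where
  "restr R = (\<lambda>f\<in>carrier V. Jinv (endo_apply R (J f)))"

definition invariant :: "'x endo \<Rightarrow> bool" where
  "invariant R \<longleftrightarrow> (\<forall>s\<in>S. endo_apply R s \<in> S \<and> (\<forall>a. endo_apply R (sc a s) = sc a (endo_apply R s)))"

lemma bounded_opsD:
  assumes "T \<in> bounded_ops V"
  shows "f \<in> carrier V \<Longrightarrow> T f \<in> carrier V"
    and "f \<in> carrier V \<Longrightarrow> g \<in> carrier V \<Longrightarrow> T (vadd V f g) = vadd V (T f) (T g)"
    and "f \<in> carrier V \<Longrightarrow> T (vscale V a f) = vscale V a (T f)"
    and "T \<in> extensional (carrier V)"
  using assms unfolding bounded_ops_def by (auto simp: PiE_def)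

lemma Jinv_add: "s \<in> S \<Longrightarrow> t \<in> S \<Longrightarrow> Jinv (s + t) = vadd V (Jinv s) (Jinv t)"
  by (rule inj_onD[OF inj]) (auto simp: J_add S_add add_closed)

lemma Jinv_sc: "s \<in> S \<Longrightarrow> Jinv (sc a s) = vscale V a (Jinv s)"
  by (rule inj_onD[OF inj]) (auto simp: J_scale S_sc scale_closed)

lemma endo_apply_ext:
  assumes T: "T \<in> bounded_ops V" shows "endo_apply (ext T) x = J (T (Jinv (P x)))"
proof -
  obtain C where C: "\<And>f. f \<in> carrier V \<Longrightarrow> vnorm V (T f) \<le> C * vnorm V f"
    using T unfolding bounded_ops_def by blast
  have "bounded_linear (\<lambda>x. J (T (Jinv (P x))))"
  proof (rule bounded_linear_intro[of _ "\<bar>C\<bar>"])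
    show "J (T (Jinv (P (x + y)))) = J (T (Jinv (P x))) + J (T (Jinv (P y)))" for x y
      by (simp add: Jinv_add bounded_opsD[OF T] J_add)
    show "J (T (Jinv (P (r *\<^sub>R x)))) = r *\<^sub>R J (T (Jinv (P x)))" for r x
      using Jinv_sc[of "P x" "of_real r"]
      by (simp add: bounded_opsD[OF T] J_scale sc_real)
    show "norm (J (T (Jinv (P x)))) \<le> norm x * \<bar>C\<bar>" for x
    proof -
      have "norm (J (T (Jinv (P x)))) \<le> C * norm (P x)"
        using C[of "Jinv (P x)"] by (simp add: J_norm bounded_opsD[OF T])
      also have "\<dots> \<le> \<bar>C\<bar> * norm x" by (intro mult_mono S.norm_proj_le) auto
      finally show ?thesis by (simp add: mult.commute)
    qed
  qed
  then show ?thesis by (simp add: ext_def endo_apply_endo_of)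
qed

lemma ext_J: "T \<in> bounded_ops V \<Longrightarrow> f \<in> carrier V \<Longrightarrow> endo_apply (ext T) (J f) = J (T f)"
  by (simp add: endo_apply_ext)

lemma invariant_ext: "T \<in> bounded_ops V \<Longrightarrow> invariant (ext T)"
  by (auto simp: invariant_def endo_apply_ext bounded_opsD S_sc Jinv_sc J_scale)

lemma restr_in:
  assumes R: "invariant R" shows "restr R \<in> bounded_ops V"
  unfolding bounded_ops_def mem_Collect_eq
proof (intro conjI ballI allI)
  have c: "Jinv (endo_apply R (J f)) \<in> carrier V" if "f \<in> carrier V" for f
    using R that by (auto simp: invariant_def)
  then show "restr R \<in> carrier V \<rightarrow>\<^sub>E carrier V" by (auto simp: restr_def)
  show "restr R (vadd V f g) = vadd V (restr R f) (restr R g)" if "f \<in> carrier V" "g \<in> carrier V" for f g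
    using R that by (simp add: restr_def add_closed J_add Jinv_add invariant_def)
  show "restr R (vscale V a f) = vscale V a (restr R f)" if "f \<in> carrier V" for f a
    using R that by (simp add: restr_def scale_closed J_scale Jinv_sc invariant_def)
  show "\<exists>C. \<forall>f\<in>carrier V. vnorm V (restr R f) \<le> C * vnorm V f"
    using R c by (auto simp: restr_def J_norm invariant_def norm_endo_apply_le intro!: exI[of _ "norm R"])
qed

lemma J_restr: "invariant R \<Longrightarrow> f \<in> carrier V \<Longrightarrow> J (restr R f) = endo_apply R (J f)"
  by (simp add: restr_def invariant_def)

lemma restr_ext: "T \<in> bounded_ops V \<Longrightarrow> restr (ext T) = T"
  using bounded_opsD[of T]
  by (intro extensionalityI[of _ "carrier V"]) (auto simp: restr_def endo_apply_ext)

lemma ext_inj: "inj_on ext (bounded_ops V)"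
  by (metis inj_onI restr_ext)

lemma ext_restr: 
  assumes "invariant R" "\<And>x. endo_apply R (x - P x) = 0" shows "ext (restr R) = R"
proof (rule endo_eqI)
  fix x
  have "endo_apply R x = endo_apply R (P x)" using assms(2)[of x] by simp
  then show "endo_apply (ext (restr R)) x = endo_apply R x"
    using assms(1) by (simp add: endo_apply_ext restr_in J_restr)
qed

lemma ext_compl: "T \<in> bounded_ops V \<Longrightarrow> endo_apply (ext T) (x - P x) = 0"
  using ext_J[of T "vzero V"] bounded_opsD(3)[of T "vzero V" 0]
  by (metis P_compl P_id P_in_S S_zero endo_apply_ext endo_apply_linear(4))

text \<open>
  The projection has norm at most \<open>1\<close>, so extending an operator does not increase its norm.
\<close>

lemma op_norm_eq:
  assumes T: "T \<in> bounded_ops V" shows "op_norm V T = norm (ext T)"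
proof (rule antisym)
  let ?U = "{f \<in> carrier V. vnorm V f \<le> 1}"
  have le: "vnorm V (T f) \<le> norm (ext T)" if "f \<in> ?U" for f
  proof -
    have "vnorm V (T f) = norm (endo_apply (ext T) (J f))"
      using that T by (simp add: ext_J J_norm bounded_opsD[OF T])
    also have "\<dots> \<le> norm (ext T) * norm (J f)" by (rule norm_endo_apply_le)
    also have "\<dots> \<le> norm (ext T) * 1" using that by (intro mult_left_mono) (auto simp: J_norm)
    finally show ?thesis by simp
  qed
  have ne: "?U \<noteq> {}" using zero_closed by (auto simp: J_norm J_zero intro!: exI[of _ "vzero V"])
  show "op_norm V T \<le> norm (ext T)" unfolding op_norm_def by (rule cSUP_least[OF ne le])
  have bdd: "bdd_above ((\<lambda>f. vnorm V (T f)) ` ?U)" using le by (auto intro!: bdd_aboveI)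
  have up: "vnorm V (T f) \<le> op_norm V T" if "f \<in> ?U" for f
    unfolding op_norm_def by (rule cSUP_upper[OF that bdd])
  have nonneg: "0 \<le> op_norm V T"
    using up[of "vzero V"] zero_closed bounded_opsD(1)[OF T, of "vzero V"]
    by (simp add: J_norm J_zero) (meson norm_ge_zero order_trans)
  show "norm (ext T) \<le> op_norm V T"
  proof (rule norm_endo_bound[OF nonneg])
    fix x
    define s where "s = P x"
    have s: "s \<in> S" by (simp add: s_def)
    have "norm (J (T (Jinv s))) \<le> op_norm V T * norm s"
    proof (cases "s = 0")
      case True
      then show ?thesis using endo_apply_ext[OF T, of s] s by simp
    next
      case False
      (* Scale to the unit sphere, where the operator norm is a supremum. *)
      let ?c = "complex_of_real (1 / norm s)"
      have in_U: "vscale V ?c (Jinv s) \<in> ?U"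
        using s False by (simp add: scale_closed J_norm J_scale norm_sc norm_divide)
      have eq: "vnorm V (T (vscale V ?c (Jinv s))) = norm (J (T (Jinv s))) / norm s"
        using s by (simp add: bounded_opsD[OF T] J_norm J_scale norm_sc scale_closed norm_divide)
      show ?thesis using up[OF in_U] False unfolding eq by (simp add: divide_le_eq)
    qed
    also have "\<dots> \<le> op_norm V T * norm x" using nonneg S.norm_proj_le by (intro mult_left_mono) (auto simp: s_def)
    finally show "norm (endo_apply (ext T) x) \<le> op_norm V T * norm x"
      using T by (simp add: endo_apply_ext s_def)
  qed
qed

text \<open>
  A set of operators on the complex space \<open>V\<close>, as a space over the reals.
\<close>

definition real_ops :: "('a \<Rightarrow> 'a) set \<Rightarrow> (real, 'a \<Rightarrow> 'a) nvs" where
  "real_ops C = \<lparr>carrier = C, vadd = vadd (op_space V), vzero = vzero (op_space V),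
     vscale = (\<lambda>r. vscale (op_space V) (of_real r)), vnorm = op_norm V\<rparr>"

lemma op_add:
  assumes "T \<in> bounded_ops V" "U \<in> bounded_ops V"
  shows "vadd (op_space V) T U \<in> bounded_ops V" "ext (vadd (op_space V) T U) = ext T + ext U"
proof -
  have inv: "invariant (ext T + ext U)"
    using invariant_ext assms by (auto simp: invariant_def S_add sc_add_right)
  have "vadd (op_space V) T U = restr (ext T + ext U)"
    using assms by (auto simp: op_space_def restr_def ext_J Jinv_add bounded_opsD)
  then show "vadd (op_space V) T U \<in> bounded_ops V" "ext (vadd (op_space V) T U) = ext T + ext U"
    using inv ext_compl[OF assms(1)] ext_compl[OF assms(2)] by (simp_all add: restr_in ext_restr)
qed

lemma op_scale:
  assumes "T \<in> bounded_ops V"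
  shows "vscale (op_space V) (of_real r) T \<in> bounded_ops V"
    "ext (vscale (op_space V) (of_real r) T) = r *\<^sub>R ext T"
proof -
  have inv: "invariant (r *\<^sub>R ext T)"
    using invariant_ext[OF assms] S.subspace
    by (auto simp: invariant_def subspace_scale sc_scaleR)
  have "vscale (op_space V) (of_real r) T = restr (r *\<^sub>R ext T)"
    using assms Jinv_sc[of "J (T _)" "of_real r"]
    by (auto simp: op_space_def restr_def ext_J bounded_opsD sc_real)
  then show "vscale (op_space V) (of_real r) T \<in> bounded_ops V"
    "ext (vscale (op_space V) (of_real r) T) = r *\<^sub>R ext T"
    using inv ext_compl[OF assms] by (simp_all add: restr_in ext_restr)
qed

lemma op_zero:
  "vzero (op_space V) \<in> bounded_ops V" "ext (vzero (op_space V)) = 0"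
proof -
  have inv: "invariant 0" using sc_scaleR[of _ 0] by (auto simp: invariant_def)
  have "Jinv 0 = vzero V" using Jinv_J[OF zero_closed] by (simp add: J_zero)
  then have "vzero (op_space V) = restr 0" by (simp add: op_space_def restr_def)
  then show "vzero (op_space V) \<in> bounded_ops V" "ext (vzero (op_space V)) = 0"
    using inv by (simp_all add: restr_in ext_restr)
qed

lemma real_ops_embedding:
  assumes "C \<subseteq> bounded_ops V"
    and "\<And>T U. T \<in> C \<Longrightarrow> U \<in> C \<Longrightarrow> vadd (op_space V) T U \<in> C"
    and "vzero (op_space V) \<in> C"
    and "\<And>r T. T \<in> C \<Longrightarrow> vscale (op_space V) (of_real r) T \<in> C"
  shows "nvs_embedding (real_ops C) scaleR ext"
  using assms inj_on_subset[OF ext_inj assms(1)]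
  by unfold_locales
    (auto simp: real_ops_def op_add op_scale op_zero op_norm_eq subset_iff algebra_simps)

text \<open>
  The distance, and with it the topology, does not distinguish real from complex scalars.
\<close>

lemma norm_topology_op_space:
  "norm_topology (op_space V) = pullback_topology (bounded_ops V) ext euclidean"
proof -
  interpret R: nvs_embedding "real_ops (bounded_ops V)" scaleR ext
    by (rule real_ops_embedding) (auto simp: op_add op_scale op_zero)
  have "vdist (op_space V) = vdist (real_ops (bounded_ops V))"
    by (simp add: fun_eq_iff vdist_def vdiff_def real_ops_def op_space_def)
  then have "norm_topology (op_space V) = norm_topology (real_ops (bounded_ops V))"
    by (simp add: norm_topology_def real_ops_def op_space_def)
  then show ?thesis using R.norm_topology_pullback by (simp add: real_ops_def)
qed

text \<open>
  The model space of the group: its Lie algebra.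
\<close>

definition skew_ops :: "('a \<Rightarrow> 'a) set" where
  "skew_ops = {T \<in> bounded_ops V. \<forall>f\<in>carrier V. \<forall>g\<in>carrier V. B (J (T f)) (J g) + B (J f) (J (T g)) = 0}"

lemma skew_embedding: "nvs_embedding (real_ops skew_ops) scaleR ext"
proof (rule real_ops_embedding)
  have J_add': "J (vadd (op_space V) T U f) = J (T f) + J (U f)"
    if "T \<in> bounded_ops V" "U \<in> bounded_ops V" "f \<in> carrier V" for T U f
    using that op_add[OF that(1,2)] by (simp flip: ext_J)
  have J_scale': "J (vscale (op_space V) (of_real r) T f) = r *\<^sub>R J (T f)"
    if "T \<in> bounded_ops V" "f \<in> carrier V" for T f r
    using that op_scale[OF that(1), of r] by (simp flip: ext_J)
  have J_zero': "J (vzero (op_space V) f) = 0" if "f \<in> carrier V" for f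
    using that op_zero by (simp flip: ext_J)
  show "vadd (op_space V) T U \<in> skew_ops" if "T \<in> skew_ops" "U \<in> skew_ops" for T U
  proof -
    have "B (J (T f) + J (U f)) (J g) + B (J f) (J (T g) + J (U g)) = 0"
      if "f \<in> carrier V" "g \<in> carrier V" for f g
    proof -
      have "B (J (T f)) (J g) + B (J f) (J (T g)) = 0" "B (J (U f)) (J g) + B (J f) (J (U g)) = 0"
        using that \<open>T \<in> skew_ops\<close> \<open>U \<in> skew_ops\<close> by (auto simp: skew_ops_def)
      then show ?thesis by (simp add: B.add_left B.add_right)
    qed
    then show ?thesis using that by (simp add: skew_ops_def op_add J_add')
  qed
  show "vscale (op_space V) (of_real r) T \<in> skew_ops" if "T \<in> skew_ops" for T r
    using that
    by (auto simp: skew_ops_def op_scale J_scale' B.scaleR_left B.scaleR_right simp flip: distrib_left)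
  show "vzero (op_space V) \<in> skew_ops"
    by (simp add: skew_ops_def op_zero J_zero' B.zero_left B.zero_right)
qed (auto simp: skew_ops_def)

definition skew_endos :: "'x endo set" where
  "skew_endos = {R. invariant R \<and> (\<forall>x. endo_apply R (x - P x) = 0) \<and>
     (\<forall>s\<in>S. \<forall>t\<in>S. B (endo_apply R s) t + B s (endo_apply R t) = 0)}"

lemma ext_skew: "ext ` skew_ops = skew_endos"
proof (intro equalityI subsetI)
  fix R assume "R \<in> ext ` skew_ops"
  then obtain T where T: "T \<in> skew_ops" "R = ext T" by blast
  then show "R \<in> skew_endos"
    by (auto simp: skew_endos_def skew_ops_def invariant_ext ext_compl endo_apply_ext)
      (metis Jinv)
next
  fix R assume R: "R \<in> skew_endos"
  then have "restr R \<in> skew_ops"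
    by (auto simp: skew_endos_def skew_ops_def restr_in J_restr)
  moreover have "R = ext (restr R)" using R by (simp add: skew_endos_def ext_restr)
  ultimately show "R \<in> ext ` skew_ops" by blast
qed

text \<open>
  Every condition is an equation, or a membership in the closed set \<open>S\<close>, between quantities that depend
  continuously on the operator.
\<close>

lemma closed_skew: "closed skew_endos"
proof -
  have app: "continuous_on UNIV (\<lambda>R. endo_apply R x)" for x :: 'x
    using bounded_linear.continuous_on[OF bounded_linear_endo_apply_left continuous_on_id] .
  have scc: "continuous_on UNIV (sc a)" for a
  proof -
    have "bounded_linear (sc a)"
      by (rule bounded_linear_intro[of _ "norm a"]) (auto simp: sc_add_right sc_scaleR norm_sc mult.commute)
    then show ?thesis using bounded_linear.continuous_on continuous_on_id by blast
  qed
  have eq: "skew_endos = (\<Inter>s\<in>S. {R. endo_apply R s \<in> S}) \<inter>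
     (\<Inter>s\<in>S. \<Inter>a. {R. endo_apply R (sc a s) = sc a (endo_apply R s)}) \<inter>
     (\<Inter>x. {R. endo_apply R (x - P x) = 0}) \<inter>
     (\<Inter>s\<in>S. \<Inter>t\<in>S. {R. B (endo_apply R s) t + B s (endo_apply R t) = 0})"
    by (auto simp: skew_endos_def invariant_def)
  have 1: "closed {R. endo_apply R s \<in> S}" for s
    using closed_vimage[OF S.closed app, of s] by (simp add: vimage_def)
  have 2: "closed {R. endo_apply R (sc a s) = sc a (endo_apply R s)}" for a s
    by (intro closed_Collect_eq app continuous_on_compose2[OF scc app]) auto
  have 3: "closed {R. endo_apply R x = 0}" for x :: 'x
    by (intro closed_Collect_eq app continuous_on_const)
  have 4: "closed {R. B (endo_apply R s) t + B s (endo_apply R t) = 0}" for s t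
    by (intro closed_Collect_eq continuous_on_const continuous_on_add B.continuous_on app)
  show ?thesis unfolding eq by (intro closed_Int closed_INT ballI 1 2 3 4)
qed

end

context hilbert_model
begin

interpretation B: bounded_bilinear B by (rule B)

section \<open>Isometry groups of forms\<close>

definition isometries :: "('a \<Rightarrow> 'a) set" where
  "isometries = {T \<in> carrier (op_Gl V). \<forall>f\<in>carrier V. \<forall>g\<in>carrier V. form (T f) (T g) = form f g}"

abbreviation isometry_group :: "('a \<Rightarrow> 'a) monoid" where
  "isometry_group \<equiv> (op_Gl V)\<lparr>carrier := isometries\<rparr>"

abbreviation idV :: "'a \<Rightarrow> 'a" where "idV \<equiv> (\<lambda>x\<in>carrier V. x)"

text \<open>
  Extending by the identity, instead of zero, on the orthogonal complement makes the embedding unital.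
  Cayley transforms turn the identity on the complement into zero and conversely, which matches \<open>embed\<close>
  on the group with \<open>ext\<close> on the model space.
\<close>

definition embed :: "('a \<Rightarrow> 'a) \<Rightarrow> 'x endo" where
  "embed T = ext T + (1 - endo_of P)"

lemma endo_apply_P [simp]: "endo_apply (endo_of P) x = P x"
  by (simp add: endo_apply_endo_of S.bounded_linear_proj)

lemma embed_apply: "T \<in> bounded_ops V \<Longrightarrow> endo_apply (embed T) x = J (T (Jinv (P x))) + (x - P x)"
  by (simp add: embed_def endo_apply_ext)

lemma embed_on_S: "T \<in> bounded_ops V \<Longrightarrow> s \<in> S \<Longrightarrow> endo_apply (embed T) s = J (T (Jinv s))"
  by (simp add: embed_apply)

lemma embed_compl: "T \<in> bounded_ops V \<Longrightarrow> endo_apply (embed T) (x - P x) = x - P x"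
  using ext_compl[of T x] by (simp add: embed_def algebra_simps)

lemma invariant_one: "invariant 1" by (simp add: invariant_def)

lemma invariant_mult: "invariant R \<Longrightarrow> invariant R' \<Longrightarrow> invariant (R * R')"
  by (simp add: invariant_def)

lemma invariant_diff: "invariant R \<Longrightarrow> invariant R' \<Longrightarrow> invariant (R - R')"
  using sc_add_right[of _ _ "- _"] sc_scaleR[of _ "-1"]
  by (auto simp: invariant_def S_diff)

lemma invariant_embed: "T \<in> bounded_ops V \<Longrightarrow> invariant (embed T)"
  by (auto simp: invariant_def embed_on_S bounded_opsD S_sc Jinv_sc J_scale)

lemma restr_one: "restr 1 = idV" by (auto simp: restr_def)

lemma idV: "idV \<in> bounded_ops V" using restr_in[OF invariant_one] by (simp add: restr_one)

lemma compose_restr: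
  assumes "invariant R" "invariant R'"
  shows "compose (carrier V) (restr R) (restr R') = restr (R * R')"
  using assms by (auto simp: compose_def restr_def invariant_def fun_eq_iff)

lemma compose_bounded_ops:
  assumes "T \<in> bounded_ops V" "U \<in> bounded_ops V"
  shows "compose (carrier V) T U \<in> bounded_ops V"
proof -
  have "compose (carrier V) T U = restr (ext T * ext U)"
    using compose_restr[OF invariant_ext[OF assms(1)] invariant_ext[OF assms(2)]] assms
    by (simp add: restr_ext)
  then show ?thesis using invariant_ext assms by (simp add: restr_in invariant_mult)
qed

lemma embed_restr:
  assumes "invariant R" "\<And>x. endo_apply R (x - P x) = x - P x" shows "embed (restr R) = R"
proof (rule endo_eqI)
  fix x
  have "endo_apply R x = endo_apply R (P x) + endo_apply R (x - P x)" by simp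
  then show "endo_apply (embed (restr R)) x = endo_apply R x"
    using assms by (simp only: embed_apply restr_in J_restr Jinv P_in_S assms(2))
qed

lemma embed_compose:
  assumes "T \<in> bounded_ops V" "U \<in> bounded_ops V"
  shows "embed (compose (carrier V) T U) = embed T * embed U"
proof (rule endo_eqI)
  fix x
  let ?f = "Jinv (P x)"
  have "endo_apply (embed U) x = J (U ?f) + (x - P x)" using assms by (simp add: embed_apply)
  then have "endo_apply (embed T * embed U) x = endo_apply (embed T) (J (U ?f)) + endo_apply (embed T) (x - P x)"
    by (metis endo_apply_linear(1) endo_apply_simps(5))
  also have "\<dots> = J (T (U ?f)) + (x - P x)"
    using bounded_opsD(1)[OF assms(2), of ?f]
    by (simp only: embed_on_S[OF assms(1)] embed_compl[OF assms(1)] J_in_S Jinv_J Jinv P_in_S)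
  finally show "endo_apply (embed (compose (carrier V) T U)) x = endo_apply (embed T * embed U) x"
    using assms by (simp add: embed_apply compose_bounded_ops) (simp add: compose_def)
qed

lemma embed_id: "embed idV = 1"
  by (rule endo_eqI) (simp add: embed_apply idV)

lemma embed_inj: "inj_on embed (bounded_ops V)"
  by (rule inj_onI) (auto simp: embed_def dest: inj_onD[OF ext_inj])

lemma op_monoid: "monoid (op_monoid V)"
proof (rule monoidI)
  note sel = op_monoid_def monoid.select_convs partial_object.select_convs
  show "\<one>\<^bsub>op_monoid V\<^esub> \<in> carrier (op_monoid V)" by (simp add: sel idV)
  fix T assume T: "T \<in> carrier (op_monoid V)"
  show "\<one>\<^bsub>op_monoid V\<^esub> \<otimes>\<^bsub>op_monoid V\<^esub> T = T" "T \<otimes>\<^bsub>op_monoid V\<^esub> \<one>\<^bsub>op_monoid V\<^esub> = T"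
    using T idV by (auto simp: sel embed_compose embed_id compose_bounded_ops intro!: inj_onD[OF embed_inj])
  fix U assume U: "U \<in> carrier (op_monoid V)"
  show "T \<otimes>\<^bsub>op_monoid V\<^esub> U \<in> carrier (op_monoid V)" using T U by (simp add: sel compose_bounded_ops)
  fix W assume "W \<in> carrier (op_monoid V)"
  then show "T \<otimes>\<^bsub>op_monoid V\<^esub> U \<otimes>\<^bsub>op_monoid V\<^esub> W = T \<otimes>\<^bsub>op_monoid V\<^esub> (U \<otimes>\<^bsub>op_monoid V\<^esub> W)"
    using T U by (auto simp: sel embed_compose compose_bounded_ops mult.assoc intro!: inj_onD[OF embed_inj])
qed

lemma op_Gl_simps:
  "mult (op_Gl V) = compose (carrier V)" "one (op_Gl V) = idV"
  "carrier (op_Gl V) = {T \<in> bounded_ops V. \<exists>U\<in>bounded_ops V. compose (carrier V) U T = idV \<and> compose (carrier V) T U = idV}"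
  by (simp_all add: op_Gl_def units_of_def op_monoid_def Units_def fun_eq_iff)

lemma group_isometries: "group isometry_group"
proof -
  interpret M: monoid "op_monoid V" by (rule op_monoid)
  interpret Gl: group "op_Gl V" unfolding op_Gl_def by (rule M.units_group)
  have bd: "T \<in> bounded_ops V" if "T \<in> carrier (op_Gl V)" for T using that by (simp add: op_Gl_simps)
  have "subgroup isometries (op_Gl V)"
  proof (rule Gl.subgroupI)
    show "isometries \<subseteq> carrier (op_Gl V)" by (auto simp: isometries_def)
    have "\<one>\<^bsub>op_Gl V\<^esub> \<in> isometries" using Gl.one_closed by (simp add: isometries_def op_Gl_simps(2))
    then show "isometries \<noteq> {}" by blast
    fix T assume T: "T \<in> isometries"
    then have Gl: "T \<in> carrier (op_Gl V)" by (simp add: isometries_def)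
    let ?U = "inv\<^bsub>op_Gl V\<^esub> T"
    have U: "?U \<in> carrier (op_Gl V)" using Gl by simp
    have "compose (carrier V) T ?U = idV" using Gl.r_inv[OF Gl] by (simp add: op_Gl_simps(1,2))
    then have TU: "T (?U f) = f" if "f \<in> carrier V" for f
      using that by (metis compose_eq restrict_apply')
    have "form (?U f) (?U g) = form f g" if "f \<in> carrier V" "g \<in> carrier V" for f g
    proof -
      have "?U f \<in> carrier V" "?U g \<in> carrier V" using bounded_opsD(1)[OF bd[OF U]] that by auto
      then have "form (T (?U f)) (T (?U g)) = form (?U f) (?U g)" using T by (simp add: isometries_def)
      then show ?thesis using TU that by simp
    qed
    then show "?U \<in> isometries" using U by (simp add: isometries_def)
    fix W assume W: "W \<in> isometries"
    then have "W \<in> carrier (op_Gl V)" by (simp add: isometries_def)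
    then have "T \<otimes>\<^bsub>op_Gl V\<^esub> W \<in> carrier (op_Gl V)" using Gl by simp
    then show "T \<otimes>\<^bsub>op_Gl V\<^esub> W \<in> isometries"
      using T W bounded_opsD(1)[OF bd[OF \<open>W \<in> carrier (op_Gl V)\<close>]]
      by (auto simp: isometries_def op_Gl_simps(1) compose_def)
  qed
  then show ?thesis by (rule subgroup.subgroup_is_group) (rule Gl.is_group)
qed

lemma isometry_bounded: "T \<in> isometries \<Longrightarrow> T \<in> bounded_ops V"
  by (simp add: isometries_def op_Gl_simps)

lemma isometry_B:
  assumes T: "T \<in> isometries" and "s \<in> S" "t \<in> S"
  shows "B (endo_apply (embed T) s) (endo_apply (embed T) t) = B s t"
proof -
  have "form (T (Jinv s)) (T (Jinv t)) = form (Jinv s) (Jinv t)" using assms by (simp add: isometries_def)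
  then have "Re (form (T (Jinv s)) (T (Jinv t))) = Re (form (Jinv s) (Jinv t))" by simp
  then show ?thesis
    using assms isometry_bounded[OF T] by (simp add: Re_form bounded_opsD embed_on_S)
qed

text \<open>
  The conditions on \<open>R\<close> that characterise the image of the group. Preservation of \<open>B\<close> suffices because
  \<open>R\<close> commutes with the multiplication by \<open>-\<i>\<close>, which yields the imaginary part of the form.
\<close>

lemma embed_isometriesI:
  assumes R: "runit R" "invariant R" "invariant (rinv R)"
    and compl: "\<And>x. endo_apply R (x - P x) = x - P x"
    and pres: "\<And>s t. s \<in> S \<Longrightarrow> t \<in> S \<Longrightarrow> B (endo_apply R s) (endo_apply R t) = B s t"
  shows "R \<in> embed ` isometries"
proof -
  have "restr R \<in> carrier (op_Gl V)"
    using R by (auto simp: op_Gl_simps(3) restr_in compose_restr restr_one intro!: bexI[of _ "restr (rinv R)"])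
  moreover have "form (restr R f) (restr R g) = form f g" if "f \<in> carrier V" "g \<in> carrier V" for f g
  proof (rule complex_eqI)
    have in_V: "restr R f \<in> carrier V" "restr R g \<in> carrier V"
      using bounded_opsD(1)[OF restr_in[OF R(2)]] that by auto
    show "Re (form (restr R f) (restr R g)) = Re (form f g)"
      using that in_V R pres by (simp add: Re_form J_restr)
    have "sc (- \<i>) (endo_apply R (J f)) = endo_apply R (sc (- \<i>) (J f))"
      using R(2) that by (simp add: invariant_def)
    then show "Im (form (restr R f) (restr R g)) = Im (form f g)"
      using that in_V R pres by (simp add: Im_form J_restr S_sc)
  qed
  ultimately have "restr R \<in> isometries" by (simp add: isometries_def)
  moreover have "R = embed (restr R)" using embed_restr[OF R(2) compl] by simp
  ultimately show ?thesis by blast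
qed

lemma rinv_apply: "runit R \<Longrightarrow> endo_apply R (endo_apply (rinv R) x) = x"
  "runit R \<Longrightarrow> endo_apply (rinv R) (endo_apply R x) = x"
  by (simp_all flip: endo_apply_simps(5))

lemma invariant_rinv:
  assumes R: "runit R" "invariant R" and S: "\<And>s. s \<in> S \<Longrightarrow> endo_apply (rinv R) s \<in> S"
  shows "invariant (rinv R)"
  unfolding invariant_def
proof (intro ballI conjI allI S)
  fix s a assume s: "s \<in> S"
  then have "endo_apply R (sc a (endo_apply (rinv R) s)) = sc a s"
    using R S by (simp add: invariant_def rinv_apply)
  then show "endo_apply (rinv R) (sc a s) = sc a (endo_apply (rinv R) s)"
    using rinv_apply(2)[OF R(1)] by metis
qed

text \<open>
  The equation \<open>y + X y = s\<close> with \<open>s \<in> S\<close> forces \<open>y = s - X y \<in> S\<close>, because \<open>X\<close> has its range in \<open>S\<close>.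
\<close>

lemma invariant_rinv_skew:
  assumes X: "X \<in> skew_endos" "runit (1 + X)"
  shows "invariant (rinv (1 + X))" "endo_apply (rinv (1 + X)) (x - P x) = x - P x"
proof -
  have inv: "invariant X" and z: "\<And>x. endo_apply X (x - P x) = 0" using X by (auto simp: skew_endos_def)
  have in_S: "endo_apply X y \<in> S" for y
  proof -
    have "endo_apply X y = endo_apply X (P y)" using z[of y] by simp
    then show ?thesis using inv by (simp add: invariant_def)
  qed
  show "invariant (rinv (1 + X))"
  proof (rule invariant_rinv[OF X(2)])
    show "invariant (1 + X)" using inv by (auto simp: invariant_def S_add sc_add_right)
    fix s assume s: "s \<in> S"
    let ?y = "endo_apply (rinv (1 + X)) s"
    have "?y + endo_apply X ?y = s" using rinv_apply(1)[OF X(2), of s] by simp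
    then have "?y = s - endo_apply X ?y" by (simp add: algebra_simps)
    then show "?y \<in> S" using S_diff[OF s in_S] by metis
  qed
  have "endo_apply (1 + X) (x - P x) = x - P x" using z[of x] by simp
  then show "endo_apply (rinv (1 + X)) (x - P x) = x - P x" using rinv_apply(2)[OF X(2)] by metis
qed

text \<open>
  Write \<open>s = u + X u\<close> and \<open>t = v + X v\<close>; then the Cayley transform maps \<open>s\<close> and \<open>t\<close> to \<open>u - X u\<close> and \<open>v - X v\<close>,
  and \<open>B\<close> of the two pairs differs by twice \<open>B(X u, v) + B(u, X v) = 0\<close>.
\<close>

lemma cayley_skew_isometry:
  assumes X: "X \<in> skew_endos" "runit (1 + X)" "runit (1 - X)"
  shows "cayley X \<in> embed ` isometries"
proof (rule embed_isometriesI)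
  have mX: "- X \<in> skew_endos"
    unfolding skew_endos_def mem_Collect_eq
  proof (intro conjI allI ballI)
    have "invariant 0" using sc_scaleR[of _ 0] by (auto simp: invariant_def)
    then have "invariant (0 - X)" using X by (intro invariant_diff) (auto simp: skew_endos_def)
    then show "invariant (- X)" by simp
    have "endo_apply X (x - P x) = 0" for x using X by (simp add: skew_endos_def)
    then show "endo_apply (- X) (x - P x) = 0" for x unfolding endo_apply_simps(3) by simp
    fix s t assume "s \<in> S" "t \<in> S"
    then have "B (endo_apply X s) t + B s (endo_apply X t) = 0" using X by (simp add: skew_endos_def)
    then show "B (endo_apply (- X) s) t + B s (endo_apply (- X) t) = 0"
      by (simp add: B.minus_left B.minus_right)
  qed
  have inv: "invariant X" using X by (simp add: skew_endos_def)
  note i1 = invariant_rinv_skew[OF X(1,2)]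
  have "runit (1 + - X)" using X by simp
  note i2 = invariant_rinv_skew[OF mX this]
  show "runit (cayley X)" using X by (intro runit_cayley)
  show "invariant (cayley X)"
    unfolding cayley_def by (intro invariant_mult invariant_diff invariant_one inv i1)
  have "rinv (cayley X) = (1 + X) * rinv (1 + - X)"
    using X by (simp add: cayley_def rinv_mult)
  moreover have "invariant (1 + X)" using invariant_diff[OF invariant_one, of "- X"] mX by (simp add: skew_endos_def)
  ultimately show "invariant (rinv (cayley X))" using i2 by (simp add: invariant_mult)
  show "endo_apply (cayley X) (x - P x) = x - P x" for x
  proof -
    have "endo_apply X (x - P x) = 0" using X by (simp add: skew_endos_def)
    then have "endo_apply (1 - X) (x - P x) = x - P x" by simp
    then show ?thesis unfolding cayley_def endo_apply_simps(5) i1(2) .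
  qed
  show "B (endo_apply (cayley X) s) (endo_apply (cayley X) t) = B s t" if "s \<in> S" "t \<in> S" for s t
  proof -
    define u v where "u = endo_apply (rinv (1 + X)) s" and "v = endo_apply (rinv (1 + X)) t"
    have uv: "u \<in> S" "v \<in> S" using i1(1) that by (auto simp: invariant_def u_def v_def)
    have st: "s = u + endo_apply X u" "t = v + endo_apply X v"
      using rinv_apply(1)[OF X(2), of s] rinv_apply(1)[OF X(2), of t] by (simp_all add: u_def v_def)
    have "endo_apply (cayley X) s = u - endo_apply X u" "endo_apply (cayley X) t = v - endo_apply X v"
      by (simp_all add: cayley_def u_def v_def)
    moreover have "B (endo_apply X u) v + B u (endo_apply X v) = 0"
      using X(1) uv by (simp add: skew_endos_def)
    ultimately show ?thesis
      by (simp add: st B.add_left B.add_right B.diff_left B.diff_right)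
  qed
qed

text \<open>
  Write \<open>s = u + g u\<close> and \<open>t = v + g v\<close>; then the Cayley transform maps \<open>s\<close> to \<open>u - g u\<close> and \<open>t\<close> to \<open>v - g v\<close>,
  and the skewness expression equals \<open>2 B(u, v) - 2 B(g u, g v) = 0\<close>.
\<close>

lemma cayley_isometry_skew:
  assumes g: "g \<in> embed ` isometries" and unit: "runit (1 + g)"
  shows "cayley g \<in> skew_endos"
proof -
  obtain T where T: "T \<in> isometries" "g = embed T" using g by blast
  note Tb = isometry_bounded[OF T(1)]
  have inv: "invariant g" using T Tb by (simp add: invariant_embed)
  have gz: "endo_apply g (x - P x) = x - P x" for x unfolding T(2) by (rule embed_compl[OF Tb])
  define h where "h = rinv (1 + g)"
  have h: "endo_apply h x + endo_apply g (endo_apply h x) = x" for x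
    using rinv_apply(1)[OF unit, of x] by (simp add: h_def)
  have h': "endo_apply h (y + endo_apply g y) = y" for y
    using rinv_apply(2)[OF unit, of y] by (simp add: h_def)
  have cay: "endo_apply (cayley g) x = endo_apply h x - endo_apply g (endo_apply h x)" for x
    by (simp add: cayley_def h_def)
  have hS: "endo_apply h s \<in> S" if s: "s \<in> S" for s
  proof -
    define y where "y = endo_apply h s"
    have "endo_apply g y = endo_apply g (P y) + endo_apply g (y - P y)" by simp
    then have gy: "endo_apply g y = endo_apply g (P y) + (y - P y)" by (simp only: gz)
    (* On the complement 1 + g is multiplication by 2, so a complementary part of y would survive in s. *)
    have double: "y + (a + (y - p)) = p + a + 2 *\<^sub>R (y - p)" for a p by (simp add: scaleR_2)
    have "y + endo_apply g y = s" using h[of s] by (simp only: y_def)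
    then have "s = P y + endo_apply g (P y) + 2 *\<^sub>R (y - P y)" by (simp only: gy double)
    moreover have "P y + endo_apply g (P y) \<in> S" using inv by (simp add: invariant_def S_add)
    ultimately have "2 *\<^sub>R (y - P y) \<in> S" using S_diff[OF s] by (metis add_diff_cancel_left')
    then have "P (2 *\<^sub>R (y - P y)) = 2 *\<^sub>R (y - P y)" by (rule P_id)
    then have "y - P y = 0" by simp
    then show ?thesis using P_in_S[of y] by (simp add: y_def)
  qed
  have invh: "invariant h"
    unfolding h_def
    using hS inv by (intro invariant_rinv[OF unit]) (auto simp: h_def invariant_def S_add sc_add_right)
  have "invariant (cayley g)"
    unfolding cayley_def h_def[symmetric] by (intro invariant_mult invariant_diff invariant_one inv invh)
  moreover have "endo_apply (cayley g) (x - P x) = 0" for x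
  proof -
    have "endo_apply h (2 *\<^sub>R (x - P x)) = x - P x" using h'[of "x - P x"] gz[of x] by (simp only: scaleR_2)
    then have "2 *\<^sub>R endo_apply h (x - P x) = x - P x" by simp
    then have "endo_apply h (x - P x) = (1/2) *\<^sub>R (x - P x)" by (metis scaleR_half_double scaleR_2 scaleR_scaleR one_neq_zero inverse_eq_divide scaleR_left_imp_eq)
    then show ?thesis using gz[of x] unfolding cay by (simp only: endo_apply_linear diff_self)
  qed
  moreover have "B (endo_apply (cayley g) s) t + B s (endo_apply (cayley g) t) = 0" if "s \<in> S" "t \<in> S" for s t
  proof -
    define u v where "u = endo_apply h s" and "v = endo_apply h t"
    have uv: "u \<in> S" "v \<in> S" using hS that by (auto simp: u_def v_def)
    have st: "s = u + endo_apply g u" "t = v + endo_apply g v" using h by (auto simp: u_def v_def)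
    have "endo_apply (cayley g) s = u - endo_apply g u" "endo_apply (cayley g) t = v - endo_apply g v"
      by (simp_all add: cay u_def v_def)
    moreover have "B (endo_apply g u) (endo_apply g v) = B u v" using isometry_B[OF T(1)] uv T(2) by simp
    ultimately show ?thesis
      by (simp add: st B.add_left B.add_right B.diff_left B.diff_right)
  qed
  ultimately show ?thesis by (simp add: skew_endos_def)
qed

text \<open>
  The norm topology on the group is the one induced by \<open>embed\<close>, which differs from \<open>ext\<close> by a constant.
\<close>

theorem isometries_lie_group:
  "real_banach_lie_group isometry_group (subtopology (norm_topology (op_space V)) isometries)"
proof -
  have sub: "isometries \<subseteq> bounded_ops V" using isometry_bounded by blast
  interpret group isometry_group by (rule group_isometries)
  interpret E: nvs_embedding "real_ops skew_ops" scaleR ext by (rule skew_embedding)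
  have range_E: "ext ` carrier (real_ops skew_ops) = skew_endos" by (simp add: real_ops_def ext_skew)
  interpret cayley_group isometry_group "real_ops skew_ops" ext embed
  proof unfold_locales
    show "inj_on embed (carrier isometry_group)" using inj_on_subset[OF embed_inj sub] by simp
    show "embed \<one>\<^bsub>isometry_group\<^esub> = 1" by (simp add: op_Gl_simps embed_id)
    show "embed (T \<otimes>\<^bsub>isometry_group\<^esub> U) = embed T * embed U"
      if "T \<in> carrier isometry_group" "U \<in> carrier isometry_group" for T U
      using that sub by (auto simp: op_Gl_simps intro!: embed_compose)
    show "closed (ext ` carrier (real_ops skew_ops))" unfolding range_E by (rule closed_skew)
    show "cayley X \<in> embed ` carrier isometry_group"
      if "X \<in> ext ` carrier (real_ops skew_ops)" "runit (1 + X)" "runit (1 - X)" for X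
      using cayley_skew_isometry that unfolding range_E by simp
    show "cayley g \<in> ext ` carrier (real_ops skew_ops)"
      if "g \<in> embed ` carrier isometry_group" "runit (1 + g)" for g
      using cayley_isometry_skew that unfolding range_E by simp
  qed
  have "subtopology (norm_topology (op_space V)) isometries = pullback_topology isometries embed euclidean"
    unfolding topology_eq
  proof (intro allI iffI)
    fix U
    assume "openin (subtopology (norm_topology (op_space V)) isometries) U"
    then obtain Q where Q: "open Q" "U = ext -` Q \<inter> isometries"
      using sub by (auto simp: openin_subtopology norm_topology_op_space openin_pullback_topology)
    have "open ((\<lambda>R. R - (1 - endo_of P)) -` Q)" using Q by (intro open_vimage continuous_intros)
    moreover have "U = embed -` ((\<lambda>R. R - (1 - endo_of P)) -` Q) \<inter> isometries"
      using Q by (auto simp: embed_def)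
    ultimately show "openin (pullback_topology isometries embed euclidean) U"
      by (auto simp: openin_pullback_topology)
  next
    fix U
    assume "openin (pullback_topology isometries embed euclidean) U"
    then obtain Q where Q: "open Q" "U = embed -` Q \<inter> isometries"
      by (auto simp: openin_pullback_topology)
    have "open ((\<lambda>R. R + (1 - endo_of P)) -` Q)" using Q by (intro open_vimage continuous_intros)
    moreover have "U = (ext -` ((\<lambda>R. R + (1 - endo_of P)) -` Q) \<inter> bounded_ops V) \<inter> isometries"
      using Q sub by (auto simp: embed_def)
    ultimately show "openin (subtopology (norm_topology (op_space V)) isometries) U"
      unfolding openin_subtopology norm_topology_op_space openin_pullback_topology by auto
  qed
  then show ?thesis using real_banach_lie_group by simp
qed

end

section \<open>Bump functions\<close>

text \<open>
  The functions \<open>t\<^sup>-\<^sup>k e\<^sup>-\<^sup>1\<^sup>/\<^sup>t\<close>, extended by zero. Differentiation maps each of them to a combination of two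
  others, so the whole family is smooth once it is differentiable.
\<close>

definition flat :: "nat \<Rightarrow> real \<Rightarrow> real" where
  "flat k t = (if t > 0 then inverse t ^ k * exp (- inverse t) else 0)"

lemma flat_tendsto_0: "(flat k \<longlongrightarrow> 0) (at_right 0)"
proof -
  have "((\<lambda>u. u ^ k / exp u) \<longlongrightarrow> 0) (at_top :: real filter)" by (rule tendsto_power_div_exp_0)
  then have "((\<lambda>t. inverse t ^ k / exp (inverse t)) \<longlongrightarrow> 0) (at_right (0::real))"
    using filterlim_inverse_at_top_right by (rule filterlim_compose)
  then show ?thesis
    by (rule Lim_transform_eventually)
      (auto simp: flat_def exp_minus field_simps eventually_at_filter)
qed

text \<open>
  At zero the difference quotient of one such function is the next one, which tends to zero.
\<close>

lemma flat_derivative: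
  "(flat k has_real_derivative (flat (k + 2) t - real k * flat (k + 1) t)) (at t)"
proof (cases t "0::real" rule: linorder_cases)
  case less
  have "((\<lambda>t. 0) has_real_derivative 0) (at t)" by simp
  moreover have "\<forall>\<^sub>F s in nhds t. 0 = flat k s"
    using eventually_nhds_in_open[of "{..<0}" t] less by (auto simp: flat_def elim: eventually_mono)
  ultimately have "(flat k has_real_derivative 0) (at t)"
    using DERIV_cong_ev[of t t "\<lambda>t. 0" "flat k" 0 0] by simp
  then show ?thesis using less by (simp add: flat_def)
next
  case equal
  have "((\<lambda>h. flat k h / h) \<longlongrightarrow> 0) (at_right 0)"
    using flat_tendsto_0[of "k + 1"]
    by (rule Lim_transform_eventually) (auto simp: flat_def field_simps eventually_at_filter)
  (* To the left of 0 the quotient is constantly 0. *)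
  moreover have "((\<lambda>h. flat k h / h) \<longlongrightarrow> 0) (at_left 0)"
    by (rule Lim_transform_eventually[OF tendsto_const]) (auto simp: flat_def eventually_at_filter)
  ultimately have "((\<lambda>h. flat k h / h) \<longlongrightarrow> 0) (at 0)" by (rule filterlim_split_at[rotated])
  then show ?thesis using equal by (simp add: DERIV_def flat_def)
next
  case greater
  have "((\<lambda>t. inverse t ^ k * exp (- inverse t)) has_real_derivative
      (inverse t ^ (k + 2) * exp (- inverse t) - real k * (inverse t ^ (k + 1) * exp (- inverse t)))) (at t)"
  proof (cases k)
    case 0
    then show ?thesis using greater
      by (auto intro!: derivative_eq_intros simp: field_simps power2_eq_square)
  next
    case (Suc m)
    have "((\<lambda>t. inverse t ^ Suc m) has_real_derivative
        (1 + real m) * (- (inverse t ^ Suc (Suc 0)) * inverse t ^ m)) (at t)"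
      by (rule DERIV_power_Suc, rule DERIV_inverse) (use greater in simp)
    moreover have "((\<lambda>t. exp (- inverse t)) has_real_derivative exp (- inverse t) * (inverse t)\<^sup>2) (at t)"
      using greater by (auto intro!: derivative_eq_intros simp: power2_eq_square)
    ultimately show ?thesis unfolding Suc
      by (rule DERIV_cong[OF DERIV_mult]) (simp add: algebra_simps power2_eq_square)
  qed
  moreover have ev: "\<forall>\<^sub>F s in nhds t. inverse s ^ k * exp (- inverse s) = flat k s"
    using eventually_nhds_in_open[of "{0<..}" t] greater by (auto simp: flat_def elim: eventually_mono)
  ultimately have "(flat k has_real_derivative
      (inverse t ^ (k + 2) * exp (- inverse t) - real k * (inverse t ^ (k + 1) * exp (- inverse t)))) (at t)"
    using iffD1[OF DERIV_cong_ev[OF refl ev refl]] by blast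
  then show ?thesis using greater by (simp add: flat_def)
qed

lemma flat_0_bounds: "0 \<le> flat 0 t" "flat 0 t \<le> 1"
  by (auto simp: flat_def)

lemma flat_0_tendsto: "(\<lambda>m. flat 0 (real m * c)) \<longlonglongrightarrow> (if c > 0 then 1 else 0)"
proof (cases "c > 0")
  case True
  have "filterlim (\<lambda>m. real m * c) at_top sequentially"
    using filterlim_tendsto_pos_mult_at_top[OF tendsto_const True filterlim_real_sequentially]
    by (simp add: mult.commute)
  then have "(\<lambda>m. exp (- inverse (real m * c))) \<longlonglongrightarrow> exp (- 0)"
    by (intro tendsto_exp tendsto_minus tendsto_inverse_0_at_top)
  then have "(\<lambda>m. flat 0 (real m * c)) \<longlonglongrightarrow> exp (- 0)"
    by (rule Lim_transform_eventually)
      (use True in \<open>auto simp: flat_def intro!: eventually_sequentiallyI[of 1]\<close>)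
  then show ?thesis using True by simp
next
  case False
  then have "flat 0 (real m * c) = 0" for m by (simp add: flat_def zero_less_mult_iff)
  then show ?thesis using False by simp
qed

lemma C_k_Suc_imp: "C_k (Suc k) f \<Longrightarrow> C_k k f"
proof (induction k arbitrary: f)
  case 0
  then show ?case
    by (auto intro!: continuous_at_imp_continuous_on differentiable_imp_continuous_within)
qed auto

lemma partial_deriv_unique: "(f has_derivative f') (at x) \<Longrightarrow> partial_deriv i f x = f' (axis i 1)"
  by (metis frechet_derivative_at partial_deriv_def)

lemma differentiable_has_derivative:
  "f differentiable (at x) \<Longrightarrow> (f has_derivative frechet_derivative f (at x)) (at x)"
  by (simp add: frechet_derivative_works)

lemma C_k_const: "C_k k (\<lambda>x :: real ^ 'n::finite. c)"
proof (induction k arbitrary: c)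
  case (Suc k)
  have "partial_deriv i (\<lambda>x :: real ^ 'n. c) = (\<lambda>x. 0)" for i :: 'n
    by (rule ext) (simp add: partial_deriv_unique[OF has_derivative_const])
  then show ?case using Suc[of 0] by simp
qed simp

lemma C_k_add: "C_k k f \<Longrightarrow> C_k k g \<Longrightarrow> C_k k (\<lambda>x. f x + g x)"
proof (induction k arbitrary: f g)
  case (Suc k)
  have "partial_deriv i (\<lambda>x. f x + g x) = (\<lambda>x. partial_deriv i f x + partial_deriv i g x)" for i
  proof
    fix x
    have "f differentiable (at x)" "g differentiable (at x)" using Suc.prems by auto
    note d = has_derivative_add[OF this[THEN differentiable_has_derivative]]
    show "partial_deriv i (\<lambda>x. f x + g x) x = partial_deriv i f x + partial_deriv i g x"
      unfolding partial_deriv_unique[OF d] by (simp add: partial_deriv_def)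
  qed
  then show ?case using Suc by (auto intro!: differentiable_add)
qed (auto intro!: continuous_intros)

lemma C_k_mult: "C_k k f \<Longrightarrow> C_k k g \<Longrightarrow> C_k k (\<lambda>x. f x * g x)"
proof (induction k arbitrary: f g)
  case (Suc k)
  have "partial_deriv i (\<lambda>x. f x * g x) = (\<lambda>x. f x * partial_deriv i g x + partial_deriv i f x * g x)" for i
  proof
    fix x
    have "f differentiable (at x)" "g differentiable (at x)" using Suc.prems by auto
    note d = has_derivative_mult[OF this[THEN differentiable_has_derivative]]
    show "partial_deriv i (\<lambda>x. f x * g x) x = f x * partial_deriv i g x + partial_deriv i f x * g x"
      unfolding partial_deriv_unique[OF d] by (simp add: partial_deriv_def)
  qed
  moreover have "C_k k f" "C_k k g" using Suc.prems C_k_Suc_imp by blast+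
  ultimately show ?case using Suc by (auto intro!: differentiable_mult C_k_add)
qed (auto intro!: continuous_intros)

lemma C_k_prod: "(\<And>i. i \<in> I \<Longrightarrow> C_k k (f i)) \<Longrightarrow> C_k k (\<lambda>x. \<Prod>i\<in>I. f i x)"
  by (induction I rule: infinite_finite_induct) (auto intro: C_k_const C_k_mult)

text \<open>
  By induction on the order for all \<open>j\<close> simultaneously, since each derivative involves \<open>j + 1\<close> and \<open>j + 2\<close>.
\<close>

lemma C_k_flat: "C_k k (\<lambda>x. complex_of_real (flat j (\<alpha> * x $ i + \<beta>)))"
proof (induction k arbitrary: j)
  case 0
  have "isCont (flat j) t" for t using flat_derivative DERIV_isCont by blast
  then have "continuous_on UNIV (flat j)" by (simp add: continuous_at_imp_continuous_on)
  then have "continuous_on UNIV (\<lambda>x. flat j (\<alpha> * x $ i + \<beta>))"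
    by (rule continuous_on_compose2) (auto intro!: continuous_intros)
  then show ?case by (auto intro!: continuous_intros)
next
  case (Suc k)
  let ?d = "\<lambda>x. flat (j + 2) (\<alpha> * x $ i + \<beta>) - real j * flat (j + 1) (\<alpha> * x $ i + \<beta>)"
  have der: "((\<lambda>x. complex_of_real (flat j (\<alpha> * x $ i + \<beta>))) has_derivative
      (\<lambda>h. complex_of_real (?d x * (\<alpha> * h $ i)))) (at x)" for x
  proof -
    have "((\<lambda>x. \<alpha> * x $ i + \<beta>) has_derivative (\<lambda>h. \<alpha> * h $ i)) (at x)"
      by (auto intro!: derivative_eq_intros bounded_linear_imp_has_derivative bounded_linear_vec_nth)
    moreover have "(flat j has_derivative (\<lambda>h. ?d x * h)) (at (\<alpha> * x $ i + \<beta>))"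
      using flat_derivative[of j "\<alpha> * x $ i + \<beta>"] by (simp add: has_field_derivative_def)
    ultimately have "((\<lambda>x. flat j (\<alpha> * x $ i + \<beta>)) has_derivative (\<lambda>h. ?d x * (\<alpha> * h $ i))) (at x)"
      by (rule has_derivative_compose)
    then show ?thesis by (rule has_derivative_of_real)
  qed
  have "partial_deriv l (\<lambda>x. complex_of_real (flat j (\<alpha> * x $ i + \<beta>)))
      = (\<lambda>x. complex_of_real (if l = i then \<alpha> else 0) * (complex_of_real (flat (j + 2) (\<alpha> * x $ i + \<beta>))
          + complex_of_real (- real j) * complex_of_real (flat (j + 1) (\<alpha> * x $ i + \<beta>))))" for l
    by (rule ext) (auto simp: partial_deriv_unique[OF der] axis_def)
  moreover have "C_k k (\<lambda>x. complex_of_real (if l = i then \<alpha> else 0) * (complex_of_real (flat (j + 2) (\<alpha> * x $ i + \<beta>))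
          + complex_of_real (- real j) * complex_of_real (flat (j + 1) (\<alpha> * x $ i + \<beta>))))" for l
    by (intro C_k_mult C_k_add C_k_const Suc.IH)
  ultimately show ?case using der by (auto simp: differentiable_def)
qed

text \<open>
  A smooth function supported in a box; as \<open>m\<close> grows, it converges to the indicator function of the
  box.
\<close>

definition bump :: "real ^ 'n \<Rightarrow> real ^ 'n \<Rightarrow> nat \<Rightarrow> real ^ 'n \<Rightarrow> real" where
  "bump a b m x = (\<Prod>i\<in>UNIV. flat 0 (real m * (x $ i - a $ i)) * flat 0 (real m * (b $ i - x $ i)))"

lemma bump_bounds: "0 \<le> bump a b m x" "bump a b m x \<le> 1"
  unfolding bump_def using flat_0_bounds by (auto intro!: prod_nonneg prod_le_1 mult_le_one)

lemma bump_support: "bump a b m x \<noteq> 0 \<Longrightarrow> x \<in> box a b"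
  by (auto simp: bump_def mem_box_cart flat_def zero_less_mult_iff split: if_splits)

lemma bump_tendsto: "(\<lambda>m. bump a b m x) \<longlonglongrightarrow> indicator (box a b) x"
proof -
  have "(\<lambda>m. bump a b m x) \<longlonglongrightarrow>
      (\<Prod>i\<in>UNIV. (if x $ i - a $ i > 0 then 1 else 0) * (if b $ i - x $ i > 0 then 1 else 0))"
    unfolding bump_def by (intro tendsto_prod tendsto_mult flat_0_tendsto)
  also have "(\<Prod>i\<in>UNIV. (if x $ i - a $ i > 0 then 1 else 0) * (if b $ i - x $ i > 0 then 1 else 0))
      = (indicator (box a b) x :: real)"
    by (auto simp: indicator_def mem_box_cart)
  finally show ?thesis .
qed

lemma bump_test_fun:
  assumes "cbox a b \<subseteq> \<Omega>" shows "(\<lambda>x. complex_of_real (bump a b m x)) \<in> test_funs \<Omega>"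
proof -
  have eq: "(\<lambda>x. complex_of_real (bump a b m x)) = (\<lambda>x. \<Prod>i\<in>UNIV.
      complex_of_real (flat 0 (real m * x $ i + - (real m * a $ i)))
      * complex_of_real (flat 0 (- real m * x $ i + real m * b $ i)))"
    by (simp add: bump_def algebra_simps)
  have "C_k k (\<lambda>x. complex_of_real (bump a b m x))" for k
    unfolding eq by (intro C_k_prod C_k_mult C_k_flat)
  moreover have cl: "closure {x. complex_of_real (bump a b m x) \<noteq> 0} \<subseteq> cbox a b"
    using bump_support box_subset_cbox by (intro closure_minimal closed_cbox) fastforce
  moreover have "compact (closure {x. complex_of_real (bump a b m x) \<noteq> 0})"
    using bounded_subset[OF bounded_cbox cl] by (simp add: compact_eq_bounded_closed)
  ultimately show ?thesis using assms by (auto simp: test_funs_def)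
qed

section \<open>The fundamental lemma of the calculus of variations\<close>

lemma sigma_finite_lebesgue: "sigma_finite_measure (lebesgue :: 'a::euclidean_space measure)"
proof
  obtain A :: "'a set set" where "countable A" "A \<subseteq> sets lborel" "\<Union>A = space lborel"
    "\<forall>a\<in>A. emeasure lborel a \<noteq> \<infinity>"
    using lborel.sigma_finite_countable by blast
  then show "\<exists>A. countable A \<and> A \<subseteq> sets (lebesgue :: 'a measure) \<and> \<Union>A = space lebesgue
      \<and> (\<forall>a\<in>A. emeasure lebesgue a \<noteq> \<infinity>)"
    by (intro exI[of _ A]) auto
qed

text \<open>
  The sets over which the integral of \<open>f\<close> vanishes form a Dynkin system, and the boxes are a generator of
  the Borel sets that is stable under intersections. Lebesgue sets differ from Borel sets by null sets.
\<close>

lemma set_integral_box_zero_imp_AE: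
  fixes f :: "'a::euclidean_space \<Rightarrow> complex"
  assumes f: "integrable lebesgue f" and total: "integral\<^sup>L lebesgue f = 0"
    and box: "\<And>c d. (LINT x|lebesgue. indicator (box c d) x *\<^sub>R f x) = 0"
  shows "AE x in lebesgue. f x = 0"
proof (rule sigma_finite_measure.density_zero[OF sigma_finite_lebesgue f])
  have f_ind: "integrable lebesgue (\<lambda>x. indicator A x *\<^sub>R f x)" if "A \<in> sets lebesgue" for A
    using integrable_mult_indicator[OF that f] .
  have borel: "(LINT x|lebesgue. indicator A x *\<^sub>R f x) = 0" if "A \<in> sets borel" for A
  proof -
    have A: "A \<in> sigma_sets UNIV (range (\<lambda>(a, b). box a b :: 'a set))"
      using that by (simp add: borel_eq_box)
    have st: "Int_stable (range (\<lambda>(a, b). box a b :: 'a set))"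
      by (auto simp: Int_stable_def box_Int_box)
    have pw: "range (\<lambda>(a, b). box a b :: 'a set) \<subseteq> Pow UNIV" by simp
    have sets: "S \<in> sets borel" if "S \<in> sigma_sets UNIV (range (\<lambda>(a, b). box a b :: 'a set))" for S
      using that by (simp add: borel_eq_box)
    show ?thesis
      using st pw A
    proof (induction rule: sigma_sets_induct_disjoint[where \<Omega> = UNIV])
      case (basic A)
      then show ?case using box by auto
    next
      case empty
      then show ?case by simp
    next
      case (compl A)
      have "indicator (UNIV - A) x *\<^sub>R f x = f x - indicator A x *\<^sub>R f x" for x
        by (auto simp: indicator_def)
      then show ?case using compl f f_ind[of A] total sets[of A] by simp
    next
      case (union A)
      have A: "A i \<in> sets lebesgue" for i using union sets by (simp add: image_subset_iff)
      have "(LINT x:(\<Union>i. A i)|lebesgue. f x) = (\<Sum>i. (LINT x:(A i)|lebesgue. f x))"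
      proof (rule lebesgue_integral_countable_add)
        show "set_integrable lebesgue (\<Union>i. A i) f"
          unfolding set_integrable_def by (rule f_ind) (use A in auto)
      qed (use A union(1) in \<open>auto simp: disjoint_family_on_def\<close>)
      then show ?case using union by (simp add: set_lebesgue_integral_def)
    qed
  qed
  fix A :: "'a set" assume A: "A \<in> sets lebesgue"
  then obtain S N N' where S: "A = S \<union> N" "N \<subseteq> N'" "N' \<in> null_sets lborel" "S \<in> sets lborel"
    by (auto elim: sets_completionE)
  have S': "S \<in> sets lebesgue" using S(4) by simp
  have "N' \<in> null_sets lebesgue" using S(3) by (rule null_sets_completionI)
  then have "AE x in lebesgue. x \<notin> N'" by (rule AE_not_in)
  then have "AE x in lebesgue. indicator A x *\<^sub>R f x = indicator S x *\<^sub>R f x"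
    by eventually_elim (use S in \<open>auto simp: indicator_def\<close>)
  then have "(LINT x|lebesgue. indicator A x *\<^sub>R f x) = (LINT x|lebesgue. indicator S x *\<^sub>R f x)"
    using A S' f by (intro integral_cong_AE) (auto intro!: borel_measurable_integrable f_ind)
  also have "\<dots> = 0" using borel S(4) by simp
  finally show "set_lebesgue_integral lebesgue A f = 0" by (simp add: set_lebesgue_integral_def)
qed

text \<open>
  Bump functions converge boundedly to indicator functions of boxes, so the integral of \<open>D\<close> over every
  box with closure in \<open>\<Omega>\<close> vanishes, and countably many such boxes cover \<open>\<Omega>\<close>.
\<close>

lemma fundamental_lemma:
  fixes \<Omega> :: "(real ^ 'n) set" and D :: "real ^ 'n \<Rightarrow> complex"
  assumes \<Omega>: "open \<Omega>" and D: "D \<in> L2_fun \<Omega>"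
    and zero: "\<And>\<phi>. \<phi> \<in> test_funs \<Omega> \<Longrightarrow> (LINT x|lebesgue_on \<Omega>. D x * \<phi> x) = 0"
  shows "AE x in lebesgue_on \<Omega>. D x = 0"
proof -
  define E where "E = (\<lambda>x. indicator \<Omega> x *\<^sub>R D x)"
  have \<Omega>_sets: "\<Omega> \<inter> space lebesgue \<in> sets lebesgue" "\<Omega> \<in> sets lebesgue" using \<Omega> by auto
  have E_meas [measurable]: "E \<in> borel_measurable lebesgue"
    using D by (simp add: L2_fun_def E_def borel_measurable_restrict_space_iff \<Omega>_sets)
  have "integrable lebesgue (\<lambda>x. indicator \<Omega> x *\<^sub>R (norm (D x))\<^sup>2)"
    using D by (simp add: L2_fun_def integrable_restrict_space \<Omega>_sets)
  also have "(\<lambda>x. indicator \<Omega> x *\<^sub>R (norm (D x))\<^sup>2) = (\<lambda>x. (norm (E x))\<^sup>2)"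
    by (auto simp: E_def indicator_def)
  finally have E2: "integrable lebesgue (\<lambda>x. (norm (E x))\<^sup>2)" .
  have E_box: "integrable lebesgue (\<lambda>x. indicator (box a b) x *\<^sub>R E x)" for a b
  proof (rule Bochner_Integration.integrable_bound)
    have "integrable lebesgue (indicator (box a b) :: real ^ 'n \<Rightarrow> real)"
      by (auto simp: integrable_indicator_iff emeasure_lborel_box_eq)
    then show "integrable lebesgue (\<lambda>x. indicator (box a b) x + (norm (E x))\<^sup>2 :: real)"
      using E2 by (intro Bochner_Integration.integrable_add)
    have "norm (indicator (box a b) x *\<^sub>R E x) \<le> norm (indicator (box a b) x + (norm (E x))\<^sup>2 :: real)" for x
    proof -
      have "0 \<le> (norm (E x) - 1)\<^sup>2" by simp
      then have "2 * norm (E x) \<le> (norm (E x))\<^sup>2 + 1" unfolding power2_diff by simp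
      then have "norm (E x) \<le> 1 + (norm (E x))\<^sup>2"
        using norm_ge_zero[of "E x"] by linarith
      then show ?thesis by (auto simp: indicator_def)
    qed
    then show "AE x in lebesgue. norm (indicator (box a b) x *\<^sub>R E x) \<le> norm (indicator (box a b) x + (norm (E x))\<^sup>2 :: real)"
      by auto
    show "(\<lambda>x. indicator (box a b) x *\<^sub>R E x) \<in> borel_measurable lebesgue"
      by (intro borel_measurable_scaleR borel_measurable_indicator E_meas) simp
  qed
  have box_zero: "(LINT x|lebesgue. indicator (box a b) x *\<^sub>R E x) = 0" if ab: "cbox a b \<subseteq> \<Omega>" for a b
  proof -
    let ?F = "\<lambda>m x. E x * complex_of_real (bump a b m x)"
    have [measurable]: "(\<lambda>x. complex_of_real (bump a b m x)) \<in> borel_measurable lebesgue" for m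
    proof -
      have "C_k 0 (\<lambda>x. complex_of_real (bump a b m x))"
        using bump_test_fun[OF ab, of m] unfolding test_funs_def by blast
      then have "continuous_on UNIV (\<lambda>x. complex_of_real (bump a b m x))" by (simp only: C_k.simps)
      then have "(\<lambda>x. complex_of_real (bump a b m x)) \<in> borel_measurable borel"
        by (rule borel_measurable_continuous_onI)
      then have "(\<lambda>x. complex_of_real (bump a b m x)) \<in> borel_measurable lborel"
        by (simp only: measurable_lborel1 measurable_lborel2)
      then show ?thesis by (rule measurable_completion)
    qed
    have lim: "(\<lambda>m. LINT x|lebesgue. ?F m x) \<longlonglongrightarrow> (LINT x|lebesgue. indicator (box a b) x *\<^sub>R E x)"
    proof (rule integral_dominated_convergence)
      show "integrable lebesgue (\<lambda>x. norm (indicator (box a b) x *\<^sub>R E x))"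
        by (intro integrable_norm E_box)
      show "AE x in lebesgue. (\<lambda>m. ?F m x) \<longlonglongrightarrow> indicator (box a b) x *\<^sub>R E x"
      proof (rule AE_I2)
        fix x
        have "(\<lambda>m. E x * complex_of_real (bump a b m x)) \<longlonglongrightarrow> E x * complex_of_real (indicator (box a b) x)"
          by (intro tendsto_intros bump_tendsto)
        then show "(\<lambda>m. ?F m x) \<longlonglongrightarrow> indicator (box a b) x *\<^sub>R E x"
          by (simp add: scaleR_conv_of_real mult.commute)
      qed
      show "AE x in lebesgue. norm (?F m x) \<le> norm (indicator (box a b) x *\<^sub>R E x)" for m
      proof (rule AE_I2)
        fix x
        show "norm (?F m x) \<le> norm (indicator (box a b) x *\<^sub>R E x)"
        proof (cases "x \<in> box a b")
          case True
          then show ?thesis using bump_bounds[of a b m x] by (simp add: norm_mult mult_left_le)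
        next
          case False
          then have "bump a b m x = 0" using bump_support by blast
          then show ?thesis by simp
        qed
      qed
      show "(\<lambda>x. indicator (box a b) x *\<^sub>R E x) \<in> borel_measurable lebesgue"
        using E_box by (rule borel_measurable_integrable)
    qed measurable
    have "(LINT x|lebesgue. ?F m x) = 0" for m
    proof -
      have "(LINT x|lebesgue_on \<Omega>. D x * complex_of_real (bump a b m x)) = 0"
        by (intro zero bump_test_fun ab)
      then show ?thesis by (simp add: integral_restrict_space \<Omega>_sets E_def)
    qed
    with lim show ?thesis by (simp add: LIMSEQ_const_iff)
  qed
  have cbox_AE: "AE x in lebesgue. x \<in> cbox a b \<longrightarrow> E x = 0" if ab: "cbox a b \<subseteq> \<Omega>" for a b
  proof -
    have "AE x in lebesgue. indicator (box a b) x *\<^sub>R E x = 0"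
    proof (rule set_integral_box_zero_imp_AE[OF E_box box_zero[OF ab]])
      fix c d
      (* The closure of a nonempty intersection of boxes is again a closed box inside the domain. *)
    obtain a' b' where i: "box a b \<inter> box c d = box a' b'" using box_Int_box by blast
      show "(LINT x|lebesgue. indicator (box c d) x *\<^sub>R (indicator (box a b) x *\<^sub>R E x)) = 0"
      proof (cases "box a' b' = {}")
        case True
        then have eq: "indicator (box c d) x *\<^sub>R (indicator (box a b) x *\<^sub>R E x) = 0" for x
          using i by (auto simp: indicator_def)
        show ?thesis unfolding eq by simp
      next
        case False
        have "closure (box a' b') \<subseteq> closure (box a b)" using i by (intro closure_mono) blast
        then have "cbox a' b' \<subseteq> \<Omega>"
          using False ab closure_mono[OF box_subset_cbox, of a b] by (simp add: closure_box) 
        from box_zero[OF this] show ?thesis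
          unfolding i[symmetric] by (simp add: indicator_inter_arith mult.commute)
      qed
    qed
    moreover have "AE x in lebesgue. x \<notin> cbox a b - box a b"
      using negligible_frontier_interval[of a b] by (intro AE_not_in) (simp add: negligible_iff_null_sets)
    ultimately show ?thesis by eventually_elim auto
  qed
  obtain \<D> where \<D>: "countable \<D>" "\<D> \<subseteq> Pow \<Omega>" "\<And>X. X \<in> \<D> \<Longrightarrow> \<exists>a b. X = cbox a b" "\<Union>\<D> = \<Omega>"
    using open_countable_Union_open_cbox[OF \<Omega>] by blast
  have "AE x in lebesgue. \<forall>X\<in>\<D>. x \<in> X \<longrightarrow> E x = 0"
    using \<D> cbox_AE by (subst AE_ball_countable) (auto, blast)
  then have "AE x in lebesgue. x \<in> \<Omega> \<longrightarrow> D x = 0"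
  proof eventually_elim
    case (elim x)
    show ?case
    proof
      assume x: "x \<in> \<Omega>"
      then have "E x = 0" using elim \<D>(4) by blast
      then show "D x = 0" using x by (simp add: E_def)
    qed
  qed
  then show ?thesis by (simp add: AE_restrict_space_iff \<Omega>_sets)
qed

section \<open>Multiplication operators on square integrable functions\<close>

lift_definition cscale :: "complex \<Rightarrow> ('a::euclidean_space, complex) l2 \<Rightarrow> ('a, complex) l2" is "\<lambda>a f x. a * f x"
  by (auto simp: l2_rel_def square_integrable_def norm_mult power_mult_distrib)

lemma square_integrable_cut:
  fixes f :: "'a::euclidean_space \<Rightarrow> complex"
  assumes "square_integrable f" shows "square_integrable (\<lambda>x. indicator (interior \<Omega>) x *\<^sub>R f x)"
proof -
  have eq: "(norm (indicator (interior \<Omega>) x *\<^sub>R f x))\<^sup>2 = indicator (interior \<Omega>) x *\<^sub>R (norm (f x))\<^sup>2" for x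
    by (auto simp: indicator_def)
  have "interior \<Omega> \<in> sets lebesgue" by simp
  then have "integrable lebesgue (\<lambda>x. indicator (interior \<Omega>) x *\<^sub>R (norm (f x))\<^sup>2)"
    using assms by (intro integrable_mult_indicator) (auto simp: square_integrable_def)
  then show ?thesis using assms unfolding square_integrable_def eq
    by (auto intro!: borel_measurable_scaleR borel_measurable_indicator)
qed

text \<open>
  Restriction to an open set; the interior makes the indicator function measurable for every
  \<open>\<Omega>\<close>.
\<close>

lift_definition cut :: "'a set \<Rightarrow> ('a::euclidean_space, complex) l2 \<Rightarrow> ('a, complex) l2"
  is "\<lambda>\<Omega> f x. indicator (interior \<Omega>) x *\<^sub>R f x"
  by (auto simp: l2_rel_def square_integrable_cut)

lemma cscale_laws:
  "cscale a (u + v) = cscale a u + cscale a v" "cscale (a + b) u = cscale a u + cscale b u"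
  "cscale (a * b) u = cscale a (cscale b u)" "cscale 1 u = u" "cscale (of_real r) u = r *\<^sub>R u"
proof -
  note sq = square_integrable_add
  have sc: "square_integrable (\<lambda>x. a * f x)" if "square_integrable f" for a and f :: "'a \<Rightarrow> complex"
    using that by (auto simp: square_integrable_def norm_mult power_mult_distrib)
  show "cscale a (u + v) = cscale a u + cscale a v" by transfer (auto simp: l2_rel_def sq sc distrib_left)
  show "cscale (a + b) u = cscale a u + cscale b u" by transfer (auto simp: l2_rel_def sq sc distrib_right)
  show "cscale (a * b) u = cscale a (cscale b u)" by transfer (auto simp: l2_rel_def sc mult.assoc)
  show "cscale 1 u = u" by transfer (auto simp: l2_rel_def)
  show "cscale (of_real r) u = r *\<^sub>R u"
    by transfer (auto simp: l2_rel_def sc square_integrable_scaleR scaleR_conv_of_real)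
qed

lemma inner_complex_mult: "(a * z) \<bullet> w = z \<bullet> (cnj a * (w :: complex))"
  by (simp add: inner_complex_def algebra_simps)

lemma cscale_inner: "cscale a u \<bullet> v = u \<bullet> cscale (cnj a) v"
  by transfer (simp add: inner_complex_mult)

lemma norm_cscale: "norm (cscale a u) = norm a * norm u"
proof -
  have "cscale a u \<bullet> cscale a u = (cmod a)\<^sup>2 * (u \<bullet> u)"
  proof transfer
    fix a :: complex and u :: "'a \<Rightarrow> complex"
    have "(a * u x) \<bullet> (a * u x) = (cmod a)\<^sup>2 * (u x \<bullet> u x)" for x
      by (simp add: norm_mult power_mult_distrib flip: power2_norm_eq_inner)
    then show "(LINT x|lebesgue. (a * u x) \<bullet> (a * u x)) = (cmod a)\<^sup>2 * (LINT x|lebesgue. u x \<bullet> u x)"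
      by simp
  qed
  then show ?thesis by (simp add: norm_eq_sqrt_inner real_sqrt_mult)
qed

lemma bounded_linear_cut: "bounded_linear (cut \<Omega>)"
proof (rule bounded_linear_intro[of _ 1])
  note sq = square_integrable_cut
  show "cut \<Omega> (u + v) = cut \<Omega> u + cut \<Omega> v" for u v
    by transfer (auto simp: l2_rel_def sq square_integrable_add scaleR_add_right)
  show "cut \<Omega> (r *\<^sub>R u) = r *\<^sub>R cut \<Omega> u" for r u
  proof transfer
    fix \<Omega> r and u :: "'a \<Rightarrow> complex" assume "l2_rel u u"
    then have "square_integrable (\<lambda>x. r *\<^sub>R indicator (interior \<Omega>) x *\<^sub>R u x)"
      by (intro square_integrable_scaleR sq) simp
    then show "l2_rel (\<lambda>x. indicator (interior \<Omega>) x *\<^sub>R r *\<^sub>R u x) (\<lambda>x. r *\<^sub>R indicator (interior \<Omega>) x *\<^sub>R u x)"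
      by (simp add: mult.commute)
  qed
  show "norm (cut \<Omega> u) \<le> norm u * 1" for u
  proof -
    have "cut \<Omega> u \<bullet> cut \<Omega> u \<le> u \<bullet> u"
    proof transfer
      fix \<Omega> and u :: "'a \<Rightarrow> complex" assume u: "l2_rel u u"
      have s: "square_integrable (\<lambda>x. indicator (interior \<Omega>) x *\<^sub>R u x)"
        using u by (simp add: square_integrable_cut)
      show "(LINT x|lebesgue. (indicator (interior \<Omega>) x *\<^sub>R u x) \<bullet> (indicator (interior \<Omega>) x *\<^sub>R u x))
          \<le> (LINT x|lebesgue. u x \<bullet> u x)"
      proof (rule integral_mono)
        show "integrable lebesgue (\<lambda>x. (indicator (interior \<Omega>) x *\<^sub>R u x) \<bullet> (indicator (interior \<Omega>) x *\<^sub>R u x))"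
          by (rule integrable_inner[OF s s])
        show "integrable lebesgue (\<lambda>x. u x \<bullet> u x)" using u by (intro integrable_inner) auto
      qed (auto simp: indicator_def)
    qed
    then show ?thesis by (simp add: norm_eq_sqrt_inner)
  qed
qed

section \<open>The classes of square integrable functions on an open set\<close>

locale open_domain =
  fixes \<Omega> :: "(real ^ 'n) set"
  assumes open_\<Omega>: "open \<Omega>"
begin

abbreviation ind :: "real ^ 'n \<Rightarrow> real" where "ind \<equiv> indicator \<Omega>"

lemma \<Omega>_sets: "\<Omega> \<inter> space lebesgue \<in> sets lebesgue" "\<Omega> \<in> sets lebesgue" using open_\<Omega> by auto

lemma integral_on: "(LINT x|lebesgue_on \<Omega>. f x) = (LINT x|lebesgue. ind x *\<^sub>R f x)"
  for f :: "real ^ 'n \<Rightarrow> 'b::{banach, second_countable_topology}"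
  by (rule integral_restrict_space[OF \<Omega>_sets(1)])

lemma AE_on: "(AE x in lebesgue_on \<Omega>. P x) \<longleftrightarrow> (AE x in lebesgue. x \<in> \<Omega> \<longrightarrow> P x)"
  by (rule AE_restrict_space_iff[OF \<Omega>_sets(1)])

lemma L2_fun_iff: "f \<in> L2_fun \<Omega> \<longleftrightarrow> square_integrable (\<lambda>x. ind x *\<^sub>R f x)"
proof -
  have "(\<lambda>x. ind x *\<^sub>R (norm (f x))\<^sup>2) = (\<lambda>x. (norm (ind x *\<^sub>R f x))\<^sup>2)"
    by (auto simp: indicator_def)
  then show ?thesis
    by (simp add: L2_fun_def square_integrable_def borel_measurable_restrict_space_iff \<Omega>_sets
        integrable_restrict_space del: norm_scaleR)
qed

lemma L2_fun_of_square_integrable: "square_integrable f \<Longrightarrow> f \<in> L2_fun \<Omega>"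
  using square_integrable_cut[of f \<Omega>] open_\<Omega>
  by (simp add: L2_fun_iff interior_open)

text \<open>
  Extension by zero identifies the classes on \<open>\<Omega>\<close> with the fixed points of \<open>cut \<Omega>\<close>.
\<close>

definition lift_fun :: "(real ^ 'n \<Rightarrow> complex) \<Rightarrow> (real ^ 'n, complex) l2" where
  "lift_fun f = abs_l2 (\<lambda>x. ind x *\<^sub>R f x)"

lemma lift_fun_eq_iff:
  assumes "f \<in> L2_fun \<Omega>" "g \<in> L2_fun \<Omega>"
  shows "lift_fun f = lift_fun g \<longleftrightarrow> (AE x in lebesgue_on \<Omega>. f x = g x)"
proof -
  have "(AE x in lebesgue. ind x *\<^sub>R f x = ind x *\<^sub>R g x) \<longleftrightarrow> (AE x in lebesgue. x \<in> \<Omega> \<longrightarrow> f x = g x)"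
    by (intro AE_cong) (auto simp: indicator_def)
  then show ?thesis using assms by (simp add: lift_fun_def abs_l2_eq_iff L2_fun_iff AE_on)
qed

lemma L2_fun_add: "f \<in> L2_fun \<Omega> \<Longrightarrow> g \<in> L2_fun \<Omega> \<Longrightarrow> (\<lambda>x. f x + g x) \<in> L2_fun \<Omega>"
  unfolding L2_fun_iff using square_integrable_add by (fastforce simp: scaleR_add_right)

lemma L2_fun_scale: "f \<in> L2_fun \<Omega> \<Longrightarrow> (\<lambda>x. a * f x) \<in> L2_fun \<Omega>"
  unfolding L2_fun_def by (auto simp: norm_mult power_mult_distrib)

lemma lift_fun_add:
  "f \<in> L2_fun \<Omega> \<Longrightarrow> g \<in> L2_fun \<Omega> \<Longrightarrow> lift_fun (\<lambda>x. f x + g x) = lift_fun f + lift_fun g"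
  by (simp add: lift_fun_def plus_l2.abs_eq L2_fun_iff scaleR_add_right)

lemma lift_fun_scale: "f \<in> L2_fun \<Omega> \<Longrightarrow> lift_fun (\<lambda>x. a * f x) = cscale a (lift_fun f)"
  by (simp add: lift_fun_def cscale.abs_eq L2_fun_iff mult_scaleR_right)

lemma cut_lift_fun: "f \<in> L2_fun \<Omega> \<Longrightarrow> cut \<Omega> (lift_fun f) = lift_fun f"
proof -
  assume "f \<in> L2_fun \<Omega>"
  moreover have "ind x *\<^sub>R (ind x *\<^sub>R f x) = ind x *\<^sub>R f x" for x by (simp add: indicator_def)
  ultimately show ?thesis using open_\<Omega> by (simp only: lift_fun_def cut.abs_eq L2_fun_iff l2_rel_refl interior_open)
qed

lemma lift_fun_rep: "cut \<Omega> w = w \<Longrightarrow> lift_fun (rep_l2 w) = w"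
  using open_\<Omega> cut.abs_eq[of "rep_l2 w" \<Omega>] by (simp add: rep_l2 abs_rep_l2 lift_fun_def interior_open)

text \<open>
  The real part of \<open>z \<cdot> cnj w\<close> is the real inner product of \<open>z\<close> and \<open>w\<close>, and its imaginary part is the
  real part of \<open>-\<i> z \<cdot> cnj w\<close>.
\<close>

lemma integral_mult_L2:
  assumes "f \<in> L2_fun \<Omega>" "g \<in> L2_fun \<Omega>"
  shows "integrable (lebesgue_on \<Omega>) (\<lambda>x. f x * cnj (g x))"
    and "Re (LINT x|lebesgue_on \<Omega>. f x * cnj (g x)) = lift_fun f \<bullet> lift_fun g"
    and "Im (LINT x|lebesgue_on \<Omega>. f x * cnj (g x)) = cscale (- \<i>) (lift_fun f) \<bullet> lift_fun g"
proof -
  have cnj_meas: "cnj \<in> borel_measurable borel" by (intro borel_measurable_continuous_onI continuous_intros)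
  have m: "f \<in> borel_measurable (lebesgue_on \<Omega>)" "g \<in> borel_measurable (lebesgue_on \<Omega>)"
    using assms by (auto simp: L2_fun_def)
  have i: "integrable (lebesgue_on \<Omega>) (\<lambda>x. (norm (f x))\<^sup>2 + (norm (g x))\<^sup>2)"
    using assms by (auto simp: L2_fun_def)
  show int: "integrable (lebesgue_on \<Omega>) (\<lambda>x. f x * cnj (g x))"
  proof (rule Bochner_Integration.integrable_bound[OF i])
    show "(\<lambda>x. f x * cnj (g x)) \<in> borel_measurable (lebesgue_on \<Omega>)"
      using m measurable_compose[OF m(2) cnj_meas] by (intro borel_measurable_times) (auto simp: comp_def)
    have "norm (f x * cnj (g x)) \<le> norm ((norm (f x))\<^sup>2 + (norm (g x))\<^sup>2)" for x
    proof -
      have "2 * (norm (f x) * norm (g x)) \<le> (norm (f x))\<^sup>2 + (norm (g x))\<^sup>2"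
        using sum_squares_bound[of "norm (f x)" "norm (g x)"] by (simp add: mult.assoc)
      moreover have "0 \<le> norm (f x) * norm (g x)" by simp
      ultimately show ?thesis unfolding norm_mult complex_mod_cnj real_norm_def by linarith
    qed
    then show "AE x in lebesgue_on \<Omega>. norm (f x * cnj (g x)) \<le> norm ((norm (f x))\<^sup>2 + (norm (g x))\<^sup>2)"
      by simp
  qed
  have inner: "lift_fun f' \<bullet> lift_fun g = (LINT x|lebesgue_on \<Omega>. f' x \<bullet> g x)" if "f' \<in> L2_fun \<Omega>" for f'
  proof -
    have eq: "ind x *\<^sub>R f' x \<bullet> ind x *\<^sub>R g x = ind x *\<^sub>R (f' x \<bullet> g x)" for x by (auto simp: indicator_def)
    have "lift_fun f' \<bullet> lift_fun g = (LINT x|lebesgue. ind x *\<^sub>R f' x \<bullet> ind x *\<^sub>R g x)"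
      unfolding lift_fun_def by (rule inner_l2.abs_eq) (use that assms(2) in \<open>simp_all add: L2_fun_iff\<close>)
    then show ?thesis unfolding integral_on by (simp only: eq)
  qed
  have "Re (f x * cnj (g x)) = f x \<bullet> g x" for x by (simp add: inner_complex_def)
  then show "Re (LINT x|lebesgue_on \<Omega>. f x * cnj (g x)) = lift_fun f \<bullet> lift_fun g"
    by (simp add: inner assms flip: integral_Re[OF int] del: times_complex.sel)
  have im: "Im (f x * cnj (g x)) = (- \<i> * f x) \<bullet> g x" for x by (simp add: inner_complex_def)
  have "Im (LINT x|lebesgue_on \<Omega>. f x * cnj (g x)) = (LINT x|lebesgue_on \<Omega>. Im (f x * cnj (g x)))"
    by (rule integral_Im[OF int, symmetric])
  also have "\<dots> = lift_fun (\<lambda>x. - \<i> * f x) \<bullet> lift_fun g"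
    unfolding im by (rule inner[OF L2_fun_scale[OF assms(1)], symmetric])
  also have "\<dots> = cscale (- \<i>) (lift_fun f) \<bullet> lift_fun g" by (simp only: lift_fun_scale[OF assms(1)])
  finally show "Im (LINT x|lebesgue_on \<Omega>. f x * cnj (g x)) = cscale (- \<i>) (lift_fun f) \<bullet> lift_fun g" .
qed

lemma equiv_ae: "equiv (L2_fun \<Omega>) (ae_rel \<Omega>)"
proof (rule equivI)
  show "refl_on (L2_fun \<Omega>) (ae_rel \<Omega>)" by (auto simp: refl_on_def ae_rel_def)
  show "sym (ae_rel \<Omega>)" by (auto simp: sym_def ae_rel_def)
  show "trans (ae_rel \<Omega>)" by (auto simp: trans_def ae_rel_def)
  show "ae_rel \<Omega> \<subseteq> L2_fun \<Omega> \<times> L2_fun \<Omega>" by (auto simp: ae_rel_def)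
qed

lemma cls_in: "f \<in> L2_fun \<Omega> \<Longrightarrow> cls \<Omega> f \<in> L2 \<Omega>"
  by (simp add: L2_def cls_def quotientI)

lemma cls_eq_iff: "f \<in> L2_fun \<Omega> \<Longrightarrow> g \<in> L2_fun \<Omega> \<Longrightarrow> cls \<Omega> f = cls \<Omega> g \<longleftrightarrow> lift_fun f = lift_fun g"
  unfolding cls_def by (simp add: eq_equiv_class_iff[OF equiv_ae] lift_fun_eq_iff) (auto simp: ae_rel_def)

lemma rep:
  assumes "F \<in> L2 \<Omega>" shows "rep F \<in> L2_fun \<Omega>" "cls \<Omega> (rep F) = F"
proof -
  obtain f where f: "f \<in> L2_fun \<Omega>" "F = ae_rel \<Omega> `` {f}" using assms by (auto simp: L2_def elim: quotientE)
  then have "f \<in> F" using equiv_class_self[OF equiv_ae] by blast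
  then have "rep F \<in> F" unfolding rep_def by (rule someI[of "\<lambda>f. f \<in> F" f])
  then have r: "(f, rep F) \<in> ae_rel \<Omega>" using f by simp
  then show "rep F \<in> L2_fun \<Omega>" by (simp add: ae_rel_def)
  show "cls \<Omega> (rep F) = F" using equiv_class_eq[OF equiv_ae r] f by (simp add: cls_def)
qed

definition lift :: "'n fclass \<Rightarrow> (real ^ 'n, complex) l2" where "lift F = lift_fun (rep F)"

lemma lift_cls: "f \<in> L2_fun \<Omega> \<Longrightarrow> lift (cls \<Omega> f) = lift_fun f"
  unfolding lift_def using rep[OF cls_in] cls_eq_iff by blast

lemma lift_inj: "F \<in> L2 \<Omega> \<Longrightarrow> G \<in> L2 \<Omega> \<Longrightarrow> lift F = lift G \<longleftrightarrow> F = G"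
  unfolding lift_def using rep cls_eq_iff by metis

lemma cut_lift: "F \<in> L2 \<Omega> \<Longrightarrow> cut \<Omega> (lift F) = lift F"
  unfolding lift_def by (intro cut_lift_fun rep)

lemma lift_surj: "cut \<Omega> w = w \<Longrightarrow> \<exists>F\<in>L2 \<Omega>. lift F = w"
  using L2_fun_of_square_integrable[OF rep_l2[of w]] lift_fun_rep
  by (intro bexI[of _ "cls \<Omega> (rep_l2 w)"]) (auto simp: lift_cls cls_in)

lemma L2_add: 
  assumes "F \<in> L2 \<Omega>" "G \<in> L2 \<Omega>"
  shows "L2_add \<Omega> F G \<in> L2 \<Omega>" "lift (L2_add \<Omega> F G) = lift F + lift G"
proof -
  note r = rep(1)[OF assms(1)] rep(1)[OF assms(2)]
  show "L2_add \<Omega> F G \<in> L2 \<Omega>" unfolding L2_add_def by (intro cls_in L2_fun_add r)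
  show "lift (L2_add \<Omega> F G) = lift F + lift G"
    unfolding L2_add_def lift_cls[OF L2_fun_add[OF r]] lift_fun_add[OF r] lift_def[symmetric] ..
qed

lemma L2_scale: 
  assumes "F \<in> L2 \<Omega>"
  shows "L2_scale \<Omega> a F \<in> L2 \<Omega>" "lift (L2_scale \<Omega> a F) = cscale a (lift F)"
proof -
  note r = rep(1)[OF assms]
  show "L2_scale \<Omega> a F \<in> L2 \<Omega>" unfolding L2_scale_def by (intro cls_in L2_fun_scale r)
  show "lift (L2_scale \<Omega> a F) = cscale a (lift F)"
    unfolding L2_scale_def lift_cls[OF L2_fun_scale[OF r]] lift_fun_scale[OF r] lift_def[symmetric] ..
qed

lemma L2_inner:
  assumes "F \<in> L2 \<Omega>" "G \<in> L2 \<Omega>"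
  shows "Re (L2_inner \<Omega> F G) = lift F \<bullet> lift G" "Im (L2_inner \<Omega> F G) = cscale (- \<i>) (lift F) \<bullet> lift G"
  unfolding L2_inner_def lift_def using assms rep by (simp_all add: integral_mult_L2)

lemma zero_L2: "cls \<Omega> (\<lambda>x. 0) \<in> L2 \<Omega>" "lift (cls \<Omega> (\<lambda>x. 0)) = 0"
proof -
  have z: "(\<lambda>x. 0) \<in> L2_fun \<Omega>" by (simp add: L2_fun_def)
  then show "cls \<Omega> (\<lambda>x. 0) \<in> L2 \<Omega>" by (rule cls_in)
  show "lift (cls \<Omega> (\<lambda>x. 0)) = 0" using lift_cls[OF z] by (simp add: lift_fun_def zero_l2.abs_eq)
qed

section \<open>Test functions and weak derivatives\<close>

lemma continuous_compact_support_L2: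
  fixes f :: "real ^ 'n \<Rightarrow> complex"
  assumes f: "continuous_on UNIV f" and K: "compact K" and supp: "\<And>x. x \<notin> K \<Longrightarrow> f x = 0"
  shows "f \<in> L2_fun \<Omega>"
proof (rule L2_fun_of_square_integrable)
  have "integrable lborel (\<lambda>x. indicator K x *\<^sub>R (norm (f x))\<^sup>2)"
    by (intro borel_integrable_compact K continuous_intros continuous_on_subset[OF f]) auto
  also have "(\<lambda>x. indicator K x *\<^sub>R (norm (f x))\<^sup>2) = (\<lambda>x. (norm (f x))\<^sup>2)"
  proof
    show "indicator K x *\<^sub>R (norm (f x))\<^sup>2 = (norm (f x))\<^sup>2" for x
      using supp[of x] by (cases "x \<in> K") auto
  qed
  finally have "integrable lebesgue (\<lambda>x. (norm (f x))\<^sup>2)" by (simp add: integrable_completion)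
  moreover have "f \<in> borel_measurable borel" using f by (rule borel_measurable_continuous_onI)
  then have "f \<in> borel_measurable lborel" by simp
  then have "f \<in> borel_measurable lebesgue" by (rule measurable_completion)
  ultimately show "square_integrable f" by (simp add: square_integrable_def)
qed

text \<open>
  A test function vanishes on the open complement of its support, and so do its derivatives.
\<close>

lemma test_fun_L2:
  assumes \<phi>: "\<phi> \<in> test_funs \<Omega>"
  shows "\<phi> \<in> L2_fun \<Omega>" "partial_deriv i \<phi> \<in> L2_fun \<Omega>"
proof -
  define K where "K = closure {x. \<phi> x \<noteq> 0}"
  have K: "compact K" using \<phi> by (auto simp: test_funs_def K_def)
  have C: "C_k k \<phi>" for k using \<phi> by (auto simp: test_funs_def)
  have supp: "\<phi> x = 0" if "x \<notin> K" for x using that closure_subset[of "{x. \<phi> x \<noteq> 0}"] by (auto simp: K_def)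
  show "\<phi> \<in> L2_fun \<Omega>" using C[of 0] K supp by (intro continuous_compact_support_L2[of _ K]) auto
  have "continuous_on UNIV (partial_deriv i \<phi>)" using C[of "Suc 0"] by simp
  moreover have "partial_deriv i \<phi> x = 0" if "x \<notin> K" for x
  proof -
    have "open (- K)" using K by (simp add: compact_imp_closed open_Compl)
    then have "(\<phi> has_derivative (\<lambda>h. 0)) (at x)"
      using that supp by (intro has_derivative_transform_within_open[OF has_derivative_const, of "- K" x 0]) auto
    then show ?thesis by (simp add: partial_deriv_unique)
  qed
  ultimately show "partial_deriv i \<phi> \<in> L2_fun \<Omega>" using K by (intro continuous_compact_support_L2[of _ K])
qed

lemma test_funs_scale:
  assumes "\<phi> \<in> test_funs \<Omega>"
  shows "(\<lambda>x. a * \<phi> x) \<in> test_funs \<Omega>" "partial_deriv i (\<lambda>x. a * \<phi> x) = (\<lambda>x. a * partial_deriv i \<phi> x)"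
proof -
  have C: "C_k k \<phi>" for k using assms by (auto simp: test_funs_def)
  have sub: "closure {x. a * \<phi> x \<noteq> 0} \<subseteq> closure {x. \<phi> x \<noteq> 0}" by (intro closure_mono) auto
  moreover have "compact (closure {x. a * \<phi> x \<noteq> 0})"
    using assms sub by (auto simp: test_funs_def compact_eq_bounded_closed intro: bounded_subset)
  ultimately show "(\<lambda>x. a * \<phi> x) \<in> test_funs \<Omega>"
    using assms C by (auto simp: test_funs_def intro!: C_k_mult C_k_const)
  show "partial_deriv i (\<lambda>x. a * \<phi> x) = (\<lambda>x. a * partial_deriv i \<phi> x)"
  proof
    fix x
    have "\<phi> differentiable (at x)" using C[of 1] by simp
    note d = has_derivative_mult_right[OF differentiable_has_derivative[OF this], of a]
    show "partial_deriv i (\<lambda>x. a * \<phi> x) x = a * partial_deriv i \<phi> x"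
      unfolding partial_deriv_unique[OF d] by (simp add: partial_deriv_def)
  qed
qed

lemma test_funs_add:
  assumes "\<phi> \<in> test_funs \<Omega>" "\<psi> \<in> test_funs \<Omega>" shows "(\<lambda>x. \<phi> x + \<psi> x) \<in> test_funs \<Omega>"
proof -
  let ?K = "closure {x. \<phi> x \<noteq> 0} \<union> closure {x. \<psi> x \<noteq> 0}"
  have K: "compact ?K" "?K \<subseteq> \<Omega>" using assms by (auto simp: test_funs_def)
  have sub: "closure {x. \<phi> x + \<psi> x \<noteq> 0} \<subseteq> ?K"
    unfolding closure_Un[symmetric] by (intro closure_mono) auto
  moreover have "compact (closure {x. \<phi> x + \<psi> x \<noteq> 0})"
    using bounded_subset[OF compact_imp_bounded[OF K(1)] sub] by (simp add: compact_eq_bounded_closed)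
  ultimately show ?thesis using assms K by (auto simp: test_funs_def intro!: C_k_add)
qed

end

context open_domain
begin

lemma L2_fun_cnj: "f \<in> L2_fun \<Omega> \<Longrightarrow> (\<lambda>x. cnj (f x)) \<in> L2_fun \<Omega>"
proof -
  assume f: "f \<in> L2_fun \<Omega>"
  have cnj_meas: "cnj \<in> borel_measurable borel" by (intro borel_measurable_continuous_onI continuous_intros)
  have "f \<in> borel_measurable (lebesgue_on \<Omega>)" using f by (simp add: L2_fun_def)
  from measurable_compose[OF this cnj_meas]
  have "(\<lambda>x. cnj (f x)) \<in> borel_measurable (lebesgue_on \<Omega>)" .
  then show ?thesis using f by (simp add: L2_fun_def)
qed

text \<open>
  Conjugation turns the bilinear pairing with a test function into an inner product.
\<close>

definition test_lift :: "(real ^ 'n \<Rightarrow> complex) \<Rightarrow> (real ^ 'n, complex) l2" where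
  "test_lift \<phi> = lift_fun (\<lambda>x. cnj (\<phi> x))"

lemma cscale_test_lift: "\<phi> \<in> L2_fun \<Omega> \<Longrightarrow> cscale a (test_lift \<phi>) = test_lift (\<lambda>x. cnj a * \<phi> x)"
  by (simp add: test_lift_def L2_fun_cnj flip: lift_fun_scale)

lemma integral_pairing:
  assumes "f \<in> L2_fun \<Omega>" "\<phi> \<in> L2_fun \<Omega>"
  shows "integrable (lebesgue_on \<Omega>) (\<lambda>x. f x * \<phi> x)"
    and "Re (LINT x|lebesgue_on \<Omega>. f x * \<phi> x) = lift_fun f \<bullet> test_lift \<phi>"
    and "Im (LINT x|lebesgue_on \<Omega>. f x * \<phi> x) = cscale (- \<i>) (lift_fun f) \<bullet> test_lift \<phi>"
  using integral_mult_L2[OF assms(1) L2_fun_cnj[OF assms(2)]] by (simp_all add: test_lift_def)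

text \<open>
  The equation for weak derivatives, as a family of real linear equations in the Hilbert space. Its
  imaginary part is implied, because test functions may be multiplied by \<open>-\<i>\<close>.
\<close>

definition weak_pair :: "'n \<Rightarrow> (real ^ 'n, complex) l2 \<Rightarrow> (real ^ 'n, complex) l2 \<Rightarrow> bool" where
  "weak_pair i w d \<longleftrightarrow> (\<forall>\<phi>\<in>test_funs \<Omega>. w \<bullet> test_lift (partial_deriv i \<phi>) = - (d \<bullet> test_lift \<phi>))"

lemma weak_pair_scale:
  assumes "weak_pair i w d" shows "weak_pair i (cscale a w) (cscale a d)"
  unfolding weak_pair_def
proof
  fix \<phi> assume \<phi>: "\<phi> \<in> test_funs \<Omega>"
  have "w \<bullet> test_lift (partial_deriv i (\<lambda>x. a * \<phi> x)) = - (d \<bullet> test_lift (\<lambda>x. a * \<phi> x))"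
    using assms test_funs_scale(1)[OF \<phi>] unfolding weak_pair_def by blast
  then show "cscale a w \<bullet> test_lift (partial_deriv i \<phi>) = - (cscale a d \<bullet> test_lift \<phi>)"
    by (simp add: cscale_inner cscale_test_lift test_fun_L2[OF \<phi>] test_funs_scale(2)[OF \<phi>])
qed

lemma weak_pair_add: "weak_pair i w d \<Longrightarrow> weak_pair i w' d' \<Longrightarrow> weak_pair i (w + w') (d + d')"
  by (simp add: weak_pair_def inner_add_left)

lemma is_weak_partial_iff:
  assumes "F \<in> L2 \<Omega>" "D \<in> L2 \<Omega>"
  shows "is_weak_partial \<Omega> i F D \<longleftrightarrow> weak_pair i (lift F) (lift D)"
proof
  assume wp: "is_weak_partial \<Omega> i F D"
  show "weak_pair i (lift F) (lift D)"
    unfolding weak_pair_def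
  proof
    fix \<phi> assume \<phi>: "\<phi> \<in> test_funs \<Omega>"
    then have "(LINT x|lebesgue_on \<Omega>. rep F x * partial_deriv i \<phi> x) = - (LINT x|lebesgue_on \<Omega>. rep D x * \<phi> x)"
      using wp by (simp add: is_weak_partial_def)
    then have "Re (LINT x|lebesgue_on \<Omega>. rep F x * partial_deriv i \<phi> x) = - Re (LINT x|lebesgue_on \<Omega>. rep D x * \<phi> x)"
      by simp
    then show "lift F \<bullet> test_lift (partial_deriv i \<phi>) = - (lift D \<bullet> test_lift \<phi>)"
      by (simp only: integral_pairing rep[OF assms(1)] rep[OF assms(2)] test_fun_L2[OF \<phi>] lift_def)
  qed
next
  assume w: "weak_pair i (lift F) (lift D)"
  note w' = weak_pair_scale[OF w, of "- \<i>"]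
  show "is_weak_partial \<Omega> i F D"
    unfolding is_weak_partial_def
  proof (intro conjI ballI complex_eqI assms)
    fix \<phi> assume \<phi>: "\<phi> \<in> test_funs \<Omega>"
    show "Re (LINT x|lebesgue_on \<Omega>. rep F x * partial_deriv i \<phi> x) = Re (- (LINT x|lebesgue_on \<Omega>. rep D x * \<phi> x))"
      using w \<phi> unfolding weak_pair_def uminus_complex.sel
      by (simp only: integral_pairing rep[OF assms(1)] rep[OF assms(2)] test_fun_L2[OF \<phi>] lift_def)
    show "Im (LINT x|lebesgue_on \<Omega>. rep F x * partial_deriv i \<phi> x) = Im (- (LINT x|lebesgue_on \<Omega>. rep D x * \<phi> x))"
      using w' \<phi> unfolding weak_pair_def uminus_complex.sel
      by (simp only: integral_pairing rep[OF assms(1)] rep[OF assms(2)] test_fun_L2[OF \<phi>] lift_def)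
  qed
qed

text \<open>
  The difference of two weak derivatives has vanishing integral against every test function.
\<close>

lemma is_weak_partial_unique:
  assumes D: "is_weak_partial \<Omega> i F D" and D': "is_weak_partial \<Omega> i F D'" shows "D = D'"
proof -
  have L: "D \<in> L2 \<Omega>" "D' \<in> L2 \<Omega>" using D D' by (auto simp: is_weak_partial_def)
  note r = rep(1)[OF L(1)] rep(1)[OF L(2)]
  let ?d = "\<lambda>x. rep D x + (- 1) * rep D' x"
  have "AE x in lebesgue_on \<Omega>. ?d x = 0"
  proof (rule fundamental_lemma[OF open_\<Omega>])
    show "?d \<in> L2_fun \<Omega>" by (intro L2_fun_add L2_fun_scale r)
    fix \<phi> assume \<phi>: "\<phi> \<in> test_funs \<Omega>"
    note i = integral_pairing(1)[OF r(1) test_fun_L2(1)[OF \<phi>]] integral_pairing(1)[OF r(2) test_fun_L2(1)[OF \<phi>]]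
    have "- (LINT x|lebesgue_on \<Omega>. rep D x * \<phi> x) = - (LINT x|lebesgue_on \<Omega>. rep D' x * \<phi> x)"
      using D D' \<phi> unfolding is_weak_partial_def by metis
    then have "(LINT x|lebesgue_on \<Omega>. rep D x * \<phi> x - rep D' x * \<phi> x) = 0"
      using i by simp
    then show "(LINT x|lebesgue_on \<Omega>. ?d x * \<phi> x) = 0" by (simp add: left_diff_distrib)
  qed
  then have "AE x in lebesgue_on \<Omega>. rep D x = rep D' x" by eventually_elim simp
  then have "lift D = lift D'" using lift_fun_eq_iff[OF r] by (simp add: lift_def)
  then show ?thesis using lift_inj L by blast
qed

lemma weak_partial_eq: "is_weak_partial \<Omega> i F D \<Longrightarrow> weak_partial \<Omega> i F = D"
  unfolding weak_partial_def by (rule the_equality) (assumption, rule is_weak_partial_unique)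

section \<open>The Sobolev space as a closed subspace\<close>

text \<open>
  The component \<open>None\<close> holds the function, the component \<open>Some i\<close> its weak derivative in direction \<open>i\<close>; the
  euclidean norm of this vector is the Sobolev norm.
\<close>

definition J :: "'n fclass \<Rightarrow> (real ^ 'n, complex) l2 ^ 'n option" where
  "J F = (\<chi> k. case k of None \<Rightarrow> lift F | Some i \<Rightarrow> lift (weak_partial \<Omega> i F))"

definition sc :: "complex \<Rightarrow> (real ^ 'n, complex) l2 ^ 'n option \<Rightarrow> (real ^ 'n, complex) l2 ^ 'n option" where
  "sc a u = (\<chi> k. cscale a (u $ k))"

lemma H1_carrier: "F \<in> carrier (H1 \<Omega>) \<longleftrightarrow> F \<in> L2 \<Omega> \<and> (\<forall>i. \<exists>D. is_weak_partial \<Omega> i F D)"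
  by (simp add: H1_def)

lemma H1_weak_partial:
  assumes "F \<in> carrier (H1 \<Omega>)"
  shows "F \<in> L2 \<Omega>" "is_weak_partial \<Omega> i F (weak_partial \<Omega> i F)" "weak_partial \<Omega> i F \<in> L2 \<Omega>"
proof -
  show "F \<in> L2 \<Omega>" using assms by (simp add: H1_carrier)
  obtain D where "is_weak_partial \<Omega> i F D" using assms by (auto simp: H1_carrier)
  then show "is_weak_partial \<Omega> i F (weak_partial \<Omega> i F)" using weak_partial_eq by metis
  then show "weak_partial \<Omega> i F \<in> L2 \<Omega>" by (simp add: is_weak_partial_def)
qed

lemma weak_pair_H1: "F \<in> carrier (H1 \<Omega>) \<Longrightarrow> weak_pair i (lift F) (lift (weak_partial \<Omega> i F))"
  using H1_weak_partial is_weak_partial_iff by blast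

lemma H1_I:
  assumes F: "F \<in> L2 \<Omega>" and D: "\<And>i. D i \<in> L2 \<Omega>" "\<And>i. weak_pair i (lift F) (lift (D i))"
  shows "F \<in> carrier (H1 \<Omega>)" "J F = (\<chi> k. case k of None \<Rightarrow> lift F | Some i \<Rightarrow> lift (D i))"
proof -
  have wp: "is_weak_partial \<Omega> i F (D i)" for i using is_weak_partial_iff F D by blast
  then show "F \<in> carrier (H1 \<Omega>)" using F by (auto simp: H1_carrier)
  show "J F = (\<chi> k. case k of None \<Rightarrow> lift F | Some i \<Rightarrow> lift (D i))"
    unfolding J_def weak_partial_eq[OF wp] ..
qed

lemma H1_add:
  assumes "F \<in> carrier (H1 \<Omega>)" "G \<in> carrier (H1 \<Omega>)"
  shows "L2_add \<Omega> F G \<in> carrier (H1 \<Omega>)" "J (L2_add \<Omega> F G) = J F + J G"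
proof -
  let ?D = "\<lambda>i. L2_add \<Omega> (weak_partial \<Omega> i F) (weak_partial \<Omega> i G)"
  note H = H1_weak_partial[OF assms(1)] H1_weak_partial[OF assms(2)]
  have w: "weak_pair i (lift (L2_add \<Omega> F G)) (lift (?D i))" for i
    using assms by (simp add: L2_add H weak_pair_add weak_pair_H1)
  note * = H1_I[of "L2_add \<Omega> F G" ?D, OF L2_add(1)[OF H(1,4)] L2_add(1)[OF H(3,6)] w]
  show "L2_add \<Omega> F G \<in> carrier (H1 \<Omega>)" by (rule *)
  show "J (L2_add \<Omega> F G) = J F + J G"
    unfolding *(2) by (simp add: J_def vec_eq_iff L2_add H split: option.split)
qed

lemma H1_scale:
  assumes "F \<in> carrier (H1 \<Omega>)"
  shows "L2_scale \<Omega> a F \<in> carrier (H1 \<Omega>)" "J (L2_scale \<Omega> a F) = sc a (J F)"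
proof -
  let ?D = "\<lambda>i. L2_scale \<Omega> a (weak_partial \<Omega> i F)"
  note H = H1_weak_partial[OF assms(1)]
  have w: "weak_pair i (lift (L2_scale \<Omega> a F)) (lift (?D i))" for i
    using assms by (simp add: L2_scale H weak_pair_scale weak_pair_H1)
  note * = H1_I[of "L2_scale \<Omega> a F" ?D, OF L2_scale(1)[OF H(1)] L2_scale(1)[OF H(3)] w]
  show "L2_scale \<Omega> a F \<in> carrier (H1 \<Omega>)" by (rule *)
  show "J (L2_scale \<Omega> a F) = sc a (J F)"
    unfolding *(2) by (simp add: J_def sc_def vec_eq_iff L2_scale H split: option.split)
qed

lemma H1_zero: "cls \<Omega> (\<lambda>x. 0) \<in> carrier (H1 \<Omega>)" "J (cls \<Omega> (\<lambda>x. 0)) = 0"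
proof -
  have w: "weak_pair i (lift (cls \<Omega> (\<lambda>x. 0))) (lift (cls \<Omega> (\<lambda>x. 0)))" for i
    by (simp add: zero_L2 weak_pair_def)
  note * = H1_I[of _ "\<lambda>i. cls \<Omega> (\<lambda>x. 0)", OF zero_L2(1) zero_L2(1) w]
  show "cls \<Omega> (\<lambda>x. 0) \<in> carrier (H1 \<Omega>)" by (rule *)
  show "J (cls \<Omega> (\<lambda>x. 0)) = 0" unfolding *(2) by (simp add: vec_eq_iff zero_L2 split: option.split)
qed

lemma J_inj: "inj_on J (carrier (H1 \<Omega>))"
proof (rule inj_onI)
  fix F G assume "F \<in> carrier (H1 \<Omega>)" "G \<in> carrier (H1 \<Omega>)" "J F = J G"
  then have "J F $ None = J G $ None" by simp
  then have "lift F = lift G" by (simp add: J_def)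
  then show "F = G" using lift_inj H1_weak_partial(1) \<open>F \<in> _\<close> \<open>G \<in> _\<close> by blast
qed

lemma J_norm:
  assumes "F \<in> carrier (H1 \<Omega>)" shows "vnorm (H1 \<Omega>) F = norm (J F)"
proof -
  have eq: "Re (L2_inner \<Omega> G G) = (norm (lift G))\<^sup>2" if "G \<in> L2 \<Omega>" for G
    using L2_inner[OF that that] by (simp add: power2_norm_eq_inner)
  note H = H1_weak_partial[OF assms]
  have "Re (H1_inner \<Omega> F F) = (norm (lift F))\<^sup>2 + (\<Sum>i\<in>UNIV. (norm (lift (weak_partial \<Omega> i F)))\<^sup>2)"
    by (simp add: H1_inner_def eq H)
  also have "\<dots> = (\<Sum>k\<in>UNIV. (norm (J F $ k))\<^sup>2)"
    by (simp add: UNIV_option_conv sum.reindex J_def)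
  finally show ?thesis by (simp add: H1_def norm_vec_def L2_set_def)
qed

lemma sc_laws:
  "sc a (u + v) = sc a u + sc a v" "sc (a + b) u = sc a u + sc b u" "sc (a * b) u = sc a (sc b u)"
  "sc 1 u = u" "sc (of_real r) u = r *\<^sub>R u" "norm (sc a u) = norm a * norm u"
proof -
  have "(\<Sum>k\<in>UNIV. (norm (cscale a (u $ k)))\<^sup>2) = (norm a)\<^sup>2 * (\<Sum>k\<in>UNIV. (norm (u $ k))\<^sup>2)"
    by (simp add: norm_cscale power_mult_distrib sum_distrib_left)
  then show "norm (sc a u) = norm a * norm u"
    by (simp add: norm_vec_def L2_set_def sc_def real_sqrt_mult)
qed (simp_all add: sc_def vec_eq_iff cscale_laws)

definition H1_range :: "((real ^ 'n, complex) l2 ^ 'n option) set" where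
  "H1_range = {u. (\<forall>k. cut \<Omega> (u $ k) = u $ k) \<and> (\<forall>i. weak_pair i (u $ None) (u $ Some i))}"

lemma J_range: "J ` carrier (H1 \<Omega>) = H1_range"
proof (intro equalityI subsetI)
  fix u assume "u \<in> J ` carrier (H1 \<Omega>)"
  then obtain F where F: "F \<in> carrier (H1 \<Omega>)" "u = J F" by blast
  then show "u \<in> H1_range"
    using H1_weak_partial[OF F(1)] weak_pair_H1[OF F(1)]
    by (auto simp: H1_range_def J_def cut_lift split: option.split)
next
  fix u assume u: "u \<in> H1_range"
  then have "\<forall>k. \<exists>F\<in>L2 \<Omega>. lift F = u $ k" using lift_surj by (simp add: H1_range_def)
  then obtain F where F: "\<And>k. F k \<in> L2 \<Omega>" "\<And>k. lift (F k) = u $ k" by metis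
  have "weak_pair i (lift (F None)) (lift (F (Some i)))" for i using u F by (simp add: H1_range_def)
  note * = H1_I[of "F None" "\<lambda>i. F (Some i)", OF F(1) F(1) this]
  have "J (F None) = u" unfolding *(2) by (simp add: vec_eq_iff F(2) split: option.split)
  then show "u \<in> J ` carrier (H1 \<Omega>)" using *(1) by blast
qed

text \<open>
  The range is cut out by fixed points of continuous maps and by linear equations with continuous
  coefficients.
\<close>

lemma closed_H1_range: "closed H1_range"
proof -
  have eq: "H1_range = (\<Inter>k. {u. cut \<Omega> (u $ k) = u $ k}) \<inter>
      (\<Inter>i. \<Inter>\<phi>\<in>test_funs \<Omega>. {u. u $ None \<bullet> test_lift (partial_deriv i \<phi>) = - (u $ Some i \<bullet> test_lift \<phi>)})"
    by (auto simp: H1_range_def weak_pair_def)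
  have coord: "continuous_on UNIV (\<lambda>u :: (real ^ 'n, complex) l2 ^ 'n option. u $ k)" for k
    by (rule linear_continuous_on) (rule bounded_linear_vec_nth)
  have "continuous_on UNIV (\<lambda>u :: (real ^ 'n, complex) l2 ^ 'n option. cut \<Omega> (u $ k))" for k
    by (rule bounded_linear.continuous_on[OF bounded_linear_cut coord])
  then have 1: "closed {u :: (real ^ 'n, complex) l2 ^ 'n option. cut \<Omega> (u $ k) = u $ k}" for k
    using coord by (rule closed_Collect_eq)
  have inn: "continuous_on UNIV (\<lambda>u :: (real ^ 'n, complex) l2 ^ 'n option. u $ k \<bullet> t)" for k t
    by (rule continuous_on_inner[OF coord continuous_on_const])
  have 2: "closed {u :: (real ^ 'n, complex) l2 ^ 'n option.
      u $ None \<bullet> test_lift (partial_deriv i \<phi>) = - (u $ Some i \<bullet> test_lift \<phi>)}" for i \<phi>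
    by (rule closed_Collect_eq[OF inn continuous_on_minus[OF inn]])
  show ?thesis unfolding eq by (intro closed_Int closed_INT ballI 1 2)
qed

sublocale H1: nvs_embedding "H1 \<Omega>" sc J
proof
  show "vadd (H1 \<Omega>) F G \<in> carrier (H1 \<Omega>)" "J (vadd (H1 \<Omega>) F G) = J F + J G"
    if "F \<in> carrier (H1 \<Omega>)" "G \<in> carrier (H1 \<Omega>)" for F G
    using H1_add[OF that] by (simp_all add: H1_def)
  show "vscale (H1 \<Omega>) a F \<in> carrier (H1 \<Omega>)" "J (vscale (H1 \<Omega>) a F) = sc a (J F)"
    if "F \<in> carrier (H1 \<Omega>)" for a F
    using H1_scale[OF that] by (simp_all add: H1_def)
  show "vzero (H1 \<Omega>) \<in> carrier (H1 \<Omega>)" "J (vzero (H1 \<Omega>)) = 0"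
    using H1_zero by (simp_all add: H1_def)
qed (auto simp: J_inj J_norm sc_laws)

text \<open>
  The classes of test functions, as far as they belong to the carrier: the closure in a topological space
  only sees the points of the space.
\<close>

definition test_range :: "((real ^ 'n, complex) l2 ^ 'n option) set" where
  "test_range = J ` (cls \<Omega> ` test_funs \<Omega> \<inter> carrier (H1 \<Omega>))"

lemma H10_carrier: "carrier (H10 \<Omega>) = {F \<in> carrier (H1 \<Omega>). J F \<in> closure test_range}"
proof -
  have "F \<in> norm_topology (H1 \<Omega>) closure_of (cls \<Omega> ` test_funs \<Omega>) \<longleftrightarrow>
      F \<in> carrier (H1 \<Omega>) \<and> J F \<in> closure test_range" for F
    unfolding test_range_def by (rule H1.closure_of_norm_topology)
  then show ?thesis by (auto simp: H10_def)
qed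

text \<open>
  The closure stays in the range of the larger space because that range is closed.
\<close>

lemma J_H10_range: "J ` carrier (H10 \<Omega>) = closure test_range"
proof -
  have "test_range \<subseteq> H1_range" unfolding test_range_def J_range[symmetric] by blast
  then have "closure test_range \<subseteq> J ` carrier (H1 \<Omega>)"
    unfolding J_range by (intro closure_minimal closed_H1_range)
  then show ?thesis by (auto simp: H10_carrier)
qed

lemma test_fun_cls:
  assumes "\<phi> \<in> test_funs \<Omega>" "\<psi> \<in> test_funs \<Omega>"
  shows "L2_add \<Omega> (cls \<Omega> \<phi>) (cls \<Omega> \<psi>) = cls \<Omega> (\<lambda>x. \<phi> x + \<psi> x)"
    and "L2_scale \<Omega> a (cls \<Omega> \<phi>) = cls \<Omega> (\<lambda>x. a * \<phi> x)"
proof -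
  note L = test_fun_L2(1)[OF assms(1)] test_fun_L2(1)[OF assms(2)]
  show "L2_add \<Omega> (cls \<Omega> \<phi>) (cls \<Omega> \<psi>) = cls \<Omega> (\<lambda>x. \<phi> x + \<psi> x)"
    using L by (subst lift_inj[symmetric]) (simp_all add: L2_add cls_in L2_fun_add lift_cls lift_fun_add)
  show "L2_scale \<Omega> a (cls \<Omega> \<phi>) = cls \<Omega> (\<lambda>x. a * \<phi> x)"
    using L by (subst lift_inj[symmetric]) (simp_all add: L2_scale cls_in L2_fun_scale lift_cls lift_fun_scale)
qed

lemma test_range_add: "u \<in> test_range \<Longrightarrow> v \<in> test_range \<Longrightarrow> u + v \<in> test_range"
proof -
  assume "u \<in> test_range" "v \<in> test_range"
  then obtain \<phi> \<psi> where *: "\<phi> \<in> test_funs \<Omega>" "cls \<Omega> \<phi> \<in> carrier (H1 \<Omega>)" "u = J (cls \<Omega> \<phi>)"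
    "\<psi> \<in> test_funs \<Omega>" "cls \<Omega> \<psi> \<in> carrier (H1 \<Omega>)" "v = J (cls \<Omega> \<psi>)"
    by (auto simp: test_range_def)
  have "u + v = J (cls \<Omega> (\<lambda>x. \<phi> x + \<psi> x))" "cls \<Omega> (\<lambda>x. \<phi> x + \<psi> x) \<in> carrier (H1 \<Omega>)"
    using H1_add[OF *(2,5)] test_fun_cls(1)[OF *(1,4)] * by simp_all
  then show ?thesis using test_funs_add[OF *(1,4)] by (auto simp: test_range_def)
qed

lemma test_range_sc: "u \<in> test_range \<Longrightarrow> sc a u \<in> test_range"
proof -
  assume "u \<in> test_range"
  then obtain \<phi> where *: "\<phi> \<in> test_funs \<Omega>" "cls \<Omega> \<phi> \<in> carrier (H1 \<Omega>)" "u = J (cls \<Omega> \<phi>)"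
    by (auto simp: test_range_def)
  have "sc a u = J (cls \<Omega> (\<lambda>x. a * \<phi> x))" "cls \<Omega> (\<lambda>x. a * \<phi> x) \<in> carrier (H1 \<Omega>)"
    using H1_scale[OF *(2), of a] test_fun_cls(2)[OF *(1,1), of a] * by simp_all
  then show ?thesis using test_funs_scale(1)[OF *(1), of a] by (auto simp: test_range_def)
qed

lemma test_range_zero: "0 \<in> test_range"
proof -
  have "(\<lambda>x. 0) \<in> test_funs \<Omega>" by (simp add: test_funs_def C_k_const)
  then have "J (cls \<Omega> (\<lambda>x. 0)) \<in> test_range" using H1_zero(1) by (auto simp: test_range_def)
  then show ?thesis by (simp add: H1_zero)
qed

lemma bounded_linear_sc: "bounded_linear (sc a)"
proof (rule bounded_linear_intro[of _ "norm a"])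
  show "sc a (r *\<^sub>R u) = r *\<^sub>R sc a u" for r u
    by (simp add: mult.commute flip: sc_laws(3,5))
qed (auto simp: sc_laws)

lemma closure_test_range_add:
  assumes "u \<in> closure test_range" "v \<in> closure test_range" shows "u + v \<in> closure test_range"
proof -
  obtain f g where "\<And>n. f n \<in> test_range" "f \<longlonglongrightarrow> u" "\<And>n. g n \<in> test_range" "g \<longlonglongrightarrow> v"
    using assms unfolding closure_sequential by blast
  then have "(\<lambda>n. f n + g n) \<longlonglongrightarrow> u + v" "\<And>n. f n + g n \<in> test_range"
    by (auto intro: tendsto_add test_range_add)
  then show ?thesis unfolding closure_sequential by (intro exI[of _ "\<lambda>n. f n + g n"]) simp
qed

lemma closure_test_range_sc:
  assumes "u \<in> closure test_range" shows "sc a u \<in> closure test_range"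
proof -
  obtain f where "\<And>n. f n \<in> test_range" "f \<longlonglongrightarrow> u"
    using assms unfolding closure_sequential by blast
  then have "(\<lambda>n. sc a (f n)) \<longlonglongrightarrow> sc a u" "\<And>n. sc a (f n) \<in> test_range"
    by (auto intro: bounded_linear.tendsto[OF bounded_linear_sc] test_range_sc)
  then show ?thesis unfolding closure_sequential by (intro exI[of _ "\<lambda>n. sc a (f n)"]) simp
qed

lemma H10_embedding: "nvs_embedding (H10 \<Omega>) sc J"
proof
  have sub: "F \<in> carrier (H1 \<Omega>)" if "F \<in> carrier (H10 \<Omega>)" for F using that by (simp add: H10_carrier)
  have sel: "vadd (H10 \<Omega>) = vadd (H1 \<Omega>)" "vscale (H10 \<Omega>) = vscale (H1 \<Omega>)" "vzero (H10 \<Omega>) = vzero (H1 \<Omega>)"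
    "vnorm (H10 \<Omega>) = vnorm (H1 \<Omega>)"
    by (simp_all add: H10_def)
  show "inj_on J (carrier (H10 \<Omega>))" using J_inj by (rule inj_on_subset) (use sub in blast)
  show "vadd (H10 \<Omega>) F G \<in> carrier (H10 \<Omega>)" "J (vadd (H10 \<Omega>) F G) = J F + J G"
    if "F \<in> carrier (H10 \<Omega>)" "G \<in> carrier (H10 \<Omega>)" for F G
    using that by (simp_all add: sel H10_carrier H1.add_closed H1.J_add closure_test_range_add)
  show "vscale (H10 \<Omega>) a F \<in> carrier (H10 \<Omega>)" "J (vscale (H10 \<Omega>) a F) = sc a (J F)"
    if "F \<in> carrier (H10 \<Omega>)" for a F
    using that by (simp_all add: sel H10_carrier H1.scale_closed H1.J_scale closure_test_range_sc)
  show "vzero (H10 \<Omega>) \<in> carrier (H10 \<Omega>)" "J (vzero (H10 \<Omega>)) = 0"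
    using test_range_zero closure_subset by (auto simp: sel H10_carrier H1.zero_closed H1.J_zero)
  show "vnorm (H10 \<Omega>) F = norm (J F)" if "F \<in> carrier (H10 \<Omega>)" for F
    using that by (simp add: sel H10_carrier J_norm)
qed (auto simp: sc_laws)

sublocale H10: hilbert_model "H10 \<Omega>" sc J "\<lambda>u v. (u $ None) \<bullet> (v $ None)" "L2_inner \<Omega>"
proof (intro hilbert_model.intro hilbert_model_axioms.intro H10_embedding)
  show "closed (J ` carrier (H10 \<Omega>))" by (simp add: J_H10_range)
  show "sc (of_real r) u = r *\<^sub>R u" for r u by (rule sc_laws)
  show "bounded_bilinear (\<lambda>(u :: (real ^ 'n, complex) l2 ^ 'n option) v. (u $ None) \<bullet> (v $ None))"
    by (rule bounded_bilinear.comp[OF bounded_bilinear_inner]) (rule bounded_linear_vec_nth)+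
  show "Re (L2_inner \<Omega> F G) = J F $ None \<bullet> J G $ None"
    "Im (L2_inner \<Omega> F G) = sc (- \<i>) (J F) $ None \<bullet> J G $ None"
    if "F \<in> carrier (H10 \<Omega>)" "G \<in> carrier (H10 \<Omega>)" for F G
    using that by (simp_all add: H10_carrier H1_carrier L2_inner J_def sc_def)
qed

end

section \<open>The group of isometries for the inner product of square integrable functions\<close>

theorem proposition3p4:
  fixes \<Omega> :: "(real ^ 'n) set"
  assumes "open \<Omega>"
  shows "real_banach_lie_group (L2_isometry_group \<Omega>)
           (subtopology (norm_topology (op_space (H10 \<Omega>))) (carrier (L2_isometry_group \<Omega>)))"
proof -
  interpret open_domain \<Omega> by standard (rule assms)
  have "carrier (L2_isometry_group \<Omega>) = H10.isometries"
    by (simp add: L2_isometry_group_def H10.isometries_def)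
  moreover have "L2_isometry_group \<Omega> = (op_Gl (H10 \<Omega>))\<lparr>carrier := H10.isometries\<rparr>"
    by (simp add: L2_isometry_group_def H10.isometries_def)
  ultimately show ?thesis using H10.isometries_lie_group by simp
qed

end
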